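(* Let $n \geq 3$ and $t \geq 1$ be integers, let $k$ be an arbitrary field and let $R = k[x_1,\dots,x_n]$. Then the monomial ideal $I_{n,t} = \langle \mathbf{x}^{e_1},\dots,\mathbf{x}^{e_n}\rangle$ of $R$, where $\mathbf{x}^{e_i} = \prod_{j \in \{1,\dots,n\},\, j\neq i} x_j^t$, is Cohen-Macaulay.
   Context: For $i \in \{1,\dots,n\}$, $e_i = (t,\dots,t,0,t,\dots,t)$ is the $n$-tuple with $0$ in the $i$-th coordinate and $t$ in all other coordinates, and $\mathbf{x}^{e_i} = x_1^t\cdots x_{i-1}^t x_{i+1}^t\cdots x_n^t$ is the corresponding monomial. An ideal $I$ of $R$ is called Cohen-Macaulay if the quotient ring $R/I$ is Cohen-Macaulay. *)

theory Defs
  imports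
    "HOL-Algebra.Ring_Divisibility"
    "HOL-Algebra.Algebraic_Closure_Type"
    "HOL-Library.Poly_Mapping"
    "HOL-Library.Extended_Nat"
begin

section \<open>Localization of a commutative ring\<close>

definition frac_rel :: "('a, 'b) ring_scheme \<Rightarrow> 'a set \<Rightarrow> (('a \<times> 'a) \<times> ('a \<times> 'a)) set" where
  "frac_rel R S = {((a, s), (b, t)) | a s b t.
     a \<in> carrier R \<and> s \<in> S \<and> b \<in> carrier R \<and> t \<in> S \<and>
     (\<exists>u\<in>S. u \<otimes>\<^bsub>R\<^esub> (a \<otimes>\<^bsub>R\<^esub> t) = u \<otimes>\<^bsub>R\<^esub> (b \<otimes>\<^bsub>R\<^esub> s))}"

definition frac_class :: "('a, 'b) ring_scheme \<Rightarrow> 'a set \<Rightarrow> 'a \<Rightarrow> 'a \<Rightarrow> ('a \<times> 'a) set" where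
  "frac_class R S a s = frac_rel R S `` {(a, s)}"

text \<open>Here \<open>S\<close> is meant to be a multiplicatively closed subset of \<open>carrier R\<close> containing one.\<close>

definition localization :: "('a, 'b) ring_scheme \<Rightarrow> 'a set \<Rightarrow> ('a \<times> 'a) set ring" where
  "localization R S =
    \<lparr>carrier = (carrier R \<times> S) // frac_rel R S,
     monoid.mult = (\<lambda>U V. \<Union>(a, s)\<in>U. \<Union>(b, t)\<in>V. frac_class R S (a \<otimes>\<^bsub>R\<^esub> b) (s \<otimes>\<^bsub>R\<^esub> t)),
     one = frac_class R S \<one>\<^bsub>R\<^esub> \<one>\<^bsub>R\<^esub>,
     ring.zero = frac_class R S \<zero>\<^bsub>R\<^esub> \<one>\<^bsub>R\<^esub>,
     add = (\<lambda>U V. \<Union>(a, s)\<in>U. \<Union>(b, t)\<in>V.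
       frac_class R S (a \<otimes>\<^bsub>R\<^esub> t \<oplus>\<^bsub>R\<^esub> b \<otimes>\<^bsub>R\<^esub> s) (s \<otimes>\<^bsub>R\<^esub> t))\<rparr>"

definition localization_at :: "('a, 'b) ring_scheme \<Rightarrow> 'a set \<Rightarrow> ('a \<times> 'a) set ring" where
  "localization_at R P = localization R (carrier R - P)"


section \<open>Dimension, depth and the Cohen-Macaulay property\<close>

definition krull_dim :: "('a, 'b) ring_scheme \<Rightarrow> enat" where
  "krull_dim R = Sup {enat d | d. \<exists>P :: nat \<Rightarrow> 'a set.
     (\<forall>i\<le>d. primeideal (P i) R) \<and> (\<forall>i<d. P i \<subset> P (Suc i))}"

text \<open>The first condition says that each \<open>xs ! i\<close> is a nonzerodivisor on the quotient of \<open>R\<close> by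
  the ideal generated by its predecessors.\<close>

definition regular_sequence :: "('a, 'b) ring_scheme \<Rightarrow> 'a list \<Rightarrow> bool" where
  "regular_sequence R xs \<longleftrightarrow> set xs \<subseteq> carrier R \<and>
     (\<forall>i<length xs. \<forall>a\<in>carrier R.
        xs ! i \<otimes>\<^bsub>R\<^esub> a \<in> Idl\<^bsub>R\<^esub> (set (take i xs)) \<longrightarrow> a \<in> Idl\<^bsub>R\<^esub> (set (take i xs))) \<and>
     Idl\<^bsub>R\<^esub> (set xs) \<noteq> carrier R"

text \<open>Only meaningful if \<open>R\<close> is local, that is, has exactly one maximal ideal.\<close>

definition local_depth :: "('a, 'b) ring_scheme \<Rightarrow> enat" where
  "local_depth R = Sup {enat (length xs) | xs.
     regular_sequence R xs \<and> set xs \<subseteq> (THE M. maximalideal M R)}"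

definition cohen_macaulay_ring :: "('a, 'b) ring_scheme \<Rightarrow> bool" where
  "cohen_macaulay_ring R \<longleftrightarrow> cring R \<and> noetherian_ring R \<and>
     (\<forall>M. maximalideal M R \<longrightarrow>
        local_depth (localization_at R M) = krull_dim (localization_at R M))"

definition cohen_macaulay_ideal :: "'a set \<Rightarrow> ('a, 'b) ring_scheme \<Rightarrow> bool" where
  "cohen_macaulay_ideal I R \<longleftrightarrow> ideal I R \<and> cohen_macaulay_ring (R Quot I)"


section \<open>Polynomial rings and the monomial ideals\<close>

text \<open>A monomial is a finitely supported exponent function on variable indices. The polynomial
  ring in the variables with indices \<open>1, \<dots>, n\<close> is the subring of the ring of all polynomials in
  countably many variables whose monomials involve only these indices.\<close>

definition polynomial_ring :: "nat \<Rightarrow> ((nat \<Rightarrow>\<^sub>0 nat) \<Rightarrow>\<^sub>0 'k::field) ring" where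
  "polynomial_ring n =
     ring_of_type_algebra\<lparr>carrier := {p. \<forall>m\<in>Poly_Mapping.keys p. Poly_Mapping.keys m \<subseteq> {1..n}}\<rparr>"

definition indet :: "nat \<Rightarrow> (nat \<Rightarrow>\<^sub>0 nat) \<Rightarrow>\<^sub>0 'k::field" where
  "indet j = Poly_Mapping.single (Poly_Mapping.single j 1) 1"

definition generator :: "nat \<Rightarrow> nat \<Rightarrow> nat \<Rightarrow> (nat \<Rightarrow>\<^sub>0 nat) \<Rightarrow>\<^sub>0 'k::field" where
  "generator n t i = (\<Prod>j\<in>{1..n} - {i}. indet j ^ t)"

definition monomial_ideal :: "nat \<Rightarrow> nat \<Rightarrow> ((nat \<Rightarrow>\<^sub>0 nat) \<Rightarrow>\<^sub>0 'k::field) set" where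
  "monomial_ideal n t = Idl\<^bsub>polynomial_ring n\<^esub> (generator n t ` {1..n})"

end

theory Submission
  imports Defs
begin

text \<open>Write \<open>a\<^sub>i = x\<^sub>i\<^sup>t\<close>, so that the generators are the products \<open>G\<^sub>i\<close> of all \<open>a\<^sub>j\<close> with \<open>j \<noteq> i\<close>. A relation
  \<open>\<Sum>c\<^sub>i G\<^sub>i = 0\<close> over a ring in which the \<open>a\<^sub>i\<close> pairwise form regular sequences has \<open>c\<^sub>i = d\<^sub>i a\<^sub>i\<close> with
  \<open>\<Sum>d\<^sub>i = 0\<close>. Hence an element that is regular on the ambient ring stays regular modulo the ideal,
  provided that the \<open>a\<^sub>i\<close> remain pairwise regular modulo it.

  Let \<open>M\<close> be a prime containing the ideal and let \<open>T\<close> be a maximal set of variables that are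
  algebraically independent modulo \<open>M\<close>, with complement \<open>S\<close>. Each \<open>x\<^sub>i\<close> with \<open>i \<in> S\<close> has a multiple
  \<open>u\<^sub>i = x\<^sub>i\<^sup>t Q\<^sub>i \<in> M\<close> that involves no variables besides \<open>x\<^sub>i\<close> and those in \<open>T\<close>. The complete homogeneous
  symmetric polynomials of degrees \<open>1, \<dots>, card S - 2\<close> in the \<open>u\<^sub>i\<close> form a regular sequence of the
  required kind: \<open>u\<^sub>i\<close> vanishes modulo \<open>a\<^sub>i\<close>, and \<open>h\<^sub>1, \<dots>, h\<^sub>k\<close> generate the same ideal as
  \<open>h\<^sub>1(u\<^sub>1, \<dots>, u\<^sub>m), h\<^sub>2(u\<^sub>1, \<dots>, u\<^sub>m\<^sub>-\<^sub>1), \<dots>\<close>, which is triangular with nonzero leading coefficients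
  in the variables \<open>T\<close>, units of the localization.

  Conversely, a chain of \<open>d + 1\<close> primes inside \<open>M\<close> satisfies \<open>d + card T \<le> n - 2\<close>: its smallest prime contains
  two variables, and \<open>d\<close> elements witnessing the strict inclusions together with the variables in \<open>T\<close>
  are algebraically independent modulo it. So depth and dimension agree at every maximal ideal, without any
  appeal to the Nullstellensatz.\<close>

subsection \<open>Polynomials\<close>

type_synonym 'k mpoly = "(nat \<Rightarrow>\<^sub>0 nat) \<Rightarrow>\<^sub>0 'k"

abbreviation keys where "keys \<equiv> Poly_Mapping.keys"
abbreviation lookup where "lookup \<equiv> Poly_Mapping.lookup"
abbreviation single where "single \<equiv> Poly_Mapping.single"

definition Const :: "'k::field \<Rightarrow> 'k mpoly" where "Const c = single 0 c"

definition power_product :: "(nat \<Rightarrow> 'b::comm_ring_1) \<Rightarrow> (nat \<Rightarrow>\<^sub>0 nat) \<Rightarrow> 'b" where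
  "power_product F m = (\<Prod>j\<in>keys m. F j ^ lookup m j)"

text \<open>The coefficient map is a parameter, so that one definition covers substitution of
  polynomials (\<open>subst\<close>) and the passage to univariate polynomials over polynomials
  (\<open>univ\<close>).\<close>

definition eval_with :: "('k::field \<Rightarrow> 'b::comm_ring_1) \<Rightarrow> (nat \<Rightarrow> 'b) \<Rightarrow> 'k mpoly \<Rightarrow> 'b" where
  "eval_with \<phi> F p = (\<Sum>m\<in>keys p. \<phi> (lookup p m) * power_product F m)"

text \<open>Subrings on different sets of variables are sets within one type and can be compared by
  inclusion; \<open>polys {1..n}\<close> is the carrier of \<open>polynomial_ring n\<close>.\<close>

definition polys :: "nat set \<Rightarrow> 'k::field mpoly set" where
  "polys V = {p. \<forall>m\<in>keys p. keys m \<subseteq> V}"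

lemma power_product_superset:
  assumes "finite A" "keys m \<subseteq> A"
  shows "power_product F m = (\<Prod>j\<in>A. F j ^ lookup m j)"
  unfolding power_product_def using assms
  by (intro prod.mono_neutral_left) (auto simp: in_keys_iff)

lemma power_product_add: "power_product F (m + m') = power_product F m * power_product F m'"
proof -
  let ?A = "keys m \<union> keys m'"
  have "keys (m + m') \<subseteq> ?A" by (rule Poly_Mapping.keys_add)
  then show ?thesis
    by (simp add: power_product_superset[of ?A] lookup_add power_add prod.distrib)
qed

lemma power_product_0 [simp]: "power_product F 0 = 1"
  by (simp add: power_product_def)

lemma power_product_single [simp]: "power_product F (single j e) = F j ^ e"
  by (simp add: power_product_def)

lemma mpoly_induct [case_names single add]:
  fixes p :: "'k::field mpoly"
  assumes "\<And>m c. Q (single m c)" "\<And>p q. Q p \<Longrightarrow> Q q \<Longrightarrow> Q (p + q)"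
  shows "Q p"
proof (induction p rule: Poly_Mapping.update_induct)
  case const
  show ?case using assms(1)[of 0 0] by simp
next
  case (update f a b)
  \<comment> \<open>The induction supplies a key \<open>a\<close> outside the support of
    \<open>f\<close>, so overwriting at \<open>a\<close> is adding a monomial.\<close>
  have "Poly_Mapping.update a b f = f + single a b"
    using update(1)
    by (intro poly_mapping_eqI) (auto simp: lookup_update lookup_add lookup_single when_def in_keys_iff)
  then show ?case using assms update by metis
qed

section \<open>Evaluation along a ring homomorphism on the coefficients\<close>

locale coeff_hom =
  fixes \<phi> :: "'k::field \<Rightarrow> 'b::comm_ring_1"
  assumes hom_0 [simp]: "\<phi> 0 = 0" and hom_1 [simp]: "\<phi> 1 = 1"
    and hom_add: "\<phi> (a + b) = \<phi> a + \<phi> b" and hom_mult: "\<phi> (a * b) = \<phi> a * \<phi> b"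
begin

lemma eval_superset:
  assumes "finite A" "keys p \<subseteq> A"
  shows "eval_with \<phi> F p = (\<Sum>m\<in>A. \<phi> (lookup p m) * power_product F m)"
  unfolding eval_with_def using assms
  by (intro sum.mono_neutral_left) (auto simp: in_keys_iff)

lemma eval_add: "eval_with \<phi> F (p + q) = eval_with \<phi> F p + eval_with \<phi> F q"
proof -
  let ?A = "keys p \<union> keys q"
  have "keys (p + q) \<subseteq> ?A" by (rule Poly_Mapping.keys_add)
  then show ?thesis
    by (simp add: eval_superset[of ?A] lookup_add hom_add distrib_right sum.distrib)
qed

lemma eval_single: "eval_with \<phi> F (single m c) = \<phi> c * power_product F m"
  by (simp add: eval_with_def)

lemma eval_mult: "eval_with \<phi> F (p * q) = eval_with \<phi> F p * eval_with \<phi> F q"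
proof (induction p rule: mpoly_induct)
  case (single m c)
  show ?case
  proof (induction q rule: mpoly_induct)
    case (single m' c')
    show ?case by (simp add: mult_single eval_single power_product_add hom_mult)
  qed (simp add: eval_add distrib_left)
qed (simp add: eval_add distrib_right)

lemma eval_0 [simp]: "eval_with \<phi> F 0 = 0"
  by (simp add: eval_with_def)

lemma eval_1 [simp]: "eval_with \<phi> F 1 = 1"
  using eval_single[of F 0 1] by simp

lemma eval_minus: "eval_with \<phi> F (- p) = - eval_with \<phi> F p"
  using eval_add[of F p "- p"] by (simp add: eq_neg_iff_add_eq_0 add.commute)

lemma eval_diff: "eval_with \<phi> F (p - q) = eval_with \<phi> F p - eval_with \<phi> F q"
  using eval_add[of F p "- q"] by (simp add: eval_minus)

lemma eval_power: "eval_with \<phi> F (p ^ k) = eval_with \<phi> F p ^ k"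
  by (induction k) (simp_all add: eval_mult)

lemma eval_sum: "eval_with \<phi> F (sum g A) = (\<Sum>a\<in>A. eval_with \<phi> F (g a))"
  by (induction A rule: infinite_finite_induct) (simp_all add: eval_add)

lemma eval_Const [simp]: "eval_with \<phi> F (Const c) = \<phi> c"
  by (simp add: Const_def eval_single)

lemma eval_indet [simp]: "eval_with \<phi> F (indet j) = F j"
  by (simp add: indet_def eval_single)

end

lemma Const_0 [simp]: "Const 0 = 0"
  and Const_1 [simp]: "Const 1 = 1"
  and Const_add: "Const (a + b) = Const a + Const b"
  and Const_mult: "Const (a * b) = Const a * Const b"
  by (simp_all add: Const_def single_add mult_single)

lemma Const_eq_0_iff [simp]: "Const c = 0 \<longleftrightarrow> c = 0"
  unfolding Const_def by (metis keys_single keys_zero single_zero insert_not_empty)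

lemma indet_neq_0 [simp]: "indet j \<noteq> (0 :: 'k::field mpoly)"
  unfolding indet_def by (metis keys_single keys_zero insert_not_empty zero_neq_one)

interpretation Const: coeff_hom Const
  by unfold_locales (simp_all add: Const_add Const_mult)

abbreviation subst :: "(nat \<Rightarrow> 'k::field mpoly) \<Rightarrow> 'k mpoly \<Rightarrow> 'k mpoly" where
  "subst \<equiv> eval_with Const"

lemma power_product_indet: "power_product indet m = (single m 1 :: 'k::field mpoly)"
proof -
  have indet_power: "indet j ^ e = (single (single j e) 1 :: 'k mpoly)" for j e
    by (induction e) (simp_all add: indet_def mult_single single_add[symmetric])
  have "(\<Prod>j\<in>A. single (single j (lookup m j)) 1) = (single (\<Sum>j\<in>A. single j (lookup m j)) 1 :: 'k mpoly)"
    if "finite A" for A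
    using that by (induction A rule: finite_induct) (simp_all add: mult_single)
  moreover have "(\<Sum>j\<in>keys m. single j (lookup m j)) = m"
    by (intro poly_mapping_eqI)
       (auto simp: lookup_sum lookup_single when_def in_keys_iff if_distrib sum.delta cong: if_cong)
  ultimately show ?thesis
    by (simp add: power_product_def indet_power)
qed

lemma subst_cong:
  assumes "p \<in> polys V" "\<And>j. j \<in> V \<Longrightarrow> F j = G j"
  shows "eval_with \<phi> F p = eval_with \<phi> G p"
  unfolding eval_with_def power_product_def using assms
  by (intro sum.cong refl arg_cong2[where f = "(*)"] prod.cong arg_cong2[where f = "(^)"])
     (auto simp: polys_def)

lemma subst_indet [simp]: "subst indet p = p"
proof (induction p rule: mpoly_induct)
  case (single m c)
  have "Const c * single m 1 = single m c" by (simp add: Const_def mult_single)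
  then show ?case by (simp add: Const.eval_single power_product_indet)
qed (simp add: Const.eval_add)

lemma subst_polys_id:
  assumes "p \<in> polys V" "\<And>j. j \<in> V \<Longrightarrow> F j = indet j"
  shows "subst F p = p"
  using subst_cong[OF assms] by simp

section \<open>Polynomials in a prescribed set of variables\<close>

lemma polys_UNIV [simp]: "polys UNIV = UNIV"
  by (simp add: polys_def)

lemma polys_mono: "V \<subseteq> V' \<Longrightarrow> polys V \<subseteq> polys V'"
  by (auto simp: polys_def)

lemma polys_0 [simp]: "0 \<in> polys V" and polys_1 [simp]: "1 \<in> polys V"
  and polys_Const [simp]: "Const c \<in> polys V"
  by (auto simp: polys_def Const_def)

lemma polys_indet: "j \<in> V \<Longrightarrow> indet j \<in> polys V"
  by (auto simp: polys_def indet_def)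

lemma polys_add: "p \<in> polys V \<Longrightarrow> q \<in> polys V \<Longrightarrow> p + q \<in> polys V"
  using Poly_Mapping.keys_add[of p q] by (fastforce simp: polys_def)

lemma polys_mult: "p \<in> polys V \<Longrightarrow> q \<in> polys V \<Longrightarrow> p * q \<in> polys V"
  unfolding polys_def
proof safe
  fix m j
  assume pq: "\<forall>m\<in>keys p. keys m \<subseteq> V" "\<forall>m\<in>keys q. keys m \<subseteq> V"
    and m: "m \<in> keys (p * q)" "j \<in> keys m"
  from m(1) keys_mult[of p q] obtain a b where ab: "m = a + b" "a \<in> keys p" "b \<in> keys q" by blast
  with m(2) Poly_Mapping.keys_add[of a b] have "j \<in> keys a \<union> keys b" by blast
  with ab pq show "j \<in> V" by blast
qed

lemma polys_minus: "p \<in> polys V \<Longrightarrow> - p \<in> polys V"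
  by (auto simp: polys_def in_keys_iff)

lemma polys_diff: "p \<in> polys V \<Longrightarrow> q \<in> polys V \<Longrightarrow> p - q \<in> polys V"
  using polys_add[OF _ polys_minus] by fastforce

lemma polys_power: "p \<in> polys V \<Longrightarrow> p ^ k \<in> polys V"
  by (induction k) (simp_all add: polys_mult)

lemma polys_sum: "(\<And>a. a \<in> A \<Longrightarrow> g a \<in> polys V) \<Longrightarrow> sum g A \<in> polys V"
  by (induction A rule: infinite_finite_induct) (simp_all add: polys_add)

lemma polys_prod: "(\<And>a. a \<in> A \<Longrightarrow> g a \<in> polys V) \<Longrightarrow> prod g A \<in> polys V"
  by (induction A rule: infinite_finite_induct) (simp_all add: polys_mult)

lemmas polys_closed = polys_add polys_mult polys_minus polys_diff polys_power polys_sum polys_prod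

lemma subst_in_polys:
  assumes "p \<in> polys V" "\<And>j. j \<in> V \<Longrightarrow> F j \<in> polys V'"
  shows "subst F p \<in> polys V'"
  unfolding eval_with_def power_product_def using assms
  by (intro polys_sum polys_mult polys_prod polys_power polys_Const assms(2))
     (auto simp: polys_def[of V])

lemma polys_empty: "p \<in> polys {} \<longleftrightarrow> (\<exists>c. p = Const c)"
proof
  assume p: "p \<in> polys {}"
  have "p = Const (lookup p 0)"
  proof (rule poly_mapping_eqI)
    fix m
    show "lookup p m = lookup (Const (lookup p 0)) m"
    proof (cases "m = 0")
      case False
      with p have "m \<notin> keys p" by (auto simp: polys_def)
      with False show ?thesis by (simp add: Const_def lookup_single when_def in_keys_iff)
    qed (simp add: Const_def)
  qed
  then show "\<exists>c. p = Const c" ..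
qed auto

text \<open>Killing the variables outside \<open>V\<close> is a ring homomorphism that fixes
  \<open>polys V\<close>. It brings relations with coefficients in the whole ring down to
  \<open>polys V\<close> and realizes reduction modulo variables that lie in a prime.\<close>

definition retract :: "nat set \<Rightarrow> 'k::field mpoly \<Rightarrow> 'k mpoly" where
  "retract V = subst (\<lambda>j. if j \<in> V then indet j else 0)"

lemma retract_in_polys [simp]: "retract V p \<in> polys V"
  unfolding retract_def by (rule subst_in_polys[of _ UNIV]) (auto simp: polys_indet)

lemma retract_id: "p \<in> polys V \<Longrightarrow> retract V p = p"
  unfolding retract_def by (rule subst_polys_id) auto

lemma retract_add: "retract V (p + q) = retract V p + retract V q"
  and retract_mult: "retract V (p * q) = retract V p * retract V q"
  by (simp_all add: retract_def Const.eval_add Const.eval_mult)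

subsection \<open>Isolating one variable\<close>

text \<open>Reads a polynomial as one in \<open>indet i\<close>. The coefficients keep the full
  type; \<open>coeff_univ_in_polys\<close> records which variables can occur in them.\<close>

definition univ :: "nat \<Rightarrow> 'k::field mpoly \<Rightarrow> 'k mpoly poly" where
  "univ i = eval_with (\<lambda>c. [:Const c:]) (\<lambda>j. if j = i then [:0, 1:] else [:indet j:])"

interpretation Univ: coeff_hom "\<lambda>c. [:Const c:]"
  by unfold_locales (simp_all add: Const_add Const_mult)

lemma univ_add: "univ i (p + q) = univ i p + univ i q"
  and univ_mult: "univ i (p * q) = univ i p * univ i q"
  and univ_diff: "univ i (p - q) = univ i p - univ i q"
  and univ_power: "univ i (p ^ k) = univ i p ^ k"
  and univ_sum: "univ i (sum g A) = (\<Sum>a\<in>A. univ i (g a))"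
  and univ_0 [simp]: "univ i 0 = 0"
  and univ_1 [simp]: "univ i 1 = 1"
  and univ_Const [simp]: "univ i (Const c) = [:Const c:]"
  and univ_indet: "univ i (indet j) = (if j = i then [:0, 1:] else [:indet j:])"
  by (simp_all add: univ_def Univ.eval_add Univ.eval_mult Univ.eval_diff
        Univ.eval_power Univ.eval_sum)

lemma mpoly_ring_induct [consumes 1, case_names Const indet add mult]:
  fixes p :: "'k::field mpoly"
  assumes "p \<in> polys V" "\<And>c. Q (Const c)" "\<And>j. j \<in> V \<Longrightarrow> Q (indet j)"
    "\<And>p q. Q p \<Longrightarrow> Q q \<Longrightarrow> Q (p + q)" "\<And>p q. Q p \<Longrightarrow> Q q \<Longrightarrow> Q (p * q)"
  shows "Q p"
proof -
  have Q0: "Q 0" and Q1: "Q 1" using assms(2)[of 0] assms(2)[of 1] by simp_all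
  have Qs: "(\<And>a. a \<in> A \<Longrightarrow> Q (g a)) \<Longrightarrow> Q (sum g A)" for A :: "(nat \<Rightarrow>\<^sub>0 nat) set" and g
    by (induction A rule: infinite_finite_induct) (auto simp: Q0 intro: assms(4))
  have Qp: "(\<And>a. a \<in> A \<Longrightarrow> Q (g a)) \<Longrightarrow> Q (prod g A)" for A :: "nat set" and g
    by (induction A rule: infinite_finite_induct) (auto simp: Q1 intro: assms(5))
  have Qe: "Q q \<Longrightarrow> Q (q ^ k)" for q k
    by (induction k) (auto simp: Q1 intro: assms(5))
  \<comment> \<open>Written as \<open>subst indet p\<close>, the polynomial is visibly a sum of
    products of constants and indeterminates from \<open>V\<close>.\<close>
  have "Q (subst indet p)"
    unfolding eval_with_def power_product_def using assms(1)
    by (intro Qs assms(5) Qp Qe assms(2,3)) (auto simp: polys_def)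
  then show ?thesis by simp
qed

text \<open>Makes \<open>univ i\<close> injective and turns statements about coefficients back into
  identities of polynomials.\<close>

lemma poly_univ [simp]: "poly (univ i p) (indet i) = p"
proof -
  have "p \<in> polys UNIV" by simp
  then show ?thesis
    by (induction p rule: mpoly_ring_induct) (auto simp: univ_add univ_mult univ_indet)
qed

lemma univ_polys:
  assumes "p \<in> polys V" "i \<notin> V"
  shows "univ i p = [:p:]"
  using assms(1) by (induction p rule: mpoly_ring_induct) (use assms(2) in \<open>auto simp: univ_add univ_mult univ_indet\<close>)

lemma univ_eq_0_iff [simp]: "univ i p = 0 \<longleftrightarrow> p = 0"
  by (metis poly_univ poly_0 univ_0)

lemma coeff_univ_in_polys:
  assumes "p \<in> polys (insert i V)" "i \<notin> V"
  shows "Polynomial.coeff (univ i p) d \<in> polys V"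
  using assms(1)
proof (induction p arbitrary: d rule: mpoly_ring_induct)
  case (mult p q)
  then show ?case by (auto simp: univ_mult Polynomial.coeff_mult intro!: polys_closed)
next
  case (indet j)
  then show ?case
    using assms(2) by (auto simp: univ_indet Polynomial.coeff_pCons polys_indet split: nat.split)
qed (auto simp: univ_add polys_closed Polynomial.coeff_pCons split: nat.split)

subsection \<open>Ideals of polynomials\<close>

text \<open>A ring is a module over itself with the ideals as submodules, so
  \<open>pideal.span G\<close> is the ideal generated by \<open>G\<close>. For polynomials it is
  formed in the ring in all countably many variables.\<close>

interpretation pideal: Modules.module "(*) :: 'a::comm_ring_1 \<Rightarrow> 'a \<Rightarrow> 'a"
  by unfold_locales (simp_all add: algebra_simps)

text \<open>This rewrite rule reads \<open>a * (b * x) = (a * b) * x\<close> and loops with the associative laws.\<close>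

declare pideal.scale_scale [simp del]

lemma pideal_span_mult_right: "(a::'a::comm_ring_1) \<in> pideal.span S \<Longrightarrow> a * b \<in> pideal.span S"
  using pideal.span_scale[of a S b] by (simp add: mult.commute)

lemma span_subset_of_span: "S \<subseteq> pideal.span T \<Longrightarrow> pideal.span S \<subseteq> pideal.span (T :: 'a::comm_ring_1 set)"
  by (metis pideal.span_mono pideal.span_span)

lemma span_finite_support:
  assumes "(x :: 'a::comm_ring_1) \<in> pideal.span S"
  shows "\<exists>T\<subseteq>S. finite T \<and> x \<in> pideal.span T"
  using assms
proof (induction rule: pideal.span_induct_alt)
  case base
  show ?case by (intro exI[of _ "{}"]) simp
next
  case (step c x y)
  then obtain T where T: "T \<subseteq> S" "finite T" "y \<in> pideal.span T" by blast
  have "c * x + y \<in> pideal.span (insert x T)"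
    using pideal.span_mono[OF subset_insertI] T(3)
    by (intro pideal.span_add pideal.span_scale) (auto intro: pideal.span_base)
  then show ?case using T step by (intro exI[of _ "insert x T"]) auto
qed

lemma span_finite_support_set:
  assumes "finite Y" "Y \<subseteq> pideal.span (S :: 'a::comm_ring_1 set)"
  shows "\<exists>T\<subseteq>S. finite T \<and> Y \<subseteq> pideal.span T"
  using assms
proof (induction rule: finite_induct)
  case empty
  show ?case by (intro exI[of _ "{}"]) simp
next
  case (insert x Y)
  then obtain T1 where T1: "T1 \<subseteq> S" "finite T1" "Y \<subseteq> pideal.span T1" by blast
  obtain T2 where T2: "T2 \<subseteq> S" "finite T2" "x \<in> pideal.span T2"
    using span_finite_support insert.prems by blast
  have "insert x Y \<subseteq> pideal.span (T1 \<union> T2)"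
    using T1(3) T2(3) pideal.span_mono[of T1 "T1 \<union> T2"] pideal.span_mono[of T2 "T1 \<union> T2"] by auto
  then show ?case using T1 T2 by (intro exI[of _ "T1 \<union> T2"]) auto
qed

text \<open>An arbitrary representation of \<open>x\<close> is pushed into \<open>polys V\<close> by
  \<open>retract V\<close>, which fixes \<open>x\<close> and the generators.\<close>

lemma span_polys_coeffs:
  assumes "x \<in> pideal.span S" "S \<subseteq> polys V" "finite S" "x \<in> polys V"
  shows "\<exists>c. (\<forall>s. c s \<in> polys V) \<and> x = (\<Sum>s\<in>S. c s * s)"
proof -
  from assms(1,3) obtain c where c: "x = (\<Sum>s\<in>S. c s * s)"
    by (auto simp: pideal.span_finite)
  have "x = retract V (\<Sum>s\<in>S. c s * s)" using assms(4) c by (simp add: retract_id)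
  also have "\<dots> = (\<Sum>s\<in>S. retract V (c s) * retract V s)"
    by (simp add: retract_def Const.eval_sum Const.eval_mult)
  also have "\<dots> = (\<Sum>s\<in>S. retract V (c s) * s)"
    using assms(2) by (intro sum.cong) (auto simp: retract_id)
  finally show ?thesis by (intro exI[of _ "\<lambda>s. retract V (c s)"]) auto
qed

subsection \<open>Hilbert's basis theorem\<close>

text \<open>An ascending chain condition phrased with sequences of elements. The span is formed in
  the whole ring, which by \<open>span_polys_coeffs\<close> makes no difference for elements of
  \<open>polys V\<close>.\<close>

definition noetherian_vars :: "'k::field itself \<Rightarrow> nat set \<Rightarrow> bool" where
  "noetherian_vars TYPE('k) V \<longleftrightarrow>
     (\<forall>a :: nat \<Rightarrow> 'k mpoly. range a \<subseteq> polys V \<longrightarrow> (\<exists>m. a m \<in> pideal.span (a ` {..<m})))"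

lemma noetherian_varsD:
  fixes a :: "nat \<Rightarrow> 'k::field mpoly"
  assumes "noetherian_vars TYPE('k) V" "range a \<subseteq> polys V"
  shows "\<exists>m. a m \<in> pideal.span (a ` {..<m})"
  using assms unfolding noetherian_vars_def by (elim allE impE)

text \<open>Constants form a field: a zero first term lies in the span of the empty set, and a
  nonzero one is a unit.\<close>

lemma noetherian_vars_empty: "noetherian_vars TYPE('k::field) {}"
  unfolding noetherian_vars_def
proof (intro allI impI)
  fix a :: "nat \<Rightarrow> 'k mpoly" assume a: "range a \<subseteq> polys {}"
  then obtain c d where cd: "a 0 = Const c" "a 1 = Const d"
    using polys_empty by (metis range_subsetD)
  show "\<exists>m. a m \<in> pideal.span (a ` {..<m})"
  proof (cases "c = 0")
    case True
    then show ?thesis using cd by (intro exI[of _ 0]) (simp add: pideal.span_zero)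
  next
    case False
    have "Const (d * inverse c) * a 0 \<in> pideal.span (a ` {..<1})"
      by (intro pideal.span_scale pideal.span_base) auto
    moreover have "Const (d * inverse c) * a 0 = a 1"
      using cd False by (simp add: mult.assoc flip: Const_mult)
    ultimately show ?thesis by (intro exI[of _ 1]) simp
  qed
qed

lemma noetherian_vars_finite_generation:
  assumes V: "noetherian_vars TYPE('k::field) V" and G: "(G :: 'k mpoly set) \<subseteq> polys V"
  shows "\<exists>A\<subseteq>G. finite A \<and> G \<subseteq> pideal.span A"
proof (rule ccontr)
  assume neg: "\<not> ?thesis"
  \<comment> \<open>Without a finite generating set, elements outside the span of their predecessors
    can be chosen forever.\<close>
  define Q where "Q f x r \<longleftrightarrow> f ` {..<x} \<subseteq> G \<and> r \<in> G \<and> r \<notin> pideal.span (f ` {..<x})"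
    for f :: "nat \<Rightarrow> 'k mpoly" and x r
  have "\<exists>a. \<forall>k. Q a k (a k)"
  proof (rule dependent_wellorder_choice)
    fix x f assume "\<And>y. y < x \<Longrightarrow> Q f y (f y)"
    then have "f ` {..<x} \<subseteq> G" by (auto simp: Q_def)
    moreover from this neg have "\<not> G \<subseteq> pideal.span (f ` {..<x})" by auto
    ultimately show "\<exists>r. Q f x r" by (auto simp: Q_def)
  next
    fix r and f g :: "nat \<Rightarrow> 'k mpoly" and x
    assume "\<And>y. y < x \<Longrightarrow> f y = g y"
    then have "f ` {..<x} = g ` {..<x}" by (intro image_cong) auto
    then show "Q f x r = Q g x r" by (simp add: Q_def)
  qed
  then obtain a where "\<forall>k. Q a k (a k)" ..
  then have a: "a k \<in> G" "a k \<notin> pideal.span (a ` {..<k})" for k by (auto simp: Q_def)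
  then have "range a \<subseteq> polys V" using G by auto
  from noetherian_varsD[OF V this] obtain m where "a m \<in> pideal.span (a ` {..<m})" ..
  with a(2)[of m] show False by simp
qed

text \<open>Noether's argument: in a sequence of elements of minimal degree outside the ideal generated by
  their predecessors, some leading coefficient is a combination of the previous ones.\<close>

lemma noetherian_vars_insert:
  assumes V: "noetherian_vars TYPE('k::field) V" and i: "i \<notin> V"
  shows "noetherian_vars TYPE('k) (insert i V)"
  unfolding noetherian_vars_def
proof (intro allI impI, rule ccontr)
  fix g :: "nat \<Rightarrow> 'k mpoly"
  assume g: "range g \<subseteq> polys (insert i V)"
    and neg: "\<nexists>m. g m \<in> pideal.span (g ` {..<m})"
  define deg where "deg p = Polynomial.degree (univ i p)" for p :: "'k mpoly"
  define J where "J = pideal.span (range g) \<inter> polys (insert i V)"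
  have gJ: "range g \<subseteq> J" using g pideal.span_superset[of "range g"] by (simp add: J_def)
  \<comment> \<open>\<open>J\<close> is not finitely generated: a finite subset lies in the span of
    an initial segment of \<open>g\<close>, which would then contain the next term
    \<open>g m\<close>.\<close>
  have ex: "\<exists>r. r \<in> J \<and> r \<notin> pideal.span Y" if "finite Y" "Y \<subseteq> J" for Y
  proof (rule ccontr)
    assume "\<not> ?thesis"
    then have *: "J \<subseteq> pideal.span Y" by blast
    from that obtain T where T: "T \<subseteq> range g" "finite T" "Y \<subseteq> pideal.span T"
      using span_finite_support_set[of Y "range g"] by (auto simp: J_def)
    obtain M where "T = g ` M" "finite M" using finite_subset_image[OF T(2,1)] by auto
    moreover from this(2) obtain m where "M \<subseteq> {..<m}" by (auto simp: finite_nat_iff_bounded)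
    ultimately have "T \<subseteq> g ` {..<m}" by auto
    then have "pideal.span T \<subseteq> pideal.span (g ` {..<m})" by (rule pideal.span_mono)
    moreover have "J \<subseteq> pideal.span T" using * span_subset_of_span[OF T(3)] by simp
    ultimately have "J \<subseteq> pideal.span (g ` {..<m})" by simp
    with gJ have "g m \<in> pideal.span (g ` {..<m})" using rangeI[of g m] by blast
    with neg show False by blast
  qed
  define Q where "Q f x r \<longleftrightarrow> f ` {..<x} \<subseteq> J \<and> r \<in> J \<and> r \<notin> pideal.span (f ` {..<x})
     \<and> (\<forall>s. s \<in> J \<and> s \<notin> pideal.span (f ` {..<x}) \<longrightarrow> deg r \<le> deg s)"
    for f :: "nat \<Rightarrow> 'k mpoly" and x r
  have "\<exists>f. \<forall>k. Q f k (f k)"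
  proof (rule dependent_wellorder_choice)
    fix x f assume "\<And>y. y < x \<Longrightarrow> Q f y (f y)"
    then have fJ: "f ` {..<x} \<subseteq> J" by (auto simp: Q_def)
    obtain s where "s \<in> J \<and> s \<notin> pideal.span (f ` {..<x})" using ex[OF _ fJ] by auto
    from ex_has_least_nat[of "\<lambda>s. s \<in> J \<and> s \<notin> pideal.span (f ` {..<x})", OF this, of deg]
    show "\<exists>r. Q f x r" using fJ by (auto simp: Q_def)
  next
    fix r and f g :: "nat \<Rightarrow> 'k mpoly" and x
    assume "\<And>y. y < x \<Longrightarrow> f y = g y"
    then have "f ` {..<x} = g ` {..<x}" by (intro image_cong) auto
    then show "Q f x r = Q g x r" by (simp add: Q_def)
  qed
  then obtain f where f: "\<forall>k. Q f k (f k)" ..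
  have fJ: "f k \<in> J" for k using f by (simp add: Q_def)
  have fnot: "f k \<notin> pideal.span (f ` {..<k})" for k using f by (simp add: Q_def)
  have fmin: "deg (f k) \<le> deg s" if "s \<in> J" "s \<notin> pideal.span (f ` {..<k})" for k s
    using f that by (simp add: Q_def)
  have mono: "deg (f k) \<le> deg (f m)" if "k \<le> m" for k m
  proof -
    have "pideal.span (f ` {..<k}) \<subseteq> pideal.span (f ` {..<m})"
      using that by (intro pideal.span_mono image_mono) auto
    then show ?thesis using fJ[of m] fnot[of m] fmin[of "f m" k] by auto
  qed
  define a where "a k = Polynomial.lead_coeff (univ i (f k))" for k
  have aV: "a k \<in> polys V" for k
    using fJ[of k] i by (simp add: a_def J_def coeff_univ_in_polys)
  then have "range a \<subseteq> polys V" by auto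
  from noetherian_varsD[OF V this] obtain m where m: "a m \<in> pideal.span (a ` {..<m})" ..
  have "a ` {..<m} \<subseteq> polys V" using aV by blast
  from span_polys_coeffs[OF m this _ aV]
  obtain c where c: "\<And>s. c s \<in> polys V" "a m = (\<Sum>s\<in>a ` {..<m}. c s * s)"
    by auto
  \<comment> \<open>Different indices may share a leading coefficient, so \<open>K\<close> picks one
    index for each value.\<close>
  obtain K where K: "K \<subseteq> {..<m}" "inj_on a K" "a ` {..<m} = a ` K"
    using subset_image_inj[of "a ` {..<m}" a "{..<m}"] by auto
  have finK: "finite K" using K(1) finite_subset by blast
  have am: "a m = (\<Sum>k\<in>K. c (a k) * a k)"
    using c(2) K by (simp add: sum.reindex)
  \<comment> \<open>Multiples of earlier \<open>f k\<close>, shifted to the degree of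
    \<open>f m\<close>, cancel its leading term. The result stays outside the span but has smaller
    degree.\<close>
  define h where "h = f m - (\<Sum>k\<in>K. c (a k) * indet i ^ (deg (f m) - deg (f k)) * f k)"
  have sumspan: "(\<Sum>k\<in>K. c (a k) * indet i ^ (deg (f m) - deg (f k)) * f k) \<in> pideal.span (f ` {..<m})"
    using K(1) by (intro pideal.span_sum pideal.span_scale pideal.span_base) auto
  have hnot: "h \<notin> pideal.span (f ` {..<m})"
  proof
    assume "h \<in> pideal.span (f ` {..<m})"
    from pideal.span_add[OF this sumspan] fnot[of m] show False by (simp add: h_def)
  qed
  have "h \<in> pideal.span (range g)" unfolding h_def
    by (intro pideal.span_diff pideal.span_sum pideal.span_scale) (use fJ in \<open>auto simp: J_def\<close>)
  moreover have "h \<in> polys (insert i V)" unfolding h_def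
    using fJ c(1) polys_mono[of V "insert i V"]
    by (intro polys_closed polys_indet) (auto simp: J_def)
  ultimately have hJ: "h \<in> J" by (simp add: J_def)
  have Phi_h: "univ i h = univ i (f m) - (\<Sum>k\<in>K. [:c (a k):] * ([:0, 1:] ^ (deg (f m) - deg (f k)) * univ i (f k)))"
    unfolding h_def univ_diff univ_sum univ_mult univ_power univ_indet univ_polys[OF c(1) i] mult.assoc
    by (simp only: refl if_True)
  have cf: "Polynomial.coeff ([:0, 1:] ^ e * q) d = (if d < e then 0 else Polynomial.coeff q (d - e))"
    for e d and q :: "'k mpoly poly"
    by (induction e arbitrary: d) (auto simp: Polynomial.coeff_pCons mult.assoc split: nat.split)
  have "Polynomial.coeff (univ i h) d = 0" if d: "d \<ge> deg (f m)" for d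
  proof (cases "d = deg (f m)")
    case True
    have "Polynomial.coeff (univ i h) d = a m - (\<Sum>k\<in>K. c (a k) *
        Polynomial.coeff (univ i (f k)) (deg (f m) - (deg (f m) - deg (f k))))"
      by (simp add: Phi_h Polynomial.coeff_sum cf True a_def deg_def[symmetric] not_less[THEN iffD2, OF diff_le_self])
    also have "(\<Sum>k\<in>K. c (a k) *
        Polynomial.coeff (univ i (f k)) (deg (f m) - (deg (f m) - deg (f k)))) = (\<Sum>k\<in>K. c (a k) * a k)"
      using K(1) mono by (intro sum.cong) (auto simp: a_def deg_def[symmetric] subset_iff less_imp_le)
    finally have "Polynomial.coeff (univ i h) d = a m - (\<Sum>k\<in>K. c (a k) * a k)" .
    then show ?thesis using am by simp
  next
    case False
    with d have d: "d > deg (f m)" by simp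
    have "Polynomial.coeff (univ i (f k)) (d - (deg (f m) - deg (f k))) = 0" if "k \<in> K" for k
      using d mono[of k m] that K(1) by (intro Polynomial.coeff_eq_0) (auto simp: deg_def)
    then show ?thesis
      using d by (auto simp: Phi_h Polynomial.coeff_sum cf Polynomial.coeff_eq_0 deg_def intro!: sum.neutral)
  qed
  moreover have "h \<noteq> 0" using hnot pideal.span_zero by metis
  then have "Polynomial.lead_coeff (univ i h) \<noteq> 0" by simp
  ultimately have "deg h < deg (f m)" using deg_def not_less by metis
  with fmin[OF hJ hnot] show False by simp
qed

lemma noetherian_vars_finite: "finite V \<Longrightarrow> noetherian_vars TYPE('k::field) V"
  by (induction V rule: finite_induct) (simp_all add: noetherian_vars_empty noetherian_vars_insert)

subsection \<open>The polynomial ring as a record\<close>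

lemma polynomial_ring_simps [simp]:
  "carrier (polynomial_ring n) = polys {1..n}"
  "monoid.mult (polynomial_ring n) = (*)"
  "one (polynomial_ring n) = 1"
  "ring.zero (polynomial_ring n) = 0"
  "add (polynomial_ring n) = (+)"
  by (simp_all add: polynomial_ring_def polys_def ring_of_type_algebra_def fun_eq_iff)

lemma cring_polynomial_ring: "cring (polynomial_ring n :: 'k::field mpoly ring)"
proof (rule cringI)
  show "abelian_group (polynomial_ring n :: 'k mpoly ring)"
  proof (rule abelian_groupI)
    fix x :: "'k mpoly" assume "x \<in> carrier (polynomial_ring n)"
    then show "\<exists>y\<in>carrier (polynomial_ring n). y \<oplus>\<^bsub>polynomial_ring n\<^esub> x = \<zero>\<^bsub>polynomial_ring n\<^esub>"
      by (intro bexI[of _ "- x"]) (auto intro: polys_minus)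
  qed (auto intro: polys_add simp: algebra_simps)
  show "comm_monoid (polynomial_ring n :: 'k mpoly ring)"
  proof (rule comm_monoidI, goal_cases)
    case (1 x y) then show ?case by (simp add: polys_mult)
  next
    case 2 show ?case by simp
  next
    case (3 x y z) show ?case by (simp only: polynomial_ring_simps mult.assoc)
  next
    case (4 x) show ?case by simp
  next
    case (5 x y) show ?case by (simp only: polynomial_ring_simps mult.commute[of x])
  qed
qed (auto simp: algebra_simps)

lemma a_inv_polynomial_ring [simp]:
  assumes "x \<in> polys {1..n}"
  shows "\<ominus>\<^bsub>polynomial_ring n\<^esub> x = - x"
proof -
  interpret cring "polynomial_ring n :: 'a mpoly ring" by (rule cring_polynomial_ring)
  show ?thesis using assms by (intro minus_equality) (auto intro: polys_minus)
qed

lemma ideal_polynomial_ringI: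
  assumes "J \<subseteq> polys {1..n}" "0 \<in> J" "\<And>x y. x \<in> J \<Longrightarrow> y \<in> J \<Longrightarrow> x + y \<in> J"
    "\<And>x y. x \<in> J \<Longrightarrow> y \<in> polys {1..n} \<Longrightarrow> y * x \<in> J"
  shows "ideal J (polynomial_ring n)"
proof -
  interpret cring "polynomial_ring n :: 'a mpoly ring" by (rule cring_polynomial_ring)
  have neg: "- x \<in> J" if "x \<in> J" for x
    using assms(4)[OF that, of "- 1"] by (simp add: polys_minus)
  show ?thesis
  proof (rule idealI)
    show "subgroup J (add_monoid (polynomial_ring n))"
      using assms neg by (intro add.subgroupI) (auto simp: subset_iff simp flip: a_inv_def)
  qed (use assms in \<open>auto simp: mult.commute intro: ring_axioms\<close>)
qed

text \<open>One ideal is formed inside the record, the other in the ring with all variables.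
  \<open>retract {1..n}\<close> maps the second into the first and fixes the polynomials in
  \<open>n\<close> variables.\<close>

lemma Idl_polynomial_ring:
  assumes "G \<subseteq> polys {1..n}"
  shows "Idl\<^bsub>polynomial_ring n\<^esub> G = pideal.span G \<inter> polys {1..n}"
proof -
  interpret cring "polynomial_ring n :: 'a mpoly ring" by (rule cring_polynomial_ring)
  have id: "ideal (Idl\<^bsub>polynomial_ring n\<^esub> G) (polynomial_ring n)"
    using assms by (intro genideal_ideal) simp
  have retr: "retract {1..n} x \<in> Idl\<^bsub>polynomial_ring n\<^esub> G" if "x \<in> pideal.span G" for x
    using that
  proof (induction rule: pideal.span_induct_alt)
    case base
    show ?case using additive_subgroup.zero_closed[OF ideal.axioms(1)[OF id]] by (simp add: retract_id)
  next
    case (step c x y)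
    have "x \<in> Idl\<^bsub>polynomial_ring n\<^esub> G" using genideal_self assms step(1) by auto
    then have "retract {1..n} c * x \<in> Idl\<^bsub>polynomial_ring n\<^esub> G"
      using ideal.I_l_closed[OF id, of x "retract {1..n} c"] by simp
    moreover have "retract {1..n} x = x" using assms step(1) by (auto simp: retract_id)
    ultimately show ?case
      using additive_subgroup.a_closed[OF ideal.axioms(1)[OF id], of "retract {1..n} c * x" "retract {1..n} y"] step(2)
      by (simp add: retract_add retract_mult)
  qed
  show ?thesis
  proof
    show "Idl\<^bsub>polynomial_ring n\<^esub> G \<subseteq> pideal.span G \<inter> polys {1..n}"
      by (intro genideal_minimal ideal_polynomial_ringI)
         (use assms in \<open>auto intro: pideal.span_add pideal.span_scale pideal.span_zero polys_add polys_mult pideal.span_base\<close>)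
    show "pideal.span G \<inter> polys {1..n} \<subseteq> Idl\<^bsub>polynomial_ring n\<^esub> G"
      using retr retract_id by fastforce
  qed
qed

lemma noetherian_polynomial_ring: "noetherian_ring (polynomial_ring n :: 'k::field mpoly ring)"
proof -
  interpret cring "polynomial_ring n :: 'k mpoly ring" by (rule cring_polynomial_ring)
  show ?thesis
  proof (rule noetherian_ringI)
    fix I :: "'k mpoly set" assume I: "ideal I (polynomial_ring n)"
    then have sub: "I \<subseteq> polys {1..n}"
      using additive_subgroup.a_subset ideal.axioms(1) by fastforce
    then obtain A where A: "A \<subseteq> I" "finite A" "I \<subseteq> pideal.span A"
      using noetherian_vars_finite_generation[OF noetherian_vars_finite, of "{1..n}" I] by auto
    have "Idl\<^bsub>polynomial_ring n\<^esub> A \<subseteq> I" using A(1) I by (simp add: genideal_minimal)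
    moreover have "I \<subseteq> Idl\<^bsub>polynomial_ring n\<^esub> A"
      using A sub by (subst Idl_polynomial_ring) auto
    ultimately show "\<exists>A\<subseteq>carrier (polynomial_ring n). finite A \<and> I = Idl\<^bsub>polynomial_ring n\<^esub> A"
      using A sub by (intro exI[of _ A]) auto
  qed
qed

text \<open>Generators of the preimage in \<open>R\<close> of an ideal of the quotient map to
  generators of that ideal.\<close>

lemma noetherian_ring_Quot:
  fixes R (structure)
  assumes "noetherian_ring R" "ideal I R"
  shows "noetherian_ring (R Quot I)"
proof -
  interpret noetherian_ring R by fact
  interpret I: ideal I R by fact
  interpret q: ring_hom_ring R "R Quot I" "(+>) I" by (rule I.rcos_ring_hom_ring)
  show ?thesis
  proof (rule q.S.noetherian_ringI)
    fix J assume J: "ideal J (R Quot I)"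
    then interpret J: ideal J "R Quot I" .
    let ?J' = "{r \<in> carrier R. I +> r \<in> J}"
    have "ideal ?J' R" by (rule q.ideal_vimage[OF J])
    then obtain A where A: "A \<subseteq> carrier R" "finite A" "?J' = Idl A" using finetely_gen by blast
    let ?B = "((+>) I) ` A"
    have "?B \<subseteq> J" using A(3) genideal_self[OF A(1)] by auto
    then have 1: "Idl\<^bsub>R Quot I\<^esub> ?B \<subseteq> J" using J q.S.genideal_minimal by blast
    have Bc: "?B \<subseteq> carrier (R Quot I)" using A(1) by auto
    have "ideal {r \<in> carrier R. I +> r \<in> Idl\<^bsub>R Quot I\<^esub> ?B} R"
      by (intro q.ideal_vimage q.S.genideal_ideal Bc)
    then have "Idl A \<subseteq> {r \<in> carrier R. I +> r \<in> Idl\<^bsub>R Quot I\<^esub> ?B}"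
      using A(1) q.S.genideal_self[OF Bc] by (intro genideal_minimal) auto
    moreover have "\<exists>r\<in>carrier R. x = I +> r" if "x \<in> J" for x
      using subsetD[OF J.a_subset that] unfolding FactRing_def A_RCOSETS_def' by auto
    ultimately have "J \<subseteq> Idl\<^bsub>R Quot I\<^esub> ?B" using A(3) by blast
    with 1 Bc A(2) show "\<exists>A\<subseteq>carrier (R Quot I). finite A \<and> J = Idl\<^bsub>R Quot I\<^esub> A"
      by (intro exI[of _ ?B]) auto
  qed
qed

subsection \<open>Depth is at most dimension\<close>

text \<open>Zorn's lemma yields an ideal that is maximal among those containing \<open>J\<close> and
  avoiding \<open>S\<close>; such an ideal is prime.\<close>

lemma (in cring) primeideal_avoiding:
  assumes J: "ideal J R" and S: "S \<subseteq> carrier R" "\<one> \<in> S" "\<And>x y. x \<in> S \<Longrightarrow> y \<in> S \<Longrightarrow> x \<otimes> y \<in> S"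
    and disj: "J \<inter> S = {}"
  shows "\<exists>P. primeideal P R \<and> J \<subseteq> P \<and> P \<inter> S = {}"
proof -
  define F where "F = {K. ideal K R \<and> J \<subseteq> K \<and> K \<inter> S = {}}"
  have "\<exists>M\<in>F. \<forall>K\<in>F. M \<subseteq> K \<longrightarrow> K = M"
  proof (rule subset_Zorn)
    fix C assume C: "subset.chain F C"
    show "\<exists>U\<in>F. \<forall>K\<in>C. K \<subseteq> U"
    proof (cases "C = {}")
      case True
      then show ?thesis using J disj by (intro bexI[of _ J]) (auto simp: F_def)
    next
      case False
      have CF: "C \<subseteq> F" and lin: "\<And>K K'. K \<in> C \<Longrightarrow> K' \<in> C \<Longrightarrow> K \<subseteq> K' \<or> K' \<subseteq> K"
        using C by (auto simp: subset.chain_def)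
      have idK: "ideal K R" if "K \<in> C" for K using that CF by (auto simp: F_def)
      have "ideal (\<Union>C) R"
      proof (rule idealI)
        show "subgroup (\<Union>C) (add_monoid R)"
        proof (rule add.subgroupI)
          show "\<Union>C \<subseteq> carrier R"
            using ideal.Icarr[OF idK] by auto
          show "\<Union>C \<noteq> {}"
            using False additive_subgroup.zero_closed[OF ideal.axioms(1)[OF idK]] by fastforce
        next
          fix a assume "a \<in> \<Union>C"
          then obtain K where "K \<in> C" "a \<in> K" by auto
          with additive_subgroup.a_inv_closed[OF ideal.axioms(1)[OF idK]]
          show "\<ominus> a \<in> \<Union>C" by auto
        next
          fix a b assume "a \<in> \<Union>C" "b \<in> \<Union>C"
          then obtain K K' where K: "K \<in> C" "a \<in> K" "K' \<in> C" "b \<in> K'" by auto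
          with lin[of K K'] obtain K'' where "K'' \<in> C" "a \<in> K''" "b \<in> K''" by auto
          with additive_subgroup.a_closed[OF ideal.axioms(1)[OF idK]]
          show "a \<oplus> b \<in> \<Union>C" by auto
        qed
      next
        fix a x assume "a \<in> \<Union>C" and x: "x \<in> carrier R"
        then obtain K where K: "K \<in> C" "a \<in> K" by auto
        show "x \<otimes> a \<in> \<Union>C" using ideal.I_l_closed[OF idK K(2) x] K(1) by auto
        show "a \<otimes> x \<in> \<Union>C" using ideal.I_r_closed[OF idK K(2) x] K(1) by auto
      qed (rule ring_axioms)
      with False CF show ?thesis by (intro bexI[of _ "\<Union>C"]) (auto simp: F_def)
    qed
  qed
  then obtain M where M: "ideal M R" "J \<subseteq> M" "M \<inter> S = {}"
    and max: "\<And>K. ideal K R \<Longrightarrow> M \<subseteq> K \<Longrightarrow> K \<inter> S = {} \<Longrightarrow> K = M"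
    by (auto simp: F_def)
  interpret M: ideal M R by fact
  have meet: "\<exists>m\<in>M. \<exists>r\<in>carrier R. m \<oplus> r \<otimes> a \<in> S" if a: "a \<in> carrier R" "a \<notin> M" for a
  proof -
    have pa: "ideal (PIdl a) R" by (rule cgenideal_ideal[OF a(1)])
    have K: "ideal (M <+> PIdl a) R" by (rule add_ideals[OF M(1) pa])
    have MK: "M \<subseteq> M <+> PIdl a"
    proof
      fix m assume m: "m \<in> M"
      then have "m = m \<oplus> \<zero>" by simp
      with m additive_subgroup.zero_closed[OF ideal.axioms(1)[OF pa]] show "m \<in> M <+> PIdl a"
        unfolding set_add_def' by blast
    qed
    have "a = \<zero> \<oplus> a" using a by simp
    with cgenideal_self[OF a(1)] have "a \<in> M <+> PIdl a" unfolding set_add_def' using M.zero_closed by blast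
    with a(2) max[OF K MK] have "(M <+> PIdl a) \<inter> S \<noteq> {}" by auto
    then show ?thesis by (auto simp: set_add_def' cgenideal_def)
  qed
  have "primeideal M R"
  proof (rule primeidealI)
    show "carrier R \<noteq> M" using S(1,2) M(3) by blast
    fix a b assume ab: "a \<in> carrier R" "b \<in> carrier R" "a \<otimes> b \<in> M"
    show "a \<in> M \<or> b \<in> M"
    proof (rule ccontr)
      assume "\<not> ?thesis"
      then obtain m r m' r' where mr: "m \<in> M" "r \<in> carrier R" "m \<oplus> r \<otimes> a \<in> S"
        and mr': "m' \<in> M" "r' \<in> carrier R" "m' \<oplus> r' \<otimes> b \<in> S"
        using meet[OF ab(1)] meet[OF ab(2)] by auto
      note cl = M.Icarr[OF mr(1)] M.Icarr[OF mr'(1)] mr(2) mr'(2) ab(1,2)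
      \<comment> \<open>The product of two elements of \<open>S\<close>, one built from
        \<open>M\<close> and \<open>a\<close>, the other from \<open>M\<close> and \<open>b\<close>,
        expands into terms that all lie in \<open>M\<close>.\<close>
      have "(m \<oplus> r \<otimes> a) \<otimes> (m' \<oplus> r' \<otimes> b) = m \<otimes> (m' \<oplus> r' \<otimes> b) \<oplus> ((r \<otimes> a) \<otimes> m' \<oplus> (r \<otimes> r') \<otimes> (a \<otimes> b))"
        using cl by (simp add: l_distr r_distr m_ac)
      also have "\<dots> \<in> M"
        using cl by (intro M.a_closed M.I_r_closed[OF mr(1)] M.I_l_closed[OF mr'(1)] M.I_l_closed[OF ab(3)]) auto
      finally show False using S(3)[OF mr(3) mr'(3)] M(3) by auto
    qed
  qed (use M(1) is_cring in auto)
  with M show ?thesis by blast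
qed

text \<open>The chain of primes is built from the top. If \<open>y\<close> is a nonzerodivisor modulo \<open>J\<close> and
  \<open>P\<close> is a prime containing \<open>J\<close> and \<open>y\<close>, then \<open>J\<close> avoids all products \<open>s y\<^sup>j\<close> with \<open>s \<notin> P\<close>.\<close>

lemma (in cring) primeideal_below:
  assumes J: "ideal J R" "J \<subseteq> P" and P: "primeideal P R" and y: "y \<in> P"
    and reg: "\<And>a. a \<in> carrier R \<Longrightarrow> y \<otimes> a \<in> J \<Longrightarrow> a \<in> J"
  shows "\<exists>Q. primeideal Q R \<and> J \<subseteq> Q \<and> Q \<subset> P"
proof -
  interpret P: primeideal P R by fact
  have yc: "y \<in> carrier R" using y by (rule P.Icarr)
  define S where "S = {s \<otimes> y [^] (j::nat) | s j. s \<in> carrier R - P}"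
  have "\<exists>Q. primeideal Q R \<and> J \<subseteq> Q \<and> Q \<inter> S = {}"
  proof (rule primeideal_avoiding[OF J(1)])
    show "S \<subseteq> carrier R" using yc by (auto simp: S_def)
    have one: "\<one> \<notin> P" using P.one_imp_carrier P.I_notcarr by auto
    have "\<one> = \<one> \<otimes> y [^] (0::nat)" by simp
    with one show "\<one> \<in> S" unfolding S_def by blast
    fix a b assume "a \<in> S" "b \<in> S"
    then obtain s t i j where st: "s \<in> carrier R - P" "t \<in> carrier R - P" "a = s \<otimes> y [^] (i::nat)" "b = t \<otimes> y [^] (j::nat)"
      by (auto simp: S_def)
    have "a \<otimes> b = (s \<otimes> t) \<otimes> y [^] (i + j)"
      using st yc by (simp add: nat_pow_mult[symmetric] m_ac)
    moreover have "s \<otimes> t \<in> carrier R - P" using st(1,2) P.I_prime by auto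
    ultimately show "a \<otimes> b \<in> S" unfolding S_def by blast
  next
    have "s \<in> J" if "s \<in> carrier R" "s \<otimes> y [^] (j::nat) \<in> J" for s j
      using that(2)
    proof (induction j)
      case (Suc j)
      have "y \<otimes> (s \<otimes> y [^] j) = s \<otimes> y [^] Suc j"
        using that(1) yc by (simp add: m_ac)
      then have "s \<otimes> y [^] j \<in> J" using Suc.prems reg[of "s \<otimes> y [^] j"] that(1) yc by simp
      then show ?case by (rule Suc.IH)
    qed (use that(1) in simp)
    then show "J \<inter> S = {}" using J(2) by (auto simp: S_def)
  qed
  then obtain Q where Q: "primeideal Q R" "J \<subseteq> Q" "Q \<inter> S = {}" by blast
  have "Q \<subseteq> P"
  proof
    fix q assume q: "q \<in> Q"
    then have qc: "q \<in> carrier R" by (rule ideal.Icarr[OF primeideal.axioms(1)[OF Q(1)]])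
    show "q \<in> P"
    proof (rule ccontr)
      assume "q \<notin> P"
      moreover have "q = q \<otimes> y [^] (0::nat)" using qc by simp
      ultimately have "q \<in> S" using qc unfolding S_def by blast
      with q Q(3) show False by blast
    qed
  qed
  moreover have "y \<notin> Q"
  proof -
    have "\<one> \<notin> P" using P.one_imp_carrier P.I_notcarr by auto
    moreover have "y = \<one> \<otimes> y [^] (1::nat)" using yc by simp
    ultimately have "y \<in> S" unfolding S_def by blast
    with Q(3) show ?thesis by blast
  qed
  ultimately show ?thesis using Q y by blast
qed

text \<open>Starting from a prime over the whole ideal, the generators are dropped one by one from
  the end, and each drop makes room for a strictly smaller prime by
  \<open>primeideal_below\<close>.\<close>

lemma (in cring) regular_sequence_le_krull_dim:
  assumes "regular_sequence R xs"
  shows "enat (length xs) \<le> krull_dim R"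
proof -
  have xs: "set xs \<subseteq> carrier R" "Idl (set xs) \<noteq> carrier R"
    and reg: "\<And>i a. i < length xs \<Longrightarrow> a \<in> carrier R \<Longrightarrow>
      xs ! i \<otimes> a \<in> Idl (set (take i xs)) \<Longrightarrow> a \<in> Idl (set (take i xs))"
    using assms by (auto simp: regular_sequence_def)
  have sub: "set (take i xs) \<subseteq> carrier R" for i
    using xs(1) by (meson in_set_takeD subsetD subsetI)
  have chain: "\<exists>P :: nat \<Rightarrow> 'a set. (\<forall>i\<le>k. primeideal (P i) R) \<and> (\<forall>i<k. P i \<subset> P (Suc i))
      \<and> Idl (set (take (length xs - k) xs)) \<subseteq> P 0" if "k \<le> length xs" for k
    using that
  proof (induction k)
    case 0
    have id: "ideal (Idl (set xs)) R" by (rule genideal_ideal[OF xs(1)])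
    have "\<one> \<notin> Idl (set xs)" using ideal.one_imp_carrier[OF id] xs(2) by blast
    then have "\<exists>P. primeideal P R \<and> Idl (set xs) \<subseteq> P \<and> P \<inter> {\<one>} = {}"
      by (intro primeideal_avoiding[OF id]) auto
    then obtain P where "primeideal P R" "Idl (set xs) \<subseteq> P" by auto
    then show ?case by (intro exI[of _ "\<lambda>_. P"]) simp
  next
    case (Suc k)
    then obtain P where P: "\<forall>i\<le>k. primeideal (P i) R" "\<forall>i<k. P i \<subset> P (Suc i)"
      "Idl (set (take (length xs - k) xs)) \<subseteq> P 0" by auto
    define m where "m = length xs - Suc k"
    have m: "m < length xs" "length xs - k = Suc m" using Suc.prems by (auto simp: m_def)
    let ?J = "Idl (set (take m xs))"
    have "?J \<subseteq> Idl (set (take (Suc m) xs))"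
      by (rule subset_Idl_subset[OF sub]) (simp add: set_take_subset_set_take)
    then have JP: "?J \<subseteq> P 0" using P(3) m(2) by simp
    have "xs ! m \<in> set (take (Suc m) xs)" using m(1) by (simp add: take_Suc_conv_app_nth)
    then have y: "xs ! m \<in> P 0" using genideal_self[OF sub] P(3) m(2) by auto
    obtain Q where Q: "primeideal Q R" "?J \<subseteq> Q" "Q \<subset> P 0"
      using primeideal_below[OF genideal_ideal[OF sub] JP _ y reg[OF m(1)]] P(1) by blast
    \<comment> \<open>The new prime becomes the bottom of the chain and shifts the others by
      one.\<close>
    define P' where "P' = (\<lambda>i. case i of 0 \<Rightarrow> Q | Suc i \<Rightarrow> P i)"
    have "\<forall>i\<le>Suc k. primeideal (P' i) R" using P(1) Q(1) by (auto simp: P'_def split: nat.split)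
    moreover have "\<forall>i<Suc k. P' i \<subset> P' (Suc i)"
    proof (intro allI impI)
      fix i assume "i < Suc k"
      then show "P' i \<subset> P' (Suc i)" using P(2) Q(3) by (cases i) (simp_all add: P'_def)
    qed
    moreover have "Idl (set (take (length xs - Suc k) xs)) \<subseteq> P' 0"
      using Q(2) by (simp add: P'_def m_def)
    ultimately show ?case by blast
  qed
  show ?thesis unfolding krull_dim_def
    by (rule Sup_upper) (use chain[of "length xs"] in auto)
qed

lemma (in cring) local_depth_le_krull_dim: "local_depth R \<le> krull_dim R"
  unfolding local_depth_def
  by (rule Sup_least) (auto intro: regular_sequence_le_krull_dim)

subsection \<open>Localization\<close>

locale mult_localization = cring R for R (structure) +
  fixes S
  assumes S_carrier: "S \<subseteq> carrier R" and S_one: "\<one> \<in> S"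
    and S_mult: "\<And>x y. x \<in> S \<Longrightarrow> y \<in> S \<Longrightarrow> x \<otimes> y \<in> S"
begin

abbreviation frac where "frac \<equiv> frac_class R S"
abbreviation Loc where "Loc \<equiv> localization R S"

lemma S_closed [simp]: "s \<in> S \<Longrightarrow> s \<in> carrier R"
  using S_carrier by blast

lemma equiv_frac_rel: "equiv (carrier R \<times> S) (frac_rel R S)"
proof (rule equivI)
  show "frac_rel R S \<subseteq> (carrier R \<times> S) \<times> (carrier R \<times> S)"
    by (auto simp: frac_rel_def)
  show "refl_on (carrier R \<times> S) (frac_rel R S)"
    using S_one by (auto simp: refl_on_def frac_rel_def)
  show "sym (frac_rel R S)"
    by (auto simp: sym_def frac_rel_def) metis
  show "trans (frac_rel R S)"
  proof (rule transI)
    fix x y z assume "(x, y) \<in> frac_rel R S" "(y, z) \<in> frac_rel R S"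
    then obtain a s b t c w u v where *: "x = (a, s)" "y = (b, t)" "z = (c, w)"
      "a \<in> carrier R" "b \<in> carrier R" "c \<in> carrier R" "s \<in> S" "t \<in> S" "w \<in> S" "u \<in> S" "v \<in> S"
      and e: "u \<otimes> (a \<otimes> t) = u \<otimes> (b \<otimes> s)" "v \<otimes> (b \<otimes> w) = v \<otimes> (c \<otimes> t)"
      by (auto simp: frac_rel_def)
    \<comment> \<open>The middle denominator \<open>t\<close> becomes part of the multiplier, since
      it may be a zero divisor.\<close>
    have "(u \<otimes> (v \<otimes> t)) \<otimes> (a \<otimes> w) = (v \<otimes> w) \<otimes> (u \<otimes> (a \<otimes> t))" using * by (simp add: m_ac)
    also have "\<dots> = (u \<otimes> s) \<otimes> (v \<otimes> (b \<otimes> w))" unfolding e(1) using * by (simp add: m_ac)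
    also have "\<dots> = (u \<otimes> (v \<otimes> t)) \<otimes> (c \<otimes> s)" unfolding e(2) using * by (simp add: m_ac)
    finally have "\<exists>q\<in>S. q \<otimes> (a \<otimes> w) = q \<otimes> (c \<otimes> s)" using * S_mult by blast
    then show "(x, z) \<in> frac_rel R S" using * by (auto simp: frac_rel_def)
  qed
qed

lemma frac_eq_iff:
  assumes "a \<in> carrier R" "s \<in> S" "b \<in> carrier R" "t \<in> S"
  shows "frac a s = frac b t \<longleftrightarrow> (\<exists>u\<in>S. u \<otimes> (a \<otimes> t) = u \<otimes> (b \<otimes> s))"
  unfolding frac_class_def using assms
  by (subst eq_equiv_class_iff[OF equiv_frac_rel]) (auto simp: frac_rel_def)

lemma frac_eqI:
  assumes "a \<in> carrier R" "s \<in> S" "b \<in> carrier R" "t \<in> S" "a \<otimes> t = b \<otimes> s"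
  shows "frac a s = frac b t"
  using assms S_one by (subst frac_eq_iff) auto

lemma carrier_Loc: "carrier Loc = {frac a s | a s. a \<in> carrier R \<and> s \<in> S}"
  by (auto simp: localization_def quotient_def frac_class_def)

lemma frac_in_carrier [simp]: "a \<in> carrier R \<Longrightarrow> s \<in> S \<Longrightarrow> frac a s \<in> carrier Loc"
  by (auto simp: carrier_Loc)

lemma Loc_mult:
  assumes "a \<in> carrier R" "s \<in> S" "b \<in> carrier R" "t \<in> S"
  shows "frac a s \<otimes>\<^bsub>Loc\<^esub> frac b t = frac (a \<otimes> b) (s \<otimes> t)"
proof -
  let ?f = "\<lambda>x y. frac (fst x \<otimes> fst y) (snd x \<otimes> snd y)"
  have "congruent2 (frac_rel R S) (frac_rel R S) ?f"
  proof (rule congruent2I[OF equiv_frac_rel equiv_frac_rel])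
    fix x x' y assume "(x, x') \<in> frac_rel R S" and y: "y \<in> carrier R \<times> S"
    then obtain a s a' s' u where *: "x = (a, s)" "x' = (a', s')" "a \<in> carrier R" "a' \<in> carrier R"
      "s \<in> S" "s' \<in> S" "u \<in> S" and e: "u \<otimes> (a \<otimes> s') = u \<otimes> (a' \<otimes> s)" by (auto simp: frac_rel_def)
    obtain b t where yt: "y = (b, t)" "b \<in> carrier R" "t \<in> S" using y by auto
    have "u \<otimes> ((a \<otimes> b) \<otimes> (s' \<otimes> t)) = (b \<otimes> t) \<otimes> (u \<otimes> (a \<otimes> s'))" using * yt by (simp add: m_ac)
    also have "\<dots> = u \<otimes> ((a' \<otimes> b) \<otimes> (s \<otimes> t))" unfolding e using * yt by (simp add: m_ac)
    finally show "?f x y = ?f x' y" using * yt S_mult by (simp add: frac_eq_iff) blast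
    have "u \<otimes> ((b \<otimes> a) \<otimes> (t \<otimes> s')) = (b \<otimes> t) \<otimes> (u \<otimes> (a \<otimes> s'))" using * yt by (simp add: m_ac)
    also have "\<dots> = u \<otimes> ((b \<otimes> a') \<otimes> (t \<otimes> s))" unfolding e using * yt by (simp add: m_ac)
    finally show "?f y x = ?f y x'" using * yt S_mult by (simp add: frac_eq_iff) blast
  qed
  from UN_equiv_class2[OF equiv_frac_rel equiv_frac_rel this, of "(a, s)" "(b, t)"] assms
  show ?thesis by (simp add: localization_def frac_class_def[symmetric] split_beta)
qed

lemma Loc_add:
  assumes "a \<in> carrier R" "s \<in> S" "b \<in> carrier R" "t \<in> S"
  shows "frac a s \<oplus>\<^bsub>Loc\<^esub> frac b t = frac (a \<otimes> t \<oplus> b \<otimes> s) (s \<otimes> t)"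
proof -
  let ?f = "\<lambda>x y. frac (fst x \<otimes> snd y \<oplus> fst y \<otimes> snd x) (snd x \<otimes> snd y)"
  have "congruent2 (frac_rel R S) (frac_rel R S) ?f"
  proof (rule congruent2I[OF equiv_frac_rel equiv_frac_rel])
    fix x x' y assume "(x, x') \<in> frac_rel R S" and y: "y \<in> carrier R \<times> S"
    then obtain a s a' s' u where *: "x = (a, s)" "x' = (a', s')" "a \<in> carrier R" "a' \<in> carrier R"
      "s \<in> S" "s' \<in> S" "u \<in> S" and e: "u \<otimes> (a \<otimes> s') = u \<otimes> (a' \<otimes> s)" by (auto simp: frac_rel_def)
    obtain b t where yt: "y = (b, t)" "b \<in> carrier R" "t \<in> S" using y by auto
    have "u \<otimes> ((a \<otimes> t \<oplus> b \<otimes> s) \<otimes> (s' \<otimes> t))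
      = (t \<otimes> t) \<otimes> (u \<otimes> (a \<otimes> s')) \<oplus> u \<otimes> (b \<otimes> (s \<otimes> (s' \<otimes> t)))"
      using * yt by (simp add: m_ac r_distr l_distr)
    also have "\<dots> = u \<otimes> ((a' \<otimes> t \<oplus> b \<otimes> s') \<otimes> (s \<otimes> t))"
      unfolding e using * yt by (simp add: m_ac r_distr l_distr)
    finally show 1: "?f x y = ?f x' y" using * yt S_mult by (simp add: frac_eq_iff) blast
    show "?f y x = ?f y x'" using 1 * yt by (simp add: m_comm a_comm)
  qed
  from UN_equiv_class2[OF equiv_frac_rel equiv_frac_rel this, of "(a, s)" "(b, t)"] assms
  show ?thesis by (simp add: localization_def frac_class_def[symmetric] split_beta)
qed

lemma Loc_one: "\<one>\<^bsub>Loc\<^esub> = frac \<one> \<one>" and Loc_zero: "\<zero>\<^bsub>Loc\<^esub> = frac \<zero> \<one>"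
  by (simp_all add: localization_def)

lemma cring_Loc: "cring Loc"
proof -
  note simps = Loc_one Loc_zero Loc_mult Loc_add S_mult S_one m_ac r_distr l_distr a_ac
  show ?thesis
  proof (rule cringI)
    show "abelian_group Loc"
    proof (rule abelian_groupI)
      fix x y assume "x \<in> carrier Loc" "y \<in> carrier Loc"
      then show "x \<oplus>\<^bsub>Loc\<^esub> y \<in> carrier Loc"
        by (auto simp: carrier_Loc[of] simps) (auto simp: carrier_Loc intro!: exI S_mult)
    next
      fix x y z assume "x \<in> carrier Loc" "y \<in> carrier Loc" "z \<in> carrier Loc"
      then obtain a s b t c w where "x = frac a s" "y = frac b t" "z = frac c w"
        "a \<in> carrier R" "b \<in> carrier R" "c \<in> carrier R" "s \<in> S" "t \<in> S" "w \<in> S"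
        by (auto simp: carrier_Loc)
      then show "x \<oplus>\<^bsub>Loc\<^esub> y \<oplus>\<^bsub>Loc\<^esub> z = x \<oplus>\<^bsub>Loc\<^esub> (y \<oplus>\<^bsub>Loc\<^esub> z)"
        by (simp add: simps)
    next
      fix x y assume "x \<in> carrier Loc" "y \<in> carrier Loc"
      then obtain a s b t where "x = frac a s" "y = frac b t"
        "a \<in> carrier R" "b \<in> carrier R" "s \<in> S" "t \<in> S"
        by (auto simp: carrier_Loc)
      then show "x \<oplus>\<^bsub>Loc\<^esub> y = y \<oplus>\<^bsub>Loc\<^esub> x" by (simp add: simps)
    next
      show "\<zero>\<^bsub>Loc\<^esub> \<in> carrier Loc" using S_one by (simp add: Loc_zero)
    next
      fix x assume "x \<in> carrier Loc"
      then obtain a s where x: "x = frac a s" "a \<in> carrier R" "s \<in> S" by (auto simp: carrier_Loc)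
      then show "\<zero>\<^bsub>Loc\<^esub> \<oplus>\<^bsub>Loc\<^esub> x = x" by (simp add: simps)
      have "frac (\<ominus> a) s \<oplus>\<^bsub>Loc\<^esub> x = frac (\<ominus> a \<otimes> s \<oplus> a \<otimes> s) (s \<otimes> s)" using x by (simp add: Loc_add)
      also have "\<dots> = \<zero>\<^bsub>Loc\<^esub>"
        using x S_one S_mult by (simp add: Loc_zero l_minus l_neg) (intro frac_eqI, auto)
      finally show "\<exists>y\<in>carrier Loc. y \<oplus>\<^bsub>Loc\<^esub> x = \<zero>\<^bsub>Loc\<^esub>" using x by (intro bexI[of _ "frac (\<ominus> a) s"]) auto
    qed
    show "comm_monoid Loc"
    proof (rule comm_monoidI)
      fix x y assume "x \<in> carrier Loc" "y \<in> carrier Loc"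
      then obtain a s b t where xy: "x = frac a s" "y = frac b t"
        "a \<in> carrier R" "b \<in> carrier R" "s \<in> S" "t \<in> S"
        by (auto simp: carrier_Loc)
      then show "x \<otimes>\<^bsub>Loc\<^esub> y \<in> carrier Loc" by (simp add: Loc_mult S_mult)
      show "x \<otimes>\<^bsub>Loc\<^esub> y = y \<otimes>\<^bsub>Loc\<^esub> x" using xy by (simp add: simps)
    next
      fix x y z assume "x \<in> carrier Loc" "y \<in> carrier Loc" "z \<in> carrier Loc"
      then obtain a s b t c w where "x = frac a s" "y = frac b t" "z = frac c w"
        "a \<in> carrier R" "b \<in> carrier R" "c \<in> carrier R" "s \<in> S" "t \<in> S" "w \<in> S"
        by (auto simp: carrier_Loc)
      then show "x \<otimes>\<^bsub>Loc\<^esub> y \<otimes>\<^bsub>Loc\<^esub> z = x \<otimes>\<^bsub>Loc\<^esub> (y \<otimes>\<^bsub>Loc\<^esub> z)"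
        by (simp add: simps)
    next
      show "\<one>\<^bsub>Loc\<^esub> \<in> carrier Loc" using S_one by (simp add: Loc_one)
    next
      fix x assume "x \<in> carrier Loc"
      then obtain a s where x: "x = frac a s" "a \<in> carrier R" "s \<in> S" by (auto simp: carrier_Loc)
      then show "\<one>\<^bsub>Loc\<^esub> \<otimes>\<^bsub>Loc\<^esub> x = x" by (simp add: simps)
    qed
  next
    fix x y z assume "x \<in> carrier Loc" "y \<in> carrier Loc" "z \<in> carrier Loc"
    then obtain a s b t c w where *: "x = frac a s" "y = frac b t" "z = frac c w"
      "a \<in> carrier R" "b \<in> carrier R" "c \<in> carrier R" "s \<in> S" "t \<in> S" "w \<in> S"
      by (auto simp: carrier_Loc)
    \<comment> \<open>The second fraction has an additional factor \<open>w\<close> above and below,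
      so the two agree as fractions but not componentwise.\<close>
    have "frac ((a \<otimes> t \<oplus> b \<otimes> s) \<otimes> c) (s \<otimes> t \<otimes> w) =
        frac ((a \<otimes> c) \<otimes> (t \<otimes> w) \<oplus> (b \<otimes> c) \<otimes> (s \<otimes> w)) ((s \<otimes> w) \<otimes> (t \<otimes> w))"
      using * by (intro frac_eqI) (simp_all add: simps)
    then show "(x \<oplus>\<^bsub>Loc\<^esub> y) \<otimes>\<^bsub>Loc\<^esub> z = x \<otimes>\<^bsub>Loc\<^esub> z \<oplus>\<^bsub>Loc\<^esub> y \<otimes>\<^bsub>Loc\<^esub> z"
      using * by (simp add: Loc_mult Loc_add S_mult)
  qed
qed

definition to_Loc where "to_Loc a = frac a \<one>"

lemma to_Loc_hom: "to_Loc \<in> ring_hom R Loc"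
  by (rule ring_hom_memI) (simp_all add: to_Loc_def S_one Loc_mult Loc_add Loc_one)

lemma to_Loc_surj:
  assumes "z \<in> carrier Loc"
  shows "\<exists>a\<in>carrier R. \<exists>s\<in>S. z \<otimes>\<^bsub>Loc\<^esub> to_Loc s = to_Loc a"
proof -
  from assms obtain a s where z: "z = frac a s" "a \<in> carrier R" "s \<in> S" by (auto simp: carrier_Loc)
  have "frac (a \<otimes> s) s = frac a \<one>" using z S_one by (intro frac_eqI) auto
  then have "z \<otimes>\<^bsub>Loc\<^esub> to_Loc s = to_Loc a" using z S_one by (simp add: to_Loc_def Loc_mult)
  with z show ?thesis by blast
qed

lemma to_Loc_eq_0_iff:
  assumes "a \<in> carrier R"
  shows "to_Loc a = \<zero>\<^bsub>Loc\<^esub> \<longleftrightarrow> (\<exists>u\<in>S. u \<otimes> a = \<zero>)"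
  using assms S_one by (simp add: to_Loc_def Loc_zero frac_eq_iff)

lemma to_Loc_unit:
  assumes "s \<in> S"
  shows "to_Loc s \<in> Units Loc"
proof -
  interpret L: cring Loc by (rule cring_Loc)
  have "frac \<one> s \<otimes>\<^bsub>Loc\<^esub> to_Loc s = \<one>\<^bsub>Loc\<^esub>"
    using assms S_one by (simp add: to_Loc_def Loc_mult Loc_one) (intro frac_eqI, auto)
  then show ?thesis
    using assms S_one L.m_comm[of "frac \<one> s" "to_Loc s"]
    by (auto simp: Units_def to_Loc_def intro!: bexI[of _ "frac \<one> s"])
qed

end

text \<open>Records what is used of the localization \<open>L\<close> of the quotient by
  \<open>G\<close> at a prime with preimage \<open>M\<close>: elements are fractions
  (\<open>surj\<close>), the kernel of \<open>\<pi>\<close> is known (\<open>ker\<close>) and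
  denominators are invertible (\<open>unit\<close>). Computations then take place among polynomials
  instead of classes of pairs of cosets.\<close>

locale poly_localization = L: cring L for L :: "('b, 'c) ring_scheme" (structure) +
  fixes n :: nat and G :: "'k::field mpoly set" and M :: "'k mpoly set" and \<pi> :: "'k mpoly \<Rightarrow> 'b"
  assumes prime_M: "primeideal M (polynomial_ring n)" and G_sub: "G \<subseteq> M"
    and hom: "\<pi> \<in> ring_hom (polynomial_ring n) L"
    and surj: "\<And>z. z \<in> carrier L \<Longrightarrow> \<exists>a\<in>polys {1..n}. \<exists>w\<in>polys {1..n} - M. z \<otimes> \<pi> w = \<pi> a"
    and ker: "\<And>a. a \<in> polys {1..n} \<Longrightarrow> \<pi> a = \<zero> \<longleftrightarrow> (\<exists>w\<in>polys {1..n} - M. w * a \<in> pideal.span G)"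
    and unit: "\<And>w. w \<in> polys {1..n} - M \<Longrightarrow> \<pi> w \<in> Units L"
begin

abbreviation "R \<equiv> polynomial_ring n :: 'k mpoly ring"
abbreviation "W \<equiv> polys {1..n} - M"

sublocale R: cring R by (rule cring_polynomial_ring)
sublocale M: primeideal M R by (rule prime_M)

lemma \<pi>_closed [simp]: "a \<in> polys {1..n} \<Longrightarrow> \<pi> a \<in> carrier L"
  using ring_hom_closed[OF hom] by simp

lemma \<pi>_mult: "a \<in> polys {1..n} \<Longrightarrow> b \<in> polys {1..n} \<Longrightarrow> \<pi> (a * b) = \<pi> a \<otimes> \<pi> b"
  and \<pi>_add: "a \<in> polys {1..n} \<Longrightarrow> b \<in> polys {1..n} \<Longrightarrow> \<pi> (a + b) = \<pi> a \<oplus> \<pi> b"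
  and \<pi>_one: "\<pi> 1 = \<one>"
  using ring_hom_mult[OF hom] ring_hom_add[OF hom] ring_hom_one[OF hom] by simp_all

lemma M_sub: "M \<subseteq> polys {1..n}"
  using M.a_subset by simp

lemma one_W: "1 \<in> W"
  using M.one_imp_carrier M.I_notcarr by auto

lemma W_mult: "v \<in> W \<Longrightarrow> w \<in> W \<Longrightarrow> v * w \<in> W"
  using M.I_prime[of v w] by (auto intro: polys_mult)

lemma \<pi>_span_G: "g \<in> polys {1..n} \<Longrightarrow> g \<in> pideal.span G \<Longrightarrow> \<pi> g = \<zero>"
  using ker[of g] bexI[OF _ one_W, of "\<lambda>w. w * g \<in> pideal.span G"] by simp

lemma \<pi>_G: "g \<in> G \<Longrightarrow> \<pi> g = \<zero>"
  using \<pi>_span_G[of g] G_sub M_sub pideal.span_base[of g G] by blast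

text \<open>The extension of \<open>K\<close> to \<open>L\<close>, that is, the fractions with
  numerator in \<open>K\<close>, stated by clearing the denominator \<open>w\<close>.\<close>

definition ext :: "'k mpoly set \<Rightarrow> 'b set" where
  "ext K = {z \<in> carrier L. \<exists>a\<in>K. \<exists>w\<in>W. z \<otimes> \<pi> w = \<pi> a}"

lemma extI: "z \<in> carrier L \<Longrightarrow> a \<in> K \<Longrightarrow> w \<in> W \<Longrightarrow> z \<otimes> \<pi> w = \<pi> a \<Longrightarrow> z \<in> ext K"
  unfolding ext_def by blast

lemma \<pi>_in_extI: "a \<in> K \<Longrightarrow> a \<in> polys {1..n} \<Longrightarrow> \<pi> a \<in> ext K"
  by (rule extI[OF _ _ one_W]) (simp_all add: \<pi>_one)

lemma ideal_polysD:
  assumes "ideal K R"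
  shows "K \<subseteq> polys {1..n}" "0 \<in> K" "a \<in> K \<Longrightarrow> b \<in> K \<Longrightarrow> a + b \<in> K"
    "a \<in> K \<Longrightarrow> c \<in> polys {1..n} \<Longrightarrow> c * a \<in> K" "a \<in> K \<Longrightarrow> - a \<in> K"
proof -
  interpret ideal K R by fact
  show s: "K \<subseteq> polys {1..n}" using a_subset by simp
  show "0 \<in> K" using zero_closed by simp
  show "a \<in> K \<Longrightarrow> b \<in> K \<Longrightarrow> a + b \<in> K" using a_closed by simp
  show "a \<in> K \<Longrightarrow> c \<in> polys {1..n} \<Longrightarrow> c * a \<in> K" for c using I_l_closed by simp
  from this[of "- 1"] show "a \<in> K \<Longrightarrow> - a \<in> K" by (simp add: polys_minus)
qed

lemma ext_ideal:
  assumes K: "ideal K R"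
  shows "ideal (ext K) L"
proof (rule idealI)
  note Kd = ideal_polysD[OF K]
  have mult: "x \<otimes> z \<in> ext K" if z: "z \<in> ext K" and x: "x \<in> carrier L" for x z
  proof -
    from z obtain a w where aw: "z \<in> carrier L" "a \<in> K" "w \<in> W" "z \<otimes> \<pi> w = \<pi> a" by (auto simp: ext_def)
    from surj[OF x] obtain b v where bv: "b \<in> polys {1..n}" "v \<in> W" "x \<otimes> \<pi> v = \<pi> b" by auto
    have "(x \<otimes> z) \<otimes> \<pi> (v * w) = (x \<otimes> \<pi> v) \<otimes> (z \<otimes> \<pi> w)"
      using x aw(1,3) bv(2) by (simp add: \<pi>_mult L.m_ac)
    also have "\<dots> = \<pi> (b * a)" using aw(2,4) bv(1,3) Kd(1) by (auto simp: \<pi>_mult)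
    finally show ?thesis
      using x aw(1) by (intro extI[OF _ Kd(4)[OF aw(2) bv(1)] W_mult[OF bv(2) aw(3)]]) auto
  qed
  show "subgroup (ext K) (add_monoid L)"
  proof (rule L.add.subgroupI)
    show "ext K \<subseteq> carrier L" by (auto simp: ext_def)
    have "\<pi> 0 = \<zero>" using \<pi>_span_G[of 0] by (simp add: pideal.span_zero)
    then have "\<zero> \<in> ext K" using \<pi>_in_extI[OF Kd(2)] by simp
    then show "ext K \<noteq> {}" by blast
  next
    fix z assume z: "z \<in> ext K"
    then have "z \<in> carrier L" by (simp add: ext_def)
    then have "\<ominus> z = (\<ominus> \<one>) \<otimes> z" by (simp add: L.l_minus)
    then show "\<ominus> z \<in> ext K" using mult[OF z, of "\<ominus> \<one>"] by simp
  next
    fix x z assume "x \<in> ext K" "z \<in> ext K"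
    then obtain a w b v where *: "z \<in> carrier L" "a \<in> K" "w \<in> W" "z \<otimes> \<pi> w = \<pi> a"
      "x \<in> carrier L" "b \<in> K" "v \<in> W" "x \<otimes> \<pi> v = \<pi> b" by (auto simp: ext_def)
    have ab: "a \<in> polys {1..n}" "b \<in> polys {1..n}" using * Kd(1) by auto
    have "(x \<oplus> z) \<otimes> \<pi> (v * w) = (x \<otimes> \<pi> v) \<otimes> \<pi> w \<oplus> (z \<otimes> \<pi> w) \<otimes> \<pi> v"
      using *(1,3,5,7) by (simp add: \<pi>_mult L.m_ac L.l_distr L.r_distr)
    also have "\<dots> = \<pi> (w * b + v * a)" using * ab by (simp add: \<pi>_mult \<pi>_add polys_mult L.m_comm)
    finally show "x \<oplus> z \<in> ext K"
      using * by (intro extI[OF _ Kd(3)[OF Kd(4)[OF *(6), of w] Kd(4)[OF *(2), of v]] W_mult[OF *(7,3)]]) auto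
  qed
  show "x \<otimes> z \<in> ext K" "z \<otimes> x \<in> ext K" if "z \<in> ext K" "x \<in> carrier L" for x z
    using mult[OF that] that L.m_comm[of z x] by (auto simp: ext_def)
qed (rule L.ring_axioms)

text \<open>If \<open>a\<close> equals a fraction with numerator \<open>b\<close> and denominator
  \<open>w\<close>, then a multiplier from \<open>W\<close> carries \<open>a * w - b\<close> into
  the ideal of \<open>G\<close>, which lies in \<open>K\<close>; hence a multiple of
  \<open>a\<close> lies in \<open>K\<close> too.\<close>

lemma \<pi>_in_extD:
  assumes K: "ideal K R" "pideal.span G \<inter> polys {1..n} \<subseteq> K" and a: "a \<in> polys {1..n}" "\<pi> a \<in> ext K"
  shows "\<exists>w\<in>W. w * a \<in> K"
proof -
  note Kd = ideal_polysD[OF K(1)]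
  from a obtain b w where b: "b \<in> K" "w \<in> W" "\<pi> a \<otimes> \<pi> w = \<pi> b" by (auto simp: ext_def)
  have bp: "b \<in> polys {1..n}" using b(1) Kd(1) by auto
  have "a * w = (a * w - b) + b" by simp
  then have "\<pi> (a * w) = \<pi> (a * w - b) \<oplus> \<pi> b"
    using a(1) b(2) bp \<pi>_add[of "a * w - b" b] by (simp add: polys_closed)
  moreover have "\<pi> (a * w) = \<pi> b" using a(1) b by (simp add: \<pi>_mult)
  ultimately have "\<pi> (a * w - b) = \<zero>"
    using L.add.l_cancel_one'[of "\<pi> b" "\<pi> (a * w - b)"] L.add.r_cancel_one'[of "\<pi> b" "\<pi> (a * w - b)"]
      a(1) b(2) bp by (simp add: polys_closed)
  then obtain v where v: "v \<in> W" "v * (a * w - b) \<in> pideal.span G"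
    using ker[of "a * w - b"] a(1) b(2) bp by (auto simp: polys_closed)
  have "v * (a * w - b) \<in> polys {1..n}" using v(1) a(1) b(2) bp by (auto intro!: polys_closed)
  with v K(2) have "v * (a * w - b) \<in> K" by blast
  moreover have "v * b \<in> K" using Kd(4)[OF b(1)] v(1) by blast
  ultimately have "v * (a * w - b) + v * b \<in> K" by (rule Kd(3))
  moreover have "v * (a * w - b) + v * b = (v * w) * a" by (simp add: algebra_simps)
  ultimately have "(v * w) * a \<in> K" by simp
  with W_mult[OF v(1) b(2)] show ?thesis by blast
qed

lemma unit_cancel:
  assumes J: "ideal J L" and z: "z \<in> carrier L" "w \<in> W" "z \<otimes> \<pi> w \<in> J"
  shows "z \<in> J"
proof -
  have "z = (z \<otimes> \<pi> w) \<otimes> inv\<^bsub>L\<^esub> \<pi> w"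
    using z(1,2) unit[OF z(2)] by (simp add: L.m_assoc)
  with ideal.I_r_closed[OF J z(3), of "inv\<^bsub>L\<^esub> \<pi> w"] unit[OF z(2)] show ?thesis by simp
qed

lemma span_G_M: "pideal.span G \<inter> polys {1..n} \<subseteq> M"
proof -
  have "Idl\<^bsub>R\<^esub> G \<subseteq> M" by (rule R.genideal_minimal[OF M.is_ideal G_sub])
  then show ?thesis using Idl_polynomial_ring[of G n] G_sub M_sub by auto
qed

lemma ext_M_proper: "\<one> \<notin> ext M"
proof
  assume "\<one> \<in> ext M"
  then have "\<exists>w\<in>W. w * 1 \<in> M"
    by (intro \<pi>_in_extD M.is_ideal span_G_M) (auto simp: \<pi>_one)
  then show False by auto
qed

lemma not_ext_M_unit:
  assumes "z \<in> carrier L" "z \<notin> ext M"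
  shows "z \<in> Units L"
proof -
  obtain a w where aw: "a \<in> polys {1..n}" "w \<in> W" "z \<otimes> \<pi> w = \<pi> a" using surj[OF assms(1)] by auto
  then have "a \<notin> M" using assms by (auto simp: ext_def)
  then have "\<pi> a \<in> Units L" using aw(1) unit by blast
  with aw(3) have "z \<otimes> \<pi> w \<in> Units L" by simp
  then show ?thesis using assms(1) aw(2) L.unit_factor[of z "\<pi> w"] by simp
qed

text \<open>Elements outside \<open>ext M\<close> are units, so every proper ideal lies in
  \<open>ext M\<close>. This evaluates the \<open>THE\<close> in \<open>local_depth\<close>.\<close>

lemma the_maximalideal: "(THE N. maximalideal N L) = ext M"
proof (rule the_equality)
  have id: "ideal (ext M) L" by (rule ext_ideal[OF M.is_ideal])
  have proper_sub: "J \<subseteq> ext M" if J: "ideal J L" "J \<noteq> carrier L" for J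
  proof
    fix z assume z: "z \<in> J"
    have zc: "z \<in> carrier L" by (rule ideal.Icarr[OF J(1) z])
    show "z \<in> ext M"
    proof (rule ccontr)
      assume "z \<notin> ext M"
      with zc have "z \<in> Units L" by (rule not_ext_M_unit)
      then have "\<one> \<in> J" using ideal.I_r_closed[OF J(1) z, of "inv\<^bsub>L\<^esub> z"] by simp
      with J show False using ideal.one_imp_carrier by blast
    qed
  qed
  show max: "maximalideal (ext M) L"
  proof (rule maximalidealI[OF id])
    show "carrier L \<noteq> ext M" using ext_M_proper by auto
    fix J assume "ideal J L" "ext M \<subseteq> J" "J \<subseteq> carrier L"
    with proper_sub[of J] show "J = ext M \<or> J = carrier L" by auto
  qed
  fix N assume N: "maximalideal N L"
  then interpret N: maximalideal N L .
  have "N \<subseteq> ext M" using proper_sub[OF N.is_ideal] N.I_notcarr by simp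
  then show "N = ext M"
    using N.I_maximal[OF id] id ext_M_proper ideal.Icarr[OF id] by auto
qed

text \<open>The polynomials in \<open>G\<close> map to zero, so they are adjoined to
  \<open>Y\<close> when the ideal is described by its numerators.\<close>

lemma Idl_ext:
  assumes Y: "Y \<subseteq> polys {1..n}"
  shows "Idl (\<pi> ` Y) = ext (Idl\<^bsub>R\<^esub> (G \<union> Y))"
proof
  have GY: "G \<union> Y \<subseteq> carrier R" using G_sub M_sub Y by auto
  have id: "ideal (Idl\<^bsub>R\<^esub> (G \<union> Y)) R" by (rule R.genideal_ideal[OF GY])
  have \<pi>Y: "\<pi> ` Y \<subseteq> carrier L" using Y by auto
  show "Idl (\<pi> ` Y) \<subseteq> ext (Idl\<^bsub>R\<^esub> (G \<union> Y))"
  proof (rule L.genideal_minimal[OF ext_ideal[OF id]], rule image_subsetI)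
    fix y assume y: "y \<in> Y"
    then have "y \<in> Idl\<^bsub>R\<^esub> (G \<union> Y)" using R.genideal_self[OF GY] by blast
    then show "\<pi> y \<in> ext (Idl\<^bsub>R\<^esub> (G \<union> Y))"
      using y Y by (intro \<pi>_in_extI) auto
  qed
  have idL: "ideal (Idl (\<pi> ` Y)) L" by (rule L.genideal_ideal[OF \<pi>Y])
  have "ideal {r \<in> carrier R. \<pi> r \<in> Idl (\<pi> ` Y)} R"
  proof -
    interpret h: ring_hom_ring R L \<pi> by (rule ring_hom_ringI2[OF R.ring_axioms L.ring_axioms hom])
    show ?thesis by (rule h.ideal_vimage[OF idL])
  qed
  moreover have "G \<union> Y \<subseteq> {r \<in> carrier R. \<pi> r \<in> Idl (\<pi> ` Y)}"
    using GY L.genideal_self[OF \<pi>Y] \<pi>_G additive_subgroup.zero_closed[OF ideal.axioms(1)[OF idL]] by auto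
  ultimately have *: "Idl\<^bsub>R\<^esub> (G \<union> Y) \<subseteq> {r \<in> carrier R. \<pi> r \<in> Idl (\<pi> ` Y)}"
    by (rule R.genideal_minimal)
  show "ext (Idl\<^bsub>R\<^esub> (G \<union> Y)) \<subseteq> Idl (\<pi> ` Y)"
  proof
    fix z assume "z \<in> ext (Idl\<^bsub>R\<^esub> (G \<union> Y))"
    then obtain a w where "z \<in> carrier L" "a \<in> Idl\<^bsub>R\<^esub> (G \<union> Y)" "w \<in> W" "z \<otimes> \<pi> w = \<pi> a"
      by (auto simp: ext_def)
    moreover from this(2) * have "\<pi> a \<in> Idl (\<pi> ` Y)" by blast
    ultimately show "z \<in> Idl (\<pi> ` Y)" using unit_cancel[OF idL] by metis
  qed
qed

text \<open>Transfers regular sequences from polynomials to \<open>L\<close>. Denominators are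
  units, so a fraction can be replaced by its numerator, and ideal membership in \<open>L\<close>
  becomes membership in a span up to a multiplier from \<open>W\<close>.\<close>

lemma length_le_local_depth:
  assumes ys: "set ys \<subseteq> M"
    and reg: "\<And>i a w. i < length ys \<Longrightarrow> a \<in> polys {1..n} \<Longrightarrow> w \<in> W \<Longrightarrow>
      w * (ys ! i * a) \<in> pideal.span (G \<union> set (take i ys)) \<Longrightarrow>
      \<exists>v\<in>W. v * a \<in> pideal.span (G \<union> set (take i ys))"
  shows "enat (length ys) \<le> local_depth L"
proof -
  define xs where "xs = map \<pi> ys"
  have ysp: "set ys \<subseteq> polys {1..n}" using ys M_sub by blast
  have take_sub: "set (take i ys) \<subseteq> polys {1..n}" for i using ysp set_take_subset[of i ys] by blast
  have GY: "G \<union> set (take i ys) \<subseteq> polys {1..n}" for i using take_sub G_sub M_sub by auto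
  define K where "K i = Idl\<^bsub>R\<^esub> (G \<union> set (take i ys))" for i
  have K: "K i = pideal.span (G \<union> set (take i ys)) \<inter> polys {1..n}" for i
    unfolding K_def by (rule Idl_polynomial_ring[OF GY])
  have Kid: "ideal (K i) R" for i unfolding K_def by (rule R.genideal_ideal) (use GY in simp)
  have GK: "pideal.span G \<inter> polys {1..n} \<subseteq> K i" for i
    unfolding K using pideal.span_mono[of G "G \<union> set (take i ys)"] by blast
  have Idl_take: "Idl (set (take i xs)) = ext (K i)" for i
    using Idl_ext[OF take_sub[of i]] by (simp add: xs_def take_map K_def)
  have sub: "set xs \<subseteq> ext M"
  proof
    fix x assume "x \<in> set xs"
    then obtain y where y: "y \<in> set ys" "x = \<pi> y" by (auto simp: xs_def)
    with ys ysp have "y \<in> M" "y \<in> polys {1..n}" by blast+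
    with y(2) show "x \<in> ext M" using \<pi>_in_extI by simp
  qed
  have extM: "ideal (ext M) L" by (rule ext_ideal[OF M.is_ideal])
  have "regular_sequence L xs"
    unfolding regular_sequence_def
  proof (intro conjI allI impI ballI)
    show "set xs \<subseteq> carrier L" using ysp by (auto simp: xs_def)
    have "Idl (set xs) \<subseteq> ext M" by (rule L.genideal_minimal[OF extM sub])
    then show "Idl (set xs) \<noteq> carrier L" using ext_M_proper by auto
    fix i z assume i: "i < length xs" and z: "z \<in> carrier L" and "xs ! i \<otimes> z \<in> Idl (set (take i xs))"
    then have yz: "\<pi> (ys ! i) \<otimes> z \<in> ext (K i)" unfolding Idl_take by (simp add: xs_def)
    have i': "i < length ys" using i by (simp add: xs_def)
    then have yp: "ys ! i \<in> polys {1..n}" using ysp nth_mem by blast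
    obtain a w where aw: "a \<in> polys {1..n}" "w \<in> W" "z \<otimes> \<pi> w = \<pi> a" using surj[OF z] by auto
    have "\<pi> (ys ! i * a) = (\<pi> (ys ! i) \<otimes> z) \<otimes> \<pi> w"
      using yp aw z by (simp add: \<pi>_mult L.m_assoc)
    also have "\<dots> \<in> ext (K i)"
      using ideal.I_r_closed[OF ext_ideal[OF Kid] yz, of "\<pi> w"] aw(2) by simp
    finally obtain v where v: "v \<in> W" "v * (ys ! i * a) \<in> K i"
      using \<pi>_in_extD[OF Kid GK, of "ys ! i * a" i] yp aw(1) by (auto simp: polys_mult)
    then obtain u where u: "u \<in> W" "u * a \<in> pideal.span (G \<union> set (take i ys))"
      using reg[OF i' aw(1) v(1)] by (auto simp: K)
    have ua: "u * a \<in> K i" using u aw(1) by (auto simp: K intro: polys_mult)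
    have "z \<otimes> \<pi> (w * u) = (z \<otimes> \<pi> w) \<otimes> \<pi> u"
      using z aw(2) u(1) by (simp add: \<pi>_mult L.m_assoc)
    also have "\<dots> = \<pi> (u * a)" using aw u(1) by (simp add: \<pi>_mult L.m_comm)
    finally have "z \<in> ext (K i)" by (rule extI[OF z ua W_mult[OF aw(2) u(1)]])
    then show "z \<in> Idl (set (take i xs))" by (simp add: Idl_take)
  qed
  moreover have "length xs = length ys" by (simp add: xs_def)
  ultimately show ?thesis
    using sub unfolding local_depth_def the_maximalideal by (intro Sup_upper) (auto intro!: exI[of _ xs])
qed

text \<open>Contraction along \<open>\<pi>\<close> maps chains of primes of \<open>L\<close> to
  chains of primes between \<open>G\<close> and \<open>M\<close>. Strictness survives because a
  fraction lies in an ideal exactly when its numerator does.\<close>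

lemma krull_dim_le:
  assumes "\<And>P d. (\<And>i. i \<le> d \<Longrightarrow> primeideal (P i) R) \<Longrightarrow> (\<And>i. i < d \<Longrightarrow> P i \<subset> P (Suc i)) \<Longrightarrow>
    G \<subseteq> P 0 \<Longrightarrow> P d \<subseteq> M \<Longrightarrow> d \<le> D"
  shows "krull_dim L \<le> enat D"
  unfolding krull_dim_def
proof (rule Sup_least, clarsimp)
  fix d and Q :: "nat \<Rightarrow> 'b set"
  assume Q: "\<forall>i\<le>d. primeideal (Q i) L" "\<forall>i<d. Q i \<subset> Q (Suc i)"
  define P where "P i = {r \<in> carrier R. \<pi> r \<in> Q i}" for i
  interpret h: ring_hom_ring R L \<pi> by (rule ring_hom_ringI2[OF R.ring_axioms L.ring_axioms hom])
  have idQ: "ideal (Q i) L" if "i \<le> d" for i using Q(1) that primeideal.axioms(1) by blast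
  have oneQ: "\<one> \<notin> Q i" if "i \<le> d" for i
    using ideal.one_imp_carrier[OF idQ[OF that]] primeideal.I_notcarr[of "Q i" L] Q(1) that by auto
  show "d \<le> D"
  proof (rule assms[of d P])
    fix i assume i: "i \<le> d"
    show "primeideal (P i) R"
    proof (rule primeidealI)
      show "ideal (P i) R" unfolding P_def by (rule h.ideal_vimage[OF idQ[OF i]])
      have "1 \<notin> P i" using oneQ[OF i] \<pi>_one by (simp add: P_def)
      then show "carrier R \<noteq> P i" by (metis R.one_closed polynomial_ring_simps(3))
      fix a b assume "a \<in> carrier R" "b \<in> carrier R" "a \<otimes>\<^bsub>R\<^esub> b \<in> P i"
      then show "a \<in> P i \<or> b \<in> P i"
        using primeideal.I_prime[of "Q i" L "\<pi> a" "\<pi> b"] Q(1) i by (auto simp: P_def \<pi>_mult)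
    qed (rule R.is_cring)
  next
    fix i assume i: "i < d"
    then have sub: "Q i \<subset> Q (Suc i)" using Q(2) by simp
    then obtain z where z: "z \<in> Q (Suc i)" "z \<notin> Q i" by blast
    have zc: "z \<in> carrier L" using ideal.Icarr[OF idQ[of "Suc i"] z(1)] i by simp
    obtain a w where aw: "a \<in> polys {1..n}" "w \<in> W" "z \<otimes> \<pi> w = \<pi> a" using surj[OF zc] by auto
    have "\<pi> a \<in> Q (Suc i)" using ideal.I_r_closed[OF idQ[of "Suc i"] z(1), of "\<pi> w"] aw i by simp
    moreover have "\<pi> a \<notin> Q i" using unit_cancel[OF idQ[of i] zc aw(2)] aw(3) z(2) i by auto
    ultimately show "P i \<subset> P (Suc i)" using sub aw(1) by (auto simp: P_def)
  next
    show "G \<subseteq> P 0"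
      using G_sub M_sub \<pi>_G additive_subgroup.zero_closed[OF ideal.axioms(1)[OF idQ[of 0]]] by (auto simp: P_def)
    show "P d \<subseteq> M"
    proof
      fix r assume r: "r \<in> P d"
      show "r \<in> M"
      proof (rule ccontr)
        assume "r \<notin> M"
        with r have "r \<in> W" "\<pi> r \<in> Q d" by (auto simp: P_def)
        then have "\<one> \<in> Q d" using unit_cancel[OF idQ[of d], of \<one> r] by simp
        with oneQ[of d] show False by simp
      qed
    qed
  qed
qed

end

text \<open>The map \<open>\<pi>\<close> sends a polynomial to its coset and then to the fraction
  with denominator one; \<open>M\<close> is the preimage of \<open>N\<close>.\<close>

lemma poly_localization_Quot:
  fixes G :: "'k::field mpoly set"
  assumes G: "G \<subseteq> polys {1..n}" and I: "I = Idl\<^bsub>polynomial_ring n\<^esub> G"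
    and N: "primeideal N (polynomial_ring n Quot I)"
  shows "\<exists>M \<pi>. poly_localization (localization_at (polynomial_ring n Quot I) N) n G M \<pi>"
proof -
  let ?R = "polynomial_ring n :: 'k mpoly ring"
  interpret R: cring ?R by (rule cring_polynomial_ring)
  have idI: "ideal I ?R" unfolding I by (rule R.genideal_ideal) (use G in simp)
  interpret I: ideal I ?R by (rule idI)
  interpret A: cring "?R Quot I" by (rule I.quotient_is_cring[OF R.is_cring])
  interpret N: primeideal N "?R Quot I" by (rule N)
  interpret q: ring_hom_ring ?R "?R Quot I" "(+>\<^bsub>?R\<^esub>) I" by (rule I.rcos_ring_hom_ring)
  let ?A = "?R Quot I" and ?S = "carrier (?R Quot I) - N"
  have oneN: "\<one>\<^bsub>?A\<^esub> \<notin> N" using N.one_imp_carrier N.I_notcarr by auto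
  interpret S: mult_localization ?A ?S
  proof
    show "x \<otimes>\<^bsub>?A\<^esub> y \<in> ?S" if "x \<in> ?S" "y \<in> ?S" for x y using that N.I_prime[of x y] by auto
  qed (use oneN in auto)
  define q where "q r = I +>\<^bsub>?R\<^esub> r" for r
  have q_closed: "r \<in> polys {1..n} \<Longrightarrow> q r \<in> carrier ?A" for r
    using q.hom_closed by (simp add: q_def)
  have q_mult: "r \<in> polys {1..n} \<Longrightarrow> s \<in> polys {1..n} \<Longrightarrow> q (r * s) = q r \<otimes>\<^bsub>?A\<^esub> q s" for r s
    using q.hom_mult[of r s] by (simp add: q_def)
  have q_surj: "\<exists>r\<in>polys {1..n}. x = q r" if "x \<in> carrier ?A" for x
    using that unfolding FactRing_def A_RCOSETS_def' q_def by auto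
  have q_zero: "q r = \<zero>\<^bsub>?A\<^esub> \<longleftrightarrow> r \<in> pideal.span G" if "r \<in> polys {1..n}" for r
  proof -
    have "q r = \<zero>\<^bsub>?A\<^esub> \<longleftrightarrow> r \<in> I"
      using that I.rcos_const_imp_mem[of r] I.a_rcos_const[of r] by (auto simp: q_def FactRing_def)
    then show ?thesis using that by (simp add: I Idl_polynomial_ring[OF G])
  qed
  define M where "M = {r \<in> carrier ?R. q r \<in> N}"
  define \<pi> where "\<pi> r = S.to_Loc (q r)" for r
  have M: "primeideal M ?R"
  proof (rule primeidealI)
    show "ideal M ?R" unfolding M_def q_def by (rule q.ideal_vimage[OF N.is_ideal])
    have "q 1 = \<one>\<^bsub>?A\<^esub>" using q.hom_one by (simp add: q_def)
    then have "1 \<notin> M" using oneN by (simp add: M_def)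
    then show "carrier ?R \<noteq> M" by (metis R.one_closed polynomial_ring_simps(3))
    fix a b assume "a \<in> carrier ?R" "b \<in> carrier ?R" "a \<otimes>\<^bsub>?R\<^esub> b \<in> M"
    then show "a \<in> M \<or> b \<in> M" using N.I_prime[of "q a" "q b"] by (auto simp: M_def q_mult q_closed)
  qed (rule R.is_cring)
  have W: "w \<in> polys {1..n} - M \<Longrightarrow> q w \<in> ?S" for w by (auto simp: M_def q_closed)
  have "poly_localization (localization ?A ?S) n G M \<pi>"
  proof -
    interpret L: cring "localization ?A ?S" by (rule S.cring_Loc)
    show "poly_localization (localization ?A ?S) n G M \<pi>"
    proof (intro poly_localization.intro L.is_cring poly_localization_axioms.intro)
      show "primeideal M ?R" by (rule M)
      show "G \<subseteq> M"
      proof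
        fix g assume "g \<in> G"
        with G have "g \<in> polys {1..n}" "g \<in> pideal.span G" by (auto simp: pideal.span_base)
        then have "q g = \<zero>\<^bsub>?A\<^esub>" using q_zero by simp
        with \<open>g \<in> polys {1..n}\<close> show "g \<in> M" using N.zero_closed by (simp add: M_def)
      qed
      have "S.to_Loc \<circ> q \<in> ring_hom ?R (localization ?A ?S)"
        by (rule ring_hom_trans[OF _ S.to_Loc_hom]) (simp add: q_def[abs_def] q.homh)
      then show "\<pi> \<in> ring_hom ?R (localization ?A ?S)" by (simp add: \<pi>_def[abs_def] comp_def)
    next
      fix z assume "z \<in> carrier (localization ?A ?S)"
      from S.to_Loc_surj[OF this] obtain x s where xs: "x \<in> carrier ?A" "s \<in> ?S"
        "z \<otimes>\<^bsub>localization ?A ?S\<^esub> S.to_Loc s = S.to_Loc x" by blast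
      obtain a where a: "a \<in> polys {1..n}" "x = q a" using q_surj[OF xs(1)] by blast
      obtain w where w: "w \<in> polys {1..n}" "s = q w" using q_surj xs(2) by blast
      have "w \<notin> M" using w xs(2) by (auto simp: M_def)
      with a w xs(3) show "\<exists>a\<in>polys {1..n}. \<exists>w\<in>polys {1..n} - M. z \<otimes>\<^bsub>localization ?A ?S\<^esub> \<pi> w = \<pi> a"
        by (auto simp: \<pi>_def)
    next
      fix a :: "'k mpoly" assume a: "a \<in> polys {1..n}"
      have "\<pi> a = \<zero>\<^bsub>localization ?A ?S\<^esub> \<longleftrightarrow> (\<exists>u\<in>?S. u \<otimes>\<^bsub>?A\<^esub> q a = \<zero>\<^bsub>?A\<^esub>)"
        unfolding \<pi>_def by (rule S.to_Loc_eq_0_iff[OF q_closed[OF a]])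
      also have "\<dots> \<longleftrightarrow> (\<exists>w\<in>polys {1..n} - M. q w \<otimes>\<^bsub>?A\<^esub> q a = \<zero>\<^bsub>?A\<^esub>)"
      proof
        assume "\<exists>u\<in>?S. u \<otimes>\<^bsub>?A\<^esub> q a = \<zero>\<^bsub>?A\<^esub>"
        then obtain u where u: "u \<in> ?S" "u \<otimes>\<^bsub>?A\<^esub> q a = \<zero>\<^bsub>?A\<^esub>" by blast
        obtain w where w: "w \<in> polys {1..n}" "u = q w" using q_surj u(1) by blast
        with u show "\<exists>w\<in>polys {1..n} - M. q w \<otimes>\<^bsub>?A\<^esub> q a = \<zero>\<^bsub>?A\<^esub>" by (auto simp: M_def)
      qed (use W in blast)
      also have "\<dots> \<longleftrightarrow> (\<exists>w\<in>polys {1..n} - M. w * a \<in> pideal.span G)"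
        using a by (intro bex_cong refl) (simp add: q_mult[symmetric] q_zero polys_mult)
      finally show "\<pi> a = \<zero>\<^bsub>localization ?A ?S\<^esub> \<longleftrightarrow> (\<exists>w\<in>polys {1..n} - M. w * a \<in> pideal.span G)" .
    next
      fix w assume "w \<in> polys {1..n} - M"
      then show "\<pi> w \<in> Units (localization ?A ?S)" unfolding \<pi>_def by (intro S.to_Loc_unit W)
    qed
  qed
  then show ?thesis by (auto simp: localization_at_def)
qed

subsection \<open>Algebraic dependence\<close>

text \<open>Bounding each exponent separately, not the total degree, gives the exact count
  \<open>Suc N ^ card V\<close>, and the bounds add under products.\<close>

definition box :: "nat set \<Rightarrow> nat \<Rightarrow> (nat \<Rightarrow>\<^sub>0 nat) set" where
  "box V N = {m. keys m \<subseteq> V \<and> (\<forall>j. lookup m j \<le> N)}"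

lemma box_finite_card:
  assumes "finite V"
  shows "finite (box V N)" "card (box V N) = Suc N ^ card V"
proof -
  have "bij_betw (\<lambda>m. restrict (lookup m) V) (box V N) (PiE V (\<lambda>_. {..N}))"
  proof (rule bij_betw_byWitness[where f' = "\<lambda>f. Abs_poly_mapping (\<lambda>j. if j \<in> V then f j else 0)"])
    have fin: "finite {j. (if j \<in> V then f j else 0) \<noteq> (0::nat)}" for f
      by (rule finite_subset[OF _ assms]) auto
    show "\<forall>a\<in>box V N. Abs_poly_mapping (\<lambda>j. if j \<in> V then restrict (lookup a) V j else 0) = a"
    proof
      fix a assume a: "a \<in> box V N"
      then have "(\<lambda>j. if j \<in> V then restrict (lookup a) V j else 0) = lookup a"
        by (auto simp: box_def in_keys_iff fun_eq_iff)
      then show "Abs_poly_mapping (\<lambda>j. if j \<in> V then restrict (lookup a) V j else 0) = a"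
        by (simp add: lookup_inverse)
    qed
    show "\<forall>f\<in>PiE V (\<lambda>_. {..N}). restrict (lookup (Abs_poly_mapping (\<lambda>j. if j \<in> V then f j else 0))) V = f"
      using fin by (auto simp: fun_eq_iff PiE_def extensional_def)
    show "(\<lambda>m. restrict (lookup m) V) ` box V N \<subseteq> PiE V (\<lambda>_. {..N})"
      by (auto simp: box_def)
    show "(\<lambda>f. Abs_poly_mapping (\<lambda>j. if j \<in> V then f j else 0)) ` PiE V (\<lambda>_. {..N}) \<subseteq> box V N"
      using fin by (auto simp: box_def in_keys_iff PiE_def Pi_def split: if_splits)
  qed
  moreover have "finite (PiE V (\<lambda>_. {..N}))" "card (PiE V (\<lambda>_. {..N})) = Suc N ^ card V"
    using assms by (auto intro: finite_PiE simp: card_PiE)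
  ultimately show "finite (box V N)" "card (box V N) = Suc N ^ card V"
    using bij_betw_finite bij_betw_same_card by metis+
qed

definition boxed :: "nat set \<Rightarrow> nat \<Rightarrow> 'k::field mpoly set" where
  "boxed V d = {p. keys p \<subseteq> box V d}"

lemma boxed_mult:
  assumes "p \<in> boxed V a" "q \<in> boxed V b"
  shows "p * q \<in> boxed V (a + b)"
proof -
  have "x + y \<in> box V (a + b)" if "x \<in> box V a" "y \<in> box V b" for x y
    using that Poly_Mapping.keys_add[of x y] by (fastforce simp: box_def lookup_add intro: add_mono)
  then show ?thesis using assms keys_mult[of p q] unfolding boxed_def by blast
qed

lemma boxed_1: "1 \<in> boxed V 0"
  by (auto simp: boxed_def box_def)

lemma boxed_power: "p \<in> boxed V a \<Longrightarrow> p ^ e \<in> boxed V (e * a)"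
  by (induction e) (auto simp: boxed_1 intro: boxed_mult)

lemma boxed_prod:
  "finite A \<Longrightarrow> (\<And>j. j \<in> A \<Longrightarrow> g j \<in> boxed V (w j)) \<Longrightarrow> prod g A \<in> boxed V (sum w A)"
  by (induction A rule: finite_induct) (auto simp: boxed_1 intro: boxed_mult)

lemma boxed_mono: "a \<le> b \<Longrightarrow> boxed V a \<subseteq> boxed V b"
  unfolding boxed_def box_def using order.trans by blast

lemma boxed_exists:
  assumes "p \<in> polys V"
  shows "\<exists>d. p \<in> boxed V d"
proof -
  define d where "d = Max (\<Union>m\<in>keys p. lookup m ` keys m)"
  have "lookup m j \<le> d" if "m \<in> keys p" for m j
  proof (cases "j \<in> keys m")
    case True
    with that show ?thesis unfolding d_def by (intro Max_ge) auto
  qed (simp add: in_keys_iff)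
  then show ?thesis using assms by (intro exI[of _ d]) (auto simp: boxed_def box_def polys_def)
qed

lemma mpoly_sum_singles: "(p :: 'k::field mpoly) = (\<Sum>m\<in>keys p. Const (lookup p m) * single m 1)"
proof -
  have "p = subst indet p" by simp
  also have "\<dots> = (\<Sum>m\<in>keys p. Const (lookup p m) * single m 1)"
    unfolding eval_with_def power_product_indet ..
  finally show ?thesis .
qed

lemma vector_space_mpoly: "vector_space (\<lambda>c (p :: 'k::field mpoly). Const c * p)"
  by unfold_locales (simp_all add: Const_add Const_mult algebra_simps)

text \<open>The products of the \<open>F j\<close> with exponents at most \<open>N\<close> outnumber, for large \<open>N\<close>, the monomials
  in the variables \<open>V\<close> that can occur in them.\<close>

lemma algebraically_dependent:
  fixes F :: "nat \<Rightarrow> 'k::field mpoly"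
  assumes fin: "finite V" "finite A" and card: "card V < card A"
    and F: "\<And>j. j \<in> A \<Longrightarrow> F j \<in> polys V"
  shows "\<exists>Q\<in>polys A. Q \<noteq> 0 \<and> subst F Q = 0"
proof -
  interpret vs: vector_space "\<lambda>c (p :: 'k mpoly). Const c * p" by (rule vector_space_mpoly)
  have "\<forall>j\<in>A. \<exists>d. F j \<in> boxed V d" using F boxed_exists by auto
  then obtain \<delta>' where \<delta>': "\<And>j. j \<in> A \<Longrightarrow> F j \<in> boxed V (\<delta>' j)" by metis
  define \<delta> where "\<delta> = (\<Sum>j\<in>A. \<delta>' j)"
  have \<delta>: "F j \<in> boxed V \<delta>" if "j \<in> A" for j
  proof -
    have "\<delta>' j \<le> \<delta>" unfolding \<delta>_def using that fin(2) by (intro member_le_sum) auto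
    then show ?thesis using \<delta>'[OF that] boxed_mono by blast
  qed
  \<comment> \<open>A product of powers of the \<open>F j\<close> with exponents up to
    \<open>N\<close> only contains exponents up to \<open>c * N\<close>. The choice of
    \<open>N\<close> makes the \<open>Suc N ^ card A\<close> products outnumber the
    \<open>Suc (c * N) ^ card V\<close> monomials available to them.\<close>
  define c where "c = card A * \<delta>"
  define N where "N = Suc c ^ card V"
  let ?E = "box A N" and ?B = "(\<lambda>m. single m (1::'k)) ` box V (c * N)"
  note E = box_finite_card[OF fin(2), of N]
  note B = box_finite_card[OF fin(1), of "c * N"]
  have mono_in: "power_product F m \<in> vs.span ?B" if m: "m \<in> ?E" for m
  proof -
    have "power_product F m = (\<Prod>j\<in>A. F j ^ lookup m j)"
      using m fin(2) by (intro power_product_superset) (auto simp: box_def)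
    also have "\<dots> \<in> boxed V (\<Sum>j\<in>A. lookup m j * \<delta>)"
      using fin(2) \<delta> by (intro boxed_prod boxed_power)
    finally have "power_product F m \<in> boxed V (\<Sum>j\<in>A. lookup m j * \<delta>)" .
    moreover have "(\<Sum>j\<in>A. lookup m j * \<delta>) \<le> (\<Sum>j\<in>A. N * \<delta>)"
      using m by (intro sum_mono mult_right_mono) (auto simp: box_def)
    then have "(\<Sum>j\<in>A. lookup m j * \<delta>) \<le> c * N" by (simp add: c_def mult_ac)
    ultimately have "power_product F m \<in> boxed V (c * N)" using boxed_mono by blast
    then have "(\<Sum>m'\<in>keys (power_product F m). Const (lookup (power_product F m) m') * single m' 1) \<in> vs.span ?B"
      by (intro vs.span_sum vs.span_scale vs.span_base) (auto simp: boxed_def)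
    then show ?thesis using mpoly_sum_singles[of "power_product F m"] by simp
  qed
  have "card ?B \<le> Suc (c * N) ^ card V" using card_image_le[OF B(1)] B(2) by metis
  also have "\<dots> \<le> (Suc c * Suc N) ^ card V" by (intro power_mono) auto
  also have "\<dots> = N * Suc N ^ card V" unfolding power_mult_distrib by (simp only: N_def)
  also have "\<dots> < Suc N * Suc N ^ card V" by (intro mult_strict_right_mono) auto
  also have "\<dots> = Suc N ^ Suc (card V)" by simp
  also have "\<dots> \<le> Suc N ^ card A" using card by (intro power_increasing) auto
  finally have less: "card ?B < card ?E" by (simp add: E(2))
  \<comment> \<open>Two exponents with the same product give a binomial relation. Otherwise the
    products are distinct and, being more than the elements of a spanning set, linearly
    dependent.\<close>
  show ?thesis
  proof (cases "inj_on (power_product F) ?E")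
    case False
    then obtain m m' where mm: "m \<in> ?E" "m' \<in> ?E" "m \<noteq> m'" "power_product F m = power_product F m'"
      by (auto simp: inj_on_def)
    let ?Q = "single m 1 - single m' 1 :: 'k mpoly"
    have "lookup ?Q m = 1" using mm(3) by (simp add: lookup_minus lookup_single)
    then have "?Q \<noteq> 0" by (metis lookup_zero zero_neq_one)
    moreover have "subst F ?Q = 0" using mm(4) by (simp add: Const.eval_diff Const.eval_single)
    moreover have "?Q \<in> polys A"
      using mm(1,2) by (intro polys_diff) (auto simp: polys_def box_def)
    ultimately show ?thesis by blast
  next
    case True
    let ?P = "power_product F ` ?E"
    have finP: "finite ?P" using E(1) by simp
    have cP: "card ?P = card ?E" using True by (rule card_image)
    have "vs.dependent ?P"
    proof (rule ccontr)
      assume "vs.independent ?P"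
      from vs.independent_span_bound[OF finite_imageI[OF B(1)] this] mono_in
      have "card ?P \<le> card ?B" by blast
      with less cP show False by simp
    qed
    then obtain u v where uv: "v \<in> ?P" "u v \<noteq> 0" "(\<Sum>v\<in>?P. Const (u v) * v) = 0"
      using vs.dependent_finite[OF finP] by auto
    define Q where "Q = (\<Sum>m\<in>?E. single m (u (power_product F m)))"
    have "subst F Q = (\<Sum>m\<in>?E. Const (u (power_product F m)) * power_product F m)"
      by (simp add: Q_def Const.eval_sum Const.eval_single)
    also have "\<dots> = (\<Sum>v\<in>?P. Const (u v) * v)" using True by (simp add: sum.reindex)
    finally have "subst F Q = 0" using uv(3) by simp
    moreover obtain m where m: "m \<in> ?E" "v = power_product F m" using uv(1) by auto
    have "lookup Q m = u v"
      using m E(1) by (simp add: Q_def lookup_sum lookup_single when_def)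
    then have "Q \<noteq> 0" using uv(2) by auto
    moreover have "Q \<in> polys A"
      unfolding Q_def by (intro polys_sum) (auto simp: polys_def box_def split: if_splits)
    ultimately show ?thesis by blast
  qed
qed

subsection \<open>The dimension bound\<close>

lemma primeideal_polysD:
  assumes "primeideal P (polynomial_ring n :: 'k::field mpoly ring)"
  shows "P \<subseteq> polys {1..n}" "0 \<in> P" "\<And>a b. a \<in> P \<Longrightarrow> b \<in> P \<Longrightarrow> a + b \<in> P"
    "\<And>a b. a \<in> P \<Longrightarrow> b \<in> P \<Longrightarrow> a - b \<in> P"
    "\<And>a c. a \<in> P \<Longrightarrow> c \<in> polys {1..n} \<Longrightarrow> c * a \<in> P" "1 \<notin> P"
    "\<And>a b. a \<in> polys {1..n} \<Longrightarrow> b \<in> polys {1..n} \<Longrightarrow> a * b \<in> P \<Longrightarrow> a \<in> P \<or> b \<in> P"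
proof -
  interpret primeideal P "polynomial_ring n :: 'k mpoly ring" by fact
  show s: "P \<subseteq> polys {1..n}" using a_subset by simp
  show "0 \<in> P" using additive_subgroup.zero_closed[OF is_additive_subgroup] by simp
  show add: "a + b \<in> P" if "a \<in> P" "b \<in> P" for a b using additive_subgroup.a_closed[OF is_additive_subgroup that] by simp
  show mul: "c * a \<in> P" if "a \<in> P" "c \<in> polys {1..n}" for a c using I_l_closed that by simp
  show "a - b \<in> P" if "a \<in> P" "b \<in> P" for a b
    using add[OF that(1) mul[OF that(2), of "- 1"]] by (simp add: polys_minus)
  show "1 \<notin> P" using one_imp_carrier I_notcarr by auto
  show "\<And>a b. a \<in> polys {1..n} \<Longrightarrow> b \<in> polys {1..n} \<Longrightarrow> a * b \<in> P \<Longrightarrow> a \<in> P \<or> b \<in> P"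
    using I_prime by simp
qed

lemma primeideal_power_mem:
  assumes P: "primeideal P (polynomial_ring n)" and a: "a \<in> polys {1..n}" "a ^ e \<in> P"
  shows "a \<in> P"
  using a(2)
proof (induction e)
  case 0
  with primeideal_polysD(6)[OF P] show ?case by simp
next
  case (Suc e)
  with primeideal_polysD(7)[OF P a(1) polys_power[OF a(1), of e]] show ?case by auto
qed

lemma primeideal_prod_mem:
  assumes P: "primeideal P (polynomial_ring n)" and A: "finite A" "\<And>a. a \<in> A \<Longrightarrow> g a \<in> polys {1..n}"
    and "prod g A \<in> P"
  shows "\<exists>a\<in>A. g a \<in> P"
  using A assms(4)
proof (induction A rule: finite_induct)
  case empty
  with primeideal_polysD(6)[OF P] show ?case by simp
next
  case (insert x A)
  have "g x \<in> polys {1..n}" "prod g A \<in> polys {1..n}"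
    using insert.prems(1) by (auto intro: polys_prod)
  with insert primeideal_polysD(7)[OF P, of "g x" "prod g A"] show ?case by auto
qed

lemma generator_in_polys: "generator n t i \<in> polys {1..n}"
  unfolding generator_def by (intro polys_closed polys_indet) auto

text \<open>Any generator puts some \<open>indet i\<close> into \<open>P\<close>; the generator that
  omits this variable then puts a second one there.\<close>

lemma two_indets_in_prime:
  assumes P: "primeideal P (polynomial_ring n)" and n: "n \<ge> 1"
    and G: "generator n t ` {1..n} \<subseteq> P"
  shows "\<exists>i\<in>{1..n}. \<exists>j\<in>{1..n}. i \<noteq> j \<and> indet i \<in> P \<and> indet j \<in> P"
proof -
  have ex: "\<exists>j\<in>{1..n} - {i}. indet j \<in> P" if "i \<in> {1..n}" for i
  proof -
    have "(\<Prod>j\<in>{1..n} - {i}. indet j ^ t) \<in> P" using G that by (auto simp: generator_def)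
    then have "\<exists>j\<in>{1..n} - {i}. indet j ^ t \<in> P"
      by (intro primeideal_prod_mem[OF P]) (auto intro!: polys_power polys_indet)
    then show ?thesis using primeideal_power_mem[OF P] polys_indet by blast
  qed
  have "1 \<in> {1..n}" using n by simp
  from ex[OF this] obtain i where i: "i \<in> {1..n}" "indet i \<in> P" by blast
  with ex[OF i(1)] show ?thesis by blast
qed

text \<open>Allows relations modulo \<open>P\<close> to be studied among polynomials in
  \<open>V\<close> alone. The induction also carries membership in \<open>polys {1..n}\<close>,
  which the product step uses.\<close>

lemma diff_retract_in_prime:
  assumes P: "primeideal P (polynomial_ring n)" and V: "\<And>j. j \<in> {1..n} - V \<Longrightarrow> indet j \<in> P"
    and p: "p \<in> polys {1..n}"
  shows "p - retract V p \<in> P"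
proof -
  note Pd = primeideal_polysD[OF P]
  have "p \<in> polys {1..n} \<and> retract V p \<in> polys {1..n} \<and> p - retract V p \<in> P" using p
  proof (induction p rule: mpoly_ring_induct)
    case (Const c)
    then show ?case by (simp add: retract_id Pd(2))
  next
    case (indet j)
    then show ?case using V[of j] Pd(2) by (auto simp: retract_def polys_indet)
  next
    case (add p q)
    have "(p + q) - retract V (p + q) = (p - retract V p) + (q - retract V q)"
      by (simp add: retract_add)
    moreover have "(p - retract V p) + (q - retract V q) \<in> P" using add by (intro Pd(3)) auto
    ultimately have "(p + q) - retract V (p + q) \<in> P" by (simp only:)
    then show ?case using add by (auto simp: retract_add intro: polys_add)
  next
    case (mult p q)
    have "p * q - retract V (p * q) = q * (p - retract V p) + retract V p * (q - retract V q)"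
      by (simp add: retract_mult algebra_simps)
    moreover have "q * (p - retract V p) + retract V p * (q - retract V q) \<in> P"
      using mult by (intro Pd(3) Pd(5)) auto
    ultimately show ?case using mult by (auto simp: retract_mult intro: polys_mult)
  qed
  then show ?thesis by simp
qed

text \<open>Elements \<open>f\<^sub>k \<in> P\<^sub>k\<^sub>+\<^sub>1 - P\<^sub>k\<close> together with the variables in \<open>T\<close> satisfy, modulo \<open>P\<^sub>0\<close>, a nontrivial
  polynomial relation. Splitting off the lowest power of \<open>f\<^sub>0, f\<^sub>1, \<dots>\<close> in turn leaves a nonzero
  polynomial in the variables \<open>T\<close> in the last prime.\<close>

lemma chain_length_bound:
  fixes P :: "nat \<Rightarrow> 'k::field mpoly set"
  assumes P: "\<And>k. k \<le> d \<Longrightarrow> primeideal (P k) (polynomial_ring n)"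
    and strict: "\<And>k. k < d \<Longrightarrow> P k \<subset> P (Suc k)"
    and ij: "i \<in> {1..n}" "j \<in> {1..n}" "i \<noteq> j" "indet i \<in> P 0" "indet j \<in> P 0"
    and T: "T \<subseteq> {1..n}" "P d \<inter> polys T \<subseteq> {0}"
  shows "d + card T \<le> n - 2"
proof (rule ccontr)
  assume neg: "\<not> ?thesis"
  note Pd = primeideal_polysD[OF P]
  have le: "P 0 \<subseteq> P k" if "k \<le> d" for k
    using that by (induction k) (use strict in \<open>auto simp: Suc_le_eq\<close>)
  have indet_T: "indet a \<notin> P 0" if "a \<in> T" for a
  proof
    assume "indet a \<in> P 0"
    then have "indet a \<in> P d \<inter> polys T" using le[of d] that by (auto simp: polys_indet)
    with T(2) show False using indet_neq_0 by blast
  qed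
  define V where "V = {1..n} - {i, j}"
  have cV: "card V = n - 2" using ij(1-3) by (simp add: V_def card_Diff_subset)
  have TV: "T \<subseteq> V" using T(1) indet_T ij(4,5) by (auto simp: V_def)
  have "\<exists>f. f \<in> P (Suc k) \<and> f \<notin> P k" if "k < d" for k using strict[OF that] by blast
  then obtain f where f: "\<And>k. k < d \<Longrightarrow> f k \<in> P (Suc k)" "\<And>k. k < d \<Longrightarrow> f k \<notin> P k" by metis
  \<comment> \<open>Two kinds of values share one index set: indices up to \<open>n\<close> are
    reserved for the variables in \<open>T\<close>, with filler zero elsewhere, and
    \<open>Suc n + k\<close> carries \<open>f k\<close> reduced to the variables \<open>V\<close>.
    The reduction changes \<open>f k\<close> only modulo \<open>P 0\<close>.\<close>
  define F where "F a = (if a \<le> n then (if a \<in> T then indet a else 0) else retract V (f (a - Suc n)))" for a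
  have FV: "F a \<in> polys V" for a using TV by (auto simp: F_def polys_indet)
  have Fk: "F (Suc n + k) \<in> P (Suc k)" "F (Suc n + k) \<notin> P k" if k: "k < d" for k
  proof -
    have fp: "f k \<in> polys {1..n}" using f(1)[OF k] Pd(1)[of "Suc k"] k by auto
    have *: "f k - F (Suc n + k) \<in> P 0"
      unfolding F_def using diff_retract_in_prime[OF P[of 0] _ fp, of V] ij(4,5) by (auto simp: V_def)
    have "f k - (f k - F (Suc n + k)) \<in> P (Suc k)"
      by (rule Pd(4)) (use * le[of "Suc k"] f(1)[OF k] k in auto)
    then show "F (Suc n + k) \<in> P (Suc k)" by simp
    show "F (Suc n + k) \<notin> P k"
    proof
      assume "F (Suc n + k) \<in> P k"
      then have "(f k - F (Suc n + k)) + F (Suc n + k) \<in> P k"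
        using * le[of k] k by (intro Pd(3)) auto
      with f(2)[OF k] show False by simp
    qed
  qed
  have subst_p: "subst F p \<in> polys {1..n}" for p
  proof -
    have "subst F p \<in> polys V" by (rule subst_in_polys[of _ UNIV]) (auto simp: FV)
    then show ?thesis using polys_mono[of V "{1..n}"] by (auto simp: V_def)
  qed
  define ind where "ind k = T \<union> {Suc n + k..<Suc n + d}" for k
  have finT: "finite T" using T(1) finite_subset by blast
  have "card (ind 0) = card T + d"
    unfolding ind_def using T(1) finT by (subst card_Un_disjoint) auto
  with neg cV have "card V < card (ind 0)" by simp
  \<comment> \<open>Each step removes the index \<open>Suc n + k\<close> from the relation while
    passing to the next prime; at \<open>k = d\<close> only \<open>T\<close> is left.\<close>
  have strip: "\<exists>Q\<in>polys (ind k). Q \<noteq> 0 \<and> subst F Q \<in> P k" if "k \<le> d" for k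
    using that
  proof (induction k)
    case 0
    have "\<exists>Q\<in>polys (ind 0). Q \<noteq> 0 \<and> subst F Q = 0"
      by (rule algebraically_dependent[OF _ _ \<open>card V < card (ind 0)\<close> FV])
         (use finT in \<open>auto simp: V_def ind_def\<close>)
    then show ?case using Pd(2)[of 0] by auto
  next
    case (Suc k)
    then obtain Q where Q: "Q \<in> polys (ind k)" "Q \<noteq> 0" "subst F Q \<in> P k" by auto
    let ?v = "Suc n + k"
    have indk: "ind k = insert ?v (ind (Suc k))" "?v \<notin> ind (Suc k)"
      using Suc.prems T(1) by (auto simp: ind_def)
    define q where "q = univ ?v Q"
    have "\<exists>e. Polynomial.coeff q e \<noteq> 0" using Q(2) by (metis q_def univ_eq_0_iff leading_coeff_0_iff)
    define e where "e = (LEAST e. Polynomial.coeff q e \<noteq> 0)"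
    have e: "Polynomial.coeff q e \<noteq> 0" "\<forall>k<e. Polynomial.coeff q k = 0"
      using LeastI_ex[OF \<open>\<exists>e. Polynomial.coeff q e \<noteq> 0\<close>] not_less_Least by (auto simp: e_def)
    then obtain q' where q': "q = Polynomial.monom 1 e * q'"
      by (metis monom_1_dvd_iff' dvdE)
    define a where "a = Polynomial.coeff q' 0"
    have a: "a = Polynomial.coeff q e"
      by (simp add: a_def q' Polynomial.coeff_monom_mult)
    obtain b q'' where bq: "q' = pCons b q''" by (cases q')
    have ba: "b = a" by (simp add: a_def bq)
    have "Q = poly q (indet ?v)" by (simp add: q_def)
    also have "\<dots> = indet ?v ^ e * (a + indet ?v * poly q'' (indet ?v))"
      by (simp add: q' bq ba Polynomial.poly_monom algebra_simps)
    finally have "subst F Q = F ?v ^ e * (subst F a + F ?v * subst F (poly q'' (indet ?v)))"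
      by (simp only: Const.eval_mult Const.eval_add Const.eval_power Const.eval_indet)
    with Q(3) have in_Pk: "F ?v ^ e * (subst F a + F ?v * subst F (poly q'' (indet ?v))) \<in> P k" by simp
    have k: "k < d" using Suc.prems by simp
    have Fp: "F ?v \<in> polys {1..n}" using Fk(1)[OF k] Pd(1)[of "Suc k"] k by auto
    \<comment> \<open>\<open>F ?v\<close> is outside the prime \<open>P k\<close>, so its power can
      be cancelled there. It lies in \<open>P (Suc k)\<close>, where only the lowest coefficient
      \<open>a\<close> survives.\<close>
    have "F ?v ^ e \<notin> P k" using primeideal_power_mem[OF P Fp] Fk(2)[OF k] k by auto
    then have "subst F a + F ?v * subst F (poly q'' (indet ?v)) \<in> P k"
      using Pd(7)[OF _ polys_power[OF Fp] polys_add[OF subst_p polys_mult[OF Fp subst_p]] in_Pk] k by auto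
    then have 1: "subst F a + F ?v * subst F (poly q'' (indet ?v)) \<in> P (Suc k)"
      using strict[OF k] by blast
    have "subst F (poly q'' (indet ?v)) * F ?v \<in> P (Suc k)"
      using Pd(5)[of "Suc k" "F ?v"] Fk(1)[OF k] subst_p k by simp
    from Pd(4)[OF _ 1 this] have "subst F a \<in> P (Suc k)" using k by (simp add: mult.commute)
    moreover have "a \<in> polys (ind (Suc k))"
      unfolding a q_def using Q(1) indk by (intro coeff_univ_in_polys) auto
    moreover have "a \<noteq> 0" using e(1) a by simp
    ultimately show ?case by blast
  qed
  from strip[of d] obtain Q where Q: "Q \<in> polys T" "Q \<noteq> 0" "subst F Q \<in> P d"
    by (auto simp: ind_def)
  have "subst F Q = Q" using T(1) by (intro subst_polys_id[OF Q(1)]) (auto simp: F_def)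
  with Q T(2) show False by auto
qed

subsection \<open>Saturated ideals and regular elements\<close>

locale mult_set =
  fixes W :: "'a::comm_ring_1 set"
  assumes one_W: "1 \<in> W" and W_mult: "\<And>s t. s \<in> W \<Longrightarrow> t \<in> W \<Longrightarrow> s * t \<in> W"
begin

text \<open>The contraction of the ideal generated by \<open>G\<close> in the localization at
  \<open>W\<close>; it replaces computations in that localization.\<close>

definition sat :: "'a set \<Rightarrow> 'a set" where
  "sat G = {p. \<exists>s\<in>W. s * p \<in> pideal.span G}"

text \<open>When \<open>sat G\<close> is the whole ring, every element counts as regular;
  \<open>regular_mod_unit_insert\<close> rests on this.\<close>

definition regular_mod :: "'a \<Rightarrow> 'a set \<Rightarrow> bool" where
  "regular_mod f G \<longleftrightarrow> (\<forall>b. f * b \<in> sat G \<longrightarrow> b \<in> sat G)"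

lemma satI: "s \<in> W \<Longrightarrow> s * p \<in> pideal.span G \<Longrightarrow> p \<in> sat G"
  by (auto simp: sat_def)

lemma span_subset_sat: "p \<in> pideal.span G \<Longrightarrow> p \<in> sat G"
  by (rule satI[OF one_W]) simp

lemma sat_base: "p \<in> G \<Longrightarrow> p \<in> sat G"
  by (intro span_subset_sat pideal.span_base)

lemma sat_0: "0 \<in> sat G"
  by (intro span_subset_sat pideal.span_zero)

lemma sat_mult:
  assumes "p \<in> sat G"
  shows "c * p \<in> sat G"
proof -
  from assms obtain s where s: "s \<in> W" "s * p \<in> pideal.span G" by (auto simp: sat_def)
  have "c * (s * p) \<in> pideal.span G" using s(2) by (rule pideal.span_scale)
  then show ?thesis by (intro satI[OF s(1)]) (simp add: mult.left_commute)
qed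

lemma sat_add:
  assumes "p \<in> sat G" "q \<in> sat G"
  shows "p + q \<in> sat G"
proof -
  from assms obtain s t where s: "s \<in> W" "s * p \<in> pideal.span G" "t \<in> W" "t * q \<in> pideal.span G"
    by (auto simp: sat_def)
  have "t * (s * p) + s * (t * q) \<in> pideal.span G"
    by (intro pideal.span_add pideal.span_scale[OF s(2)] pideal.span_scale[OF s(4)])
  then show ?thesis by (intro satI[OF W_mult[OF s(1,3)]]) (simp add: algebra_simps)
qed

lemma sat_minus: "p \<in> sat G \<Longrightarrow> - p \<in> sat G"
  using sat_mult[of p G "- 1"] by simp

lemma sat_diff: "p \<in> sat G \<Longrightarrow> q \<in> sat G \<Longrightarrow> p - q \<in> sat G"
  using sat_add[OF _ sat_minus] by fastforce

lemma sat_sum: "(\<And>i. i \<in> A \<Longrightarrow> g i \<in> sat G) \<Longrightarrow> sum g A \<in> sat G"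
  by (induction A rule: infinite_finite_induct) (simp_all add: sat_0 sat_add)

lemma sat_cancel:
  assumes "s \<in> W" "s * p \<in> sat G"
  shows "p \<in> sat G"
proof -
  from assms obtain t where t: "t \<in> W" "t * (s * p) \<in> pideal.span G" by (auto simp: sat_def)
  then show ?thesis by (intro satI[OF W_mult[OF t(1) assms(1)]]) (simp add: mult.assoc)
qed

lemma sat_subset:
  assumes "G \<subseteq> sat H"
  shows "sat G \<subseteq> sat H"
proof -
  have span: "p \<in> sat H" if "p \<in> pideal.span G" for p
    using that
    by (induction rule: pideal.span_induct_alt) (use assms in \<open>auto intro: sat_0 sat_add sat_mult\<close>)
  then show ?thesis using sat_cancel by (auto simp: sat_def[of G])
qed

lemma sat_eqI: "G \<subseteq> sat H \<Longrightarrow> H \<subseteq> sat G \<Longrightarrow> sat G = sat H"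
  using sat_subset by blast

lemma sat_mono: "G \<subseteq> H \<Longrightarrow> sat G \<subseteq> sat H"
  by (intro sat_subset) (auto intro: sat_base)

lemma sat_insertD:
  assumes "p \<in> sat (insert a G)"
  shows "\<exists>s\<in>W. \<exists>c. s * p - c * a \<in> sat G"
  using assms by (auto simp: sat_def[of "insert a G"] pideal.span_insert intro!: span_subset_sat bexI)

lemma sat_insertI:
  assumes "s \<in> W" "s * p - c * a \<in> sat G"
  shows "p \<in> sat (insert a G)"
proof -
  have "s * p - c * a \<in> sat (insert a G)" using assms(2) sat_mono[of G "insert a G"] by auto
  moreover have "c * a \<in> sat (insert a G)" by (intro sat_mult sat_base) simp
  ultimately have "(s * p - c * a) + c * a \<in> sat (insert a G)" by (rule sat_add)
  then show ?thesis using sat_cancel[OF assms(1)] by simp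
qed

lemma regular_mod_cong:
  assumes "sat G = sat H" "f - g \<in> sat G" "regular_mod f G"
  shows "regular_mod g H"
  unfolding regular_mod_def
proof (intro allI impI)
  fix b assume b: "g * b \<in> sat H"
  have "b * (f - g) + g * b \<in> sat G" using assms(1) b by (intro sat_add sat_mult[OF assms(2)]) simp
  moreover have "b * (f - g) + g * b = f * b" by (simp add: algebra_simps)
  ultimately show "b \<in> sat H" using assms(1,3) by (simp add: regular_mod_def)
qed

lemma regular_mod_unit: "f \<in> W \<Longrightarrow> regular_mod f G"
  using sat_cancel by (auto simp: regular_mod_def)

lemma regular_mod_unit_insert: "a \<in> W \<Longrightarrow> regular_mod f (insert a G)"
  unfolding regular_mod_def by (intro allI impI satI[of a]) (auto intro: pideal_span_mult_right pideal.span_base)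

lemma regular_mod_1: "regular_mod 1 G"
  by (simp add: regular_mod_def)

lemma regular_mod_mult: "regular_mod f G \<Longrightarrow> regular_mod g G \<Longrightarrow> regular_mod (f * g) G"
  unfolding regular_mod_def mult.assoc by blast

lemma regular_mod_prod:
  "(\<And>j. j \<in> A \<Longrightarrow> regular_mod (a j) G) \<Longrightarrow> regular_mod (prod a A) G"
proof (induction A rule: infinite_finite_induct)
  case (insert x A)
  then have "regular_mod (a x * prod a A) G" by (intro regular_mod_mult) auto
  with insert.hyps show ?case by simp
qed (simp_all add: regular_mod_1)

text \<open>If \<open>b c = a d\<close> modulo \<open>G\<close>, then \<open>d = b e\<close> because \<open>a\<close> is regular modulo \<open>b\<close>, so \<open>c = a e\<close>.\<close>

lemma regular_mod_swap:
  assumes a: "regular_mod a (insert b G)" and b: "regular_mod b G"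
  shows "regular_mod b (insert a G)"
  unfolding regular_mod_def
proof (intro allI impI)
  fix c assume "b * c \<in> sat (insert a G)"
  then obtain s d where s: "s \<in> W" "s * (b * c) - d * a \<in> sat G" using sat_insertD by blast
  have "1 * (a * d) - (s * c) * b = - (s * (b * c) - d * a)" by (simp add: algebra_simps)
  also have "\<dots> \<in> sat G" using s(2) by (rule sat_minus)
  finally have "a * d \<in> sat (insert b G)" by (rule sat_insertI[OF one_W])
  with a have "d \<in> sat (insert b G)" by (simp add: regular_mod_def)
  then obtain v e where v: "v \<in> W" "v * d - e * b \<in> sat G" using sat_insertD by blast
  have "v * (s * (b * c) - d * a) + a * (v * d - e * b) \<in> sat G"
    using s v by (intro sat_add sat_mult)
  also have "v * (s * (b * c) - d * a) + a * (v * d - e * b) = b * ((v * s) * c - e * a)"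
    by (simp add: algebra_simps)
  finally have "(v * s) * c - e * a \<in> sat G" using b by (simp add: regular_mod_def)
  then show "c \<in> sat (insert a G)" by (rule sat_insertI[OF W_mult[OF v(1) s(1)]])
qed

text \<open>Finitely many multipliers can be merged into their product, since \<open>P\<close>
  survives enlarging a multiplier.\<close>

lemma common_multiplier:
  assumes "finite N" "\<And>i. i \<in> N \<Longrightarrow> \<exists>s\<in>W. P i s"
    and mult: "\<And>i s t. P i s \<Longrightarrow> t \<in> W \<Longrightarrow> P i (t * s)"
  shows "\<exists>s\<in>W. \<forall>i\<in>N. P i s"
  using assms(1,2)
proof (induction N rule: finite_induct)
  case empty
  then show ?case using one_W by blast
next
  case (insert i N)
  then obtain s where s: "s \<in> W" "\<forall>i\<in>N. P i s" by auto
  obtain t where t: "t \<in> W" "P i t" using insert.prems[of i] by auto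
  have "\<forall>j\<in>insert i N. P j (t * s)"
    using mult[of _ s t] mult[of i t s] s t by (auto simp: mult.commute[of t s])
  with W_mult[OF t(1) s(1)] show ?case by blast
qed

text \<open>Modulo \<open>y\<close>, a relation \<open>\<Sum>c\<^sub>i G\<^sub>i = 0\<close> between the products \<open>G\<^sub>i\<close> of all \<open>a\<^sub>j\<close> with \<open>j \<noteq> i\<close> forces
  \<open>c\<^sub>i = d\<^sub>i a\<^sub>i\<close> with \<open>\<Sum>d\<^sub>i = 0\<close>. Such relations lift, so \<open>y\<close> stays regular modulo the \<open>G\<^sub>i\<close>.\<close>

lemma regular_mod_products:
  assumes N: "finite N" "N \<noteq> {}"
    and y: "regular_mod y H"
    and a: "\<And>i. i \<in> N \<Longrightarrow> regular_mod (a i) (insert y H)"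
    and aa: "\<And>i j. i \<in> N \<Longrightarrow> j \<in> N \<Longrightarrow> i \<noteq> j \<Longrightarrow> regular_mod (a j) (insert (a i) (insert y H))"
  shows "regular_mod y ((\<lambda>i. \<Prod>j\<in>N - {i}. a j) ` N \<union> H)"
  unfolding regular_mod_def
proof (intro allI impI)
  define g where "g i = (\<Prod>j\<in>N - {i}. a j)" for i
  define p where "p = (\<Prod>j\<in>N. a j)"
  have ag: "a i * g i = p" if "i \<in> N" for i
    using N(1) that by (simp add: g_def p_def prod.remove)
  fix b assume b: "y * b \<in> sat ((\<lambda>i. \<Prod>j\<in>N - {i}. a j) ` N \<union> H)"
  then obtain s0 where s0: "s0 \<in> W" "s0 * (y * b) \<in> pideal.span (g ` N \<union> H)"
    by (auto simp: sat_def g_def[abs_def])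
  \<comment> \<open>Coefficients are indexed by \<open>N\<close> and not by the image of
    \<open>g\<close>, because different indices may give equal products.\<close>
  have repr: "\<exists>c. x = (\<Sum>i\<in>N. c i * g i)" if "x \<in> pideal.span (g ` N)" for x
    using that
  proof (induction rule: pideal.span_induct_alt)
    case base
    show ?case by (intro exI[of _ "\<lambda>_. 0"]) simp
  next
    case (step e x z)
    then obtain i c where i: "i \<in> N" "x = g i" "z = (\<Sum>i\<in>N. c i * g i)" by auto
    have "e * x = (\<Sum>j\<in>N. (if j = i then e else 0) * g j)"
      using i N(1) by (simp add: if_distrib[of "\<lambda>x. x * _"] sum.delta cong: if_cong)
    then have "e * x + z = (\<Sum>j\<in>N. ((if j = i then e else 0) + c j) * g j)"
      by (simp add: i(3) distrib_right sum.distrib)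
    then show ?case by (rule exI[of _ "\<lambda>j. (if j = i then e else 0) + c j"])
  qed
  from s0(2) obtain x h where xh: "s0 * (y * b) = x + h" "x \<in> pideal.span (g ` N)" "h \<in> pideal.span H"
    by (auto simp: pideal.span_Un)
  obtain c where c: "x = (\<Sum>i\<in>N. c i * g i)" using repr[OF xh(2)] by blast
  have J1: "sat H \<subseteq> sat (insert y H)" by (rule sat_mono) auto
  have "(s0 * b) * y \<in> sat (insert y H)" by (intro sat_mult sat_base) simp
  then have "s0 * (y * b) \<in> sat (insert y H)" by (simp add: ac_simps)
  then have xJ: "x \<in> sat (insert y H)"
    using sat_diff[of "s0 * (y * b)" "insert y H" h] J1 span_subset_sat[OF xh(3)] xh(1) by auto
  \<comment> \<open>Every \<open>g j\<close> with \<open>j \<noteq> i\<close> has the factor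
    \<open>a i\<close>. Modulo \<open>a i\<close> only \<open>c i * g i\<close> survives, and
    \<open>g i\<close> is a product of regular elements.\<close>
  have ci: "\<exists>s\<in>W. \<exists>d e. s * c i - d * a i - e * y \<in> sat H" if i: "i \<in> N" for i
  proof -
    let ?K = "insert (a i) (insert y H)"
    have "g j \<in> sat ?K" if j: "j \<in> N - {i}" for j
    proof -
      have "g j = (\<Prod>l\<in>N - {j} - {i}. a l) * a i"
        using N(1) i j prod.remove[of "N - {j}" i a] by (auto simp: g_def mult.commute)
      then show ?thesis by (simp add: sat_mult sat_base)
    qed
    then have "(\<Sum>j\<in>N - {i}. c j * g j) \<in> sat ?K" by (intro sat_sum sat_mult)
    moreover have "x \<in> sat ?K" using xJ sat_mono[of "insert y H" ?K] by auto
    moreover have "x = c i * g i + (\<Sum>j\<in>N - {i}. c j * g j)" using N(1) i by (simp add: c sum.remove)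
    ultimately have "g i * c i \<in> sat ?K"
      using sat_diff[of x ?K "\<Sum>j\<in>N - {i}. c j * g j"] by (simp add: mult.commute)
    moreover have "regular_mod (g i) ?K" unfolding g_def by (intro regular_mod_prod aa i) auto
    ultimately have "c i \<in> sat ?K" by (simp add: regular_mod_def)
    then obtain s d where s: "s \<in> W" "s * c i - d * a i \<in> sat (insert y H)" using sat_insertD by blast
    then obtain v e where v: "v \<in> W" "v * (s * c i - d * a i) - e * y \<in> sat H" using sat_insertD by blast
    then have "(v * s) * c i - (v * d) * a i - e * y \<in> sat H" by (simp add: algebra_simps)
    with W_mult[OF v(1) s(1)] show ?thesis by blast
  qed
  have "\<exists>s\<in>W. \<forall>i\<in>N. \<exists>d e. s * c i - d * a i - e * y \<in> sat H"
  proof (rule common_multiplier[OF N(1) ci])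
    fix i s t assume "\<exists>d e. s * c i - d * a i - e * y \<in> sat H"
    then obtain d e where "s * c i - d * a i - e * y \<in> sat H" by blast
    then have "t * (s * c i - d * a i - e * y) \<in> sat H" by (rule sat_mult)
    then have "(t * s) * c i - (t * d) * a i - (t * e) * y \<in> sat H" by (simp add: algebra_simps)
    then show "\<exists>d e. (t * s) * c i - d * a i - e * y \<in> sat H" by blast
  qed
  then obtain s where s: "s \<in> W" "\<forall>i\<in>N. \<exists>d e. s * c i - d * a i - e * y \<in> sat H" by blast
  then obtain d e where de: "\<And>i. i \<in> N \<Longrightarrow> s * c i - d i * a i - e i * y \<in> sat H" by metis
  define E where "E = (\<Sum>i\<in>N. e i * g i)"
  have "(\<Sum>i\<in>N. g i * (s * c i - d i * a i - e i * y)) \<in> sat H"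
    using de by (intro sat_sum sat_mult)
  also have "(\<Sum>i\<in>N. g i * (s * c i - d i * a i - e i * y)) =
      (\<Sum>i\<in>N. s * (c i * g i) - d i * (a i * g i) - y * (e i * g i))"
    by (intro sum.cong refl) (simp add: algebra_simps)
  also have "\<dots> = s * x - (\<Sum>i\<in>N. d i) * p - y * E"
    by (simp add: sum_subtractf c E_def sum_distrib_left sum_distrib_right ag)
  finally have rel: "s * x - (\<Sum>i\<in>N. d i) * p - y * E \<in> sat H" .
  have "(s * x - y * E) - (s * x - (\<Sum>i\<in>N. d i) * p - y * E) \<in> sat (insert y H)"
  proof -
    have "E * y \<in> sat (insert y H)" by (intro sat_mult sat_base) simp
    then have "y * E \<in> sat (insert y H)" by (simp add: mult.commute)
    then show ?thesis using sat_diff[OF sat_diff[OF sat_mult[OF xJ]] subsetD[OF J1 rel]] by blast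
  qed
  then have "p * (\<Sum>i\<in>N. d i) \<in> sat (insert y H)" by (simp add: mult.commute)
  moreover have "regular_mod p (insert y H)" unfolding p_def by (intro regular_mod_prod a)
  ultimately have "(\<Sum>i\<in>N. d i) \<in> sat (insert y H)" by (simp add: regular_mod_def)
  then obtain w q where w: "w \<in> W" "w * (\<Sum>i\<in>N. d i) - q * y \<in> sat H" using sat_insertD by blast
  \<comment> \<open>Eliminating the sum of the \<open>d i\<close> between the two relations leaves
    an expression divisible by \<open>y\<close>, and \<open>y\<close> is cancelled modulo
    \<open>H\<close>.\<close>
  have "w * (s * x - (\<Sum>i\<in>N. d i) * p - y * E) + p * (w * (\<Sum>i\<in>N. d i) - q * y) + (w * s) * h \<in> sat H"
    using rel w(2) span_subset_sat[OF xh(3)] by (intro sat_add sat_mult)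
  also have "w * (s * x - (\<Sum>i\<in>N. d i) * p - y * E) + p * (w * (\<Sum>i\<in>N. d i) - q * y) + (w * s) * h
      = (w * s) * (x + h) - y * (w * E + q * p)"
    by (simp add: algebra_simps)
  also have "\<dots> = y * ((w * s * s0) * b - (w * E + q * p))"
    unfolding xh(1)[symmetric] by (simp add: algebra_simps)
  finally have "(w * s * s0) * b - (w * E + q * p) \<in> sat H"
    using y by (simp add: regular_mod_def)
  then have "(w * s * s0) * b - (w * E + q * p) \<in> sat (g ` N \<union> H)"
    using sat_mono[of H "g ` N \<union> H"] by auto
  moreover have "w * E + q * p \<in> sat (g ` N \<union> H)"
  proof -
    obtain i where "i \<in> N" using N(2) by blast
    then have "p \<in> sat (g ` N \<union> H)" using ag[of i] sat_mult[OF sat_base[of "g i"]] by fastforce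
    moreover have "E \<in> sat (g ` N \<union> H)" unfolding E_def by (intro sat_sum sat_mult sat_base) auto
    ultimately show ?thesis by (intro sat_add sat_mult)
  qed
  ultimately have "((w * s * s0) * b - (w * E + q * p)) + (w * E + q * p) \<in> sat (g ` N \<union> H)"
    by (rule sat_add)
  then have "(w * s * s0) * b \<in> sat (g ` N \<union> H)" by simp
  then have "b \<in> sat (g ` N \<union> H)"
    by (rule sat_cancel[OF W_mult[OF W_mult[OF w(1) s(1)] s0(1)]])
  then show "b \<in> sat ((\<lambda>i. \<Prod>j\<in>N - {i}. a j) ` N \<union> H)" by (simp add: g_def[abs_def])
qed

end

subsection \<open>Complete homogeneous symmetric polynomials\<close>

text \<open>The complete homogeneous symmetric polynomial of degree \<open>k\<close> in the
  \<open>u i\<close>, taken as a coefficient of the product of the geometric series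
  \<open>1 / (1 - u i * X)\<close>.\<close>

definition complete_sym :: "(nat \<Rightarrow> 'a::comm_ring_1) \<Rightarrow> nat set \<Rightarrow> nat \<Rightarrow> 'a" where
  "complete_sym u A k = fps_nth (\<Prod>i\<in>A. Abs_fps (\<lambda>k. u i ^ k)) k"

lemma complete_sym_0 [simp]: "complete_sym u A 0 = 1"
  by (induction A rule: infinite_finite_induct) (simp_all add: complete_sym_def)

lemma complete_sym_empty [simp]: "k > 0 \<Longrightarrow> complete_sym u {} k = 0"
  by (simp add: complete_sym_def)

text \<open>Comes from the identity \<open>g = 1 + u i * X * g\<close> for the geometric series; it
  separates the part without \<open>u i\<close>.\<close>

lemma complete_sym_insert:
  assumes "finite A" "i \<notin> A"
  shows "complete_sym u (insert i A) (Suc k) =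
    complete_sym u A (Suc k) + u i * complete_sym u (insert i A) k"
proof -
  let ?g = "Abs_fps (\<lambda>k. u i ^ k)" and ?P = "\<Prod>i\<in>A. Abs_fps (\<lambda>k. u i ^ k)"
  have "?g = 1 + fps_X * (fps_const (u i) * ?g)"
    by (rule fps_ext) (auto simp: fps_X_mult_nth power_eq_if)
  then have "?g * ?P = ?P + fps_X * (fps_const (u i) * (?g * ?P))"
    by (metis (no_types, lifting) distrib_right mult.assoc mult_1)
  then have "fps_nth (?g * ?P) (Suc k) = fps_nth (?P + fps_X * (fps_const (u i) * (?g * ?P))) (Suc k)"
    by (rule arg_cong)
  then show ?thesis using assms by (simp add: complete_sym_def)
qed

text \<open>Dropping variables from the end of the list changes \<open>h\<^sub>k\<close> only by multiples of \<open>h\<^sub>1, \<dots>, h\<^sub>k\<^sub>-\<^sub>1\<close> of all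
  variables, as long as at least \<open>m - k + 1\<close> of the \<open>m\<close> variables remain.\<close>

lemma complete_sym_take:
  fixes u :: "nat \<Rightarrow> 'a::comm_ring_1"
  assumes vs: "distinct vs" and r: "length vs < r + k" "r \<le> length vs" and k: "k \<ge> 1"
  shows "complete_sym u (set vs) k - complete_sym u (set (take r vs)) k
    \<in> pideal.span (complete_sym u (set vs) ` {1..<k})"
  using r(2,1) k
\<comment> \<open>Downward from \<open>r = length vs\<close>, where the difference is zero. The step
  at \<open>k\<close> also uses the hypothesis at \<open>k - 1\<close>.\<close>
proof (induction r arbitrary: k rule: inc_induct)
  case base
  show ?case by (simp add: pideal.span_zero)
next
  case (step r)
  let ?h = "complete_sym u (set vs)" and ?t = "\<lambda>r. complete_sym u (set (take r vs))"
  obtain k' where k': "k = Suc k'" using step.prems by (cases k) auto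
  have "k' \<ge> 1" using step k' by auto
  have tk: "set (take (Suc r) vs) = insert (vs ! r) (set (take r vs))"
    using step.hyps by (simp add: take_Suc_conv_app_nth)
  have "vs ! r \<notin> set (take r vs)"
    using vs step.hyps by (simp add: in_set_conv_nth nth_eq_iff_index_eq)
  then have "?t (Suc r) k = ?t r k + u (vs ! r) * ?t (Suc r) k'"
    unfolding k' tk by (intro complete_sym_insert) auto
  moreover have "?h k - ?t (Suc r) k \<in> pideal.span (?h ` {1..<k})"
    using step.IH[of k] step.prems by simp
  moreover have "u (vs ! r) * ?t (Suc r) k' \<in> pideal.span (?h ` {1..<k})"
  proof -
    have "?h k' - ?t (Suc r) k' \<in> pideal.span (?h ` {1..<k'})"
      using step.IH[of k'] step.prems k' \<open>k' \<ge> 1\<close> by simp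
    also have "\<dots> \<subseteq> pideal.span (?h ` {1..<k})" using k' by (intro pideal.span_mono) auto
    finally have "?h k' - ?t (Suc r) k' \<in> pideal.span (?h ` {1..<k})" .
    moreover have "?h k' \<in> pideal.span (?h ` {1..<k})"
      using k' \<open>k' \<ge> 1\<close> by (intro pideal.span_base) auto
    ultimately have "?h k' - (?h k' - ?t (Suc r) k') \<in> pideal.span (?h ` {1..<k})"
      using pideal.span_diff by blast
    then show ?thesis by (intro pideal.span_scale) simp
  qed
  ultimately have "(?h k - ?t (Suc r) k) + u (vs ! r) * ?t (Suc r) k' \<in> pideal.span (?h ` {1..<k})"
    by (intro pideal.span_add)
  then show ?case using \<open>?t (Suc r) k = ?t r k + u (vs ! r) * ?t (Suc r) k'\<close> by (simp add: algebra_simps)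
qed

lemma complete_sym_remove:
  assumes "finite A" "i \<notin> A"
  shows "complete_sym u (insert i A) k - complete_sym u A k \<in> pideal.span {u i}"
  using assms
  by (cases k) (simp_all add: complete_sym_insert pideal.span_zero pideal_span_mult_right pideal.span_base)

lemma complete_sym_in_polys:
  assumes "finite A" "\<And>i. i \<in> A \<Longrightarrow> u i \<in> polys V"
  shows "complete_sym u A k \<in> polys V"
  using assms
proof (induction A arbitrary: k rule: finite_induct)
  case empty
  show ?case by (cases k) auto
next
  case (insert i A)
  show ?case
  proof (induction k)
    case (Suc k)
    then show ?case using insert by (auto simp: complete_sym_insert intro!: polys_add polys_mult)
  qed simp
qed

subsection \<open>Triangular sequences\<close>

text \<open>Multipliers involve only the variables \<open>T\<close>, so \<open>univ\<close> for any
  other variable treats them as constants.\<close>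

locale var_mult_set = mult_set W for W :: "'k::field mpoly set" +
  fixes T :: "nat set"
  assumes W_polys: "W \<subseteq> polys T" and zero_notin_W: "0 \<notin> W"
begin

text \<open>If neither generators nor multipliers contain the variable \<open>v\<close>, membership
  can be read off coefficient by coefficient.\<close>

lemma coeff_univ_in_sat:
  assumes v: "v \<notin> T" and G: "\<And>g. g \<in> G \<Longrightarrow> univ v g = [:g:]" and p: "p \<in> sat G"
  shows "Polynomial.coeff (univ v p) d \<in> sat G"
proof -
  have span: "Polynomial.coeff (univ v p) d \<in> pideal.span G" if "p \<in> pideal.span G" for p
    using that
  proof (induction rule: pideal.span_induct_alt)
    case base
    show ?case by (simp add: pideal.span_zero)
  next
    case (step c x y)
    have "Polynomial.coeff (univ v (c * x + y)) d = Polynomial.coeff (univ v c) d * x + Polynomial.coeff (univ v y) d"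
      using G[OF step(1)] by (simp add: univ_add univ_mult mult.commute[of _ x])
    also have "\<dots> \<in> pideal.span G"
      by (intro pideal.span_add pideal.span_scale step(2) pideal.span_base step(1))
    finally show ?case .
  qed
  from p obtain s where s: "s \<in> W" "s * p \<in> pideal.span G" by (auto simp: sat_def)
  have "univ v s = [:s:]" using s(1) W_polys v by (intro univ_polys[of _ T]) auto
  then have "Polynomial.coeff (univ v (s * p)) d = s * Polynomial.coeff (univ v p) d"
    by (simp add: univ_mult)
  with span[OF s(2)] have "s * Polynomial.coeff (univ v p) d \<in> pideal.span G" by simp
  then show ?thesis by (rule satI[OF s(1)])
qed

text \<open>Let \<open>d\<close> be the largest degree at which the coefficient of \<open>b\<close>
  is outside \<open>sat G\<close>. Modulo \<open>sat G\<close>, a coefficient of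
  \<open>f * b\<close> is this one times the leading coefficient of \<open>f\<close>, which can be
  cancelled.\<close>

lemma regular_mod_lead_coeff:
  assumes v: "v \<notin> T" and G: "\<And>g. g \<in> G \<Longrightarrow> univ v g = [:g:]"
    and f: "Polynomial.lead_coeff (univ v f) \<in> W"
  shows "regular_mod f G"
  unfolding regular_mod_def
proof (intro allI impI, rule ccontr)
  fix b assume fb: "f * b \<in> sat G" and b: "b \<notin> sat G"
  let ?f = "univ v f" and ?b = "univ v b"
  define D where "D = {d. Polynomial.coeff ?b d \<notin> sat G}"
  have "D \<subseteq> {..Polynomial.degree ?b}"
    unfolding D_def by (metis (mono_tags, lifting) atMost_iff coeff_eq_0 mem_Collect_eq not_le sat_0 subsetI)
  then have finD: "finite D" by (rule finite_subset) simp
  have "D \<noteq> {}"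
  proof
    assume "D = {}"
    then have "(\<Sum>d\<le>Polynomial.degree ?b. indet v ^ d * Polynomial.coeff ?b d) \<in> sat G"
      by (intro sat_sum sat_mult) (auto simp: D_def)
    moreover have "(\<Sum>d\<le>Polynomial.degree ?b. indet v ^ d * Polynomial.coeff ?b d) = poly ?b (indet v)"
      by (simp add: poly_altdef mult.commute)
    ultimately show False using b by simp
  qed
  define d where "d = Max D"
  have d: "Polynomial.coeff ?b d \<notin> sat G" using Max_in[OF finD \<open>D \<noteq> {}\<close>] by (simp add: d_def D_def)
  have above: "Polynomial.coeff ?b e \<in> sat G" if "e > d" for e
    using Max_ge[OF finD, of e] that by (auto simp: d_def D_def)
  let ?n = "Polynomial.degree ?f"
  have "Polynomial.coeff (univ v (f * b)) (?n + d) =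
      (\<Sum>i\<le>?n + d. Polynomial.coeff ?f i * Polynomial.coeff ?b (?n + d - i))"
    by (simp add: univ_mult Polynomial.coeff_mult)
  also have "\<dots> = Polynomial.coeff ?f ?n * Polynomial.coeff ?b d +
      (\<Sum>i\<in>{..?n + d} - {?n}. Polynomial.coeff ?f i * Polynomial.coeff ?b (?n + d - i))"
    by (subst sum.remove[of _ ?n]) auto
  finally have eq: "Polynomial.lead_coeff ?f * Polynomial.coeff ?b d = Polynomial.coeff (univ v (f * b)) (?n + d)
      - (\<Sum>i\<in>{..?n + d} - {?n}. Polynomial.coeff ?f i * Polynomial.coeff ?b (?n + d - i))"
    by simp
  have "Polynomial.coeff ?f i * Polynomial.coeff ?b (?n + d - i) \<in> sat G" if "i \<in> {..?n + d} - {?n}" for i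
  proof (cases "i < ?n")
    case True
    then show ?thesis by (intro sat_mult above) auto
  next
    case False
    with that have "Polynomial.coeff ?f i = 0" by (intro coeff_eq_0) auto
    then show ?thesis by (simp add: sat_0)
  qed
  then have "Polynomial.lead_coeff ?f * Polynomial.coeff ?b d \<in> sat G"
    unfolding eq by (intro sat_diff coeff_univ_in_sat[OF v G fb] sat_sum)
  with d f show False using sat_cancel by blast
qed

text \<open>If \<open>i\<close> is below all of \<open>S\<close>, the generators are free of the
  variable \<open>v i\<close>. Otherwise the least \<open>b\<close> is regular modulo the others
  together with \<open>f i\<close>, and \<open>regular_mod_swap\<close> exchanges \<open>f b\<close>
  and \<open>f i\<close>.\<close>

lemma regular_mod_triangular:
  fixes f :: "nat \<Rightarrow> 'k mpoly" and v :: "nat \<Rightarrow> nat"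
  assumes v: "\<And>k. k \<in> K \<Longrightarrow> v k \<notin> T"
    and lead: "\<And>k. k \<in> K \<Longrightarrow> Polynomial.lead_coeff (univ (v k) (f k)) \<in> W"
    and free: "\<And>k l. k \<in> K \<Longrightarrow> l \<in> K \<Longrightarrow> k < l \<Longrightarrow> univ (v k) (f l) = [:f l:]"
    and S: "finite S" "S \<subseteq> K" and i: "i \<in> K - S"
  shows "regular_mod (f i) (f ` S)"
  using S i
proof (induction S arbitrary: i rule: finite_linorder_min_induct)
  case empty
  then show ?case using v lead by (intro regular_mod_lead_coeff[of "v i"]) auto
next
  case (insert b A)
  show ?case
  proof (cases "i < b")
    case True
    have "univ (v i) g = [:g:]" if "g \<in> f ` insert b A" for g
      using that insert True by (auto intro!: free)
    then show ?thesis using v lead insert.prems by (intro regular_mod_lead_coeff[of "v i"]) auto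
  next
    case False
    then have bi: "b < i" using insert.prems by (metis DiffD2 insertI1 linorder_neqE_nat)
    have "univ (v b) g = [:g:]" if "g \<in> insert (f i) (f ` A)" for g
      using that insert bi by (auto intro!: free)
    then have "regular_mod (f b) (insert (f i) (f ` A))"
      using v lead insert.prems by (intro regular_mod_lead_coeff[of "v b"]) auto
    moreover have "regular_mod (f i) (f ` A)" using insert.prems by (intro insert.IH) auto
    ultimately show ?thesis by (simp add: regular_mod_swap)
  qed
qed

text \<open>Each \<open>y l\<close> agrees with \<open>f l\<close> up to earlier \<open>y\<close>,
  so either family generates the other; expressing \<open>y\<close> by \<open>f\<close> takes an
  induction on \<open>l\<close>.\<close>

lemma sat_unitriangular:
  fixes y f :: "nat \<Rightarrow> 'k mpoly"
  assumes "\<And>l. 1 \<le> l \<Longrightarrow> l \<le> k \<Longrightarrow> y l - f l \<in> pideal.span (y ` {1..<l})"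
  shows "sat (B \<union> y ` {1..k}) = sat (B \<union> f ` {1..k})"
proof (rule sat_eqI)
  have "f l \<in> sat (B \<union> y ` {1..k})" if l: "1 \<le> l" "l \<le> k" for l
  proof -
    have "y ` {1..<l} \<subseteq> B \<union> y ` {1..k}" using l by auto
    then have "y l - f l \<in> sat (B \<union> y ` {1..k})"
      using assms[OF l] pideal.span_mono span_subset_sat by blast
    moreover have "y l \<in> sat (B \<union> y ` {1..k})" using l by (intro sat_base) auto
    ultimately have "y l - (y l - f l) \<in> sat (B \<union> y ` {1..k})" using sat_diff by blast
    then show ?thesis by simp
  qed
  then show "B \<union> f ` {1..k} \<subseteq> sat (B \<union> y ` {1..k})" by (auto intro: sat_base)
  have "y l \<in> sat (B \<union> f ` {1..k})" if "1 \<le> l" "l \<le> k" for l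
    using that
  proof (induction l rule: less_induct)
    case (less l)
    have "y ` {1..<l} \<subseteq> sat (B \<union> f ` {1..k})" using less by auto
    then have "y l - f l \<in> sat (B \<union> f ` {1..k})"
      using assms[OF less.prems] sat_subset span_subset_sat by blast
    moreover have "f l \<in> sat (B \<union> f ` {1..k})" using less.prems by (intro sat_base) auto
    ultimately have "(y l - f l) + f l \<in> sat (B \<union> f ` {1..k})" by (rule sat_add)
    then show ?case by simp
  qed
  then show "B \<union> y ` {1..k} \<subseteq> sat (B \<union> f ` {1..k})" by (auto intro: sat_base)
qed

end

section \<open>Regularity of complete symmetric polynomials\<close>

lemma lead_complete_sym:
  fixes u :: "nat \<Rightarrow> 'k::field mpoly"
  assumes A: "finite A" "i \<notin> A" and T: "i \<notin> T"
    and u: "\<And>j. j \<in> insert i A \<Longrightarrow> u j \<in> polys (insert j T)"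
    and deg: "Polynomial.degree (univ i (u i)) > 0"
  shows "Polynomial.degree (univ i (complete_sym u (insert i A) k)) = k * Polynomial.degree (univ i (u i))
    \<and> Polynomial.lead_coeff (univ i (complete_sym u (insert i A) k)) = Polynomial.lead_coeff (univ i (u i)) ^ k"
proof (induction k)
  case (Suc k)
  let ?h = "complete_sym u (insert i A)" and ?D = "Polynomial.degree (univ i (u i))"
  have "complete_sym u A (Suc k) \<in> polys (A \<union> T)"
    using u polys_mono[of "insert _ T" "A \<union> T"] by (intro complete_sym_in_polys A(1)) blast
  then have 1: "univ i (complete_sym u A (Suc k)) = [:complete_sym u A (Suc k):]"
    using A(2) T by (intro univ_polys[of _ "A \<union> T"]) auto
  \<comment> \<open>The first summand is constant in the variable \<open>i\<close>, so degree and
    leading coefficient come from the product.\<close>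
  have eq: "univ i (?h (Suc k)) = univ i (complete_sym u A (Suc k)) + univ i (u i) * univ i (?h k)"
    using A by (simp add: complete_sym_insert univ_add univ_mult)
  have nz: "univ i (u i) \<noteq> 0" using deg by auto
  then have "Polynomial.lead_coeff (univ i (?h k)) \<noteq> 0" using Suc by auto
  then have nzh: "univ i (?h k) \<noteq> 0" by auto
  have degp: "Polynomial.degree (univ i (u i) * univ i (?h k)) = Suc k * ?D"
    using nz nzh Suc by (simp add: degree_mult_eq)
  have lt: "Polynomial.degree (univ i (complete_sym u A (Suc k))) < Polynomial.degree (univ i (u i) * univ i (?h k))"
    unfolding degp 1 using deg by simp
  show ?case
  proof
    show "Polynomial.degree (univ i (?h (Suc k))) = Suc k * ?D"
      unfolding eq degree_add_eq_right[OF lt] by (rule degp)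
    show "Polynomial.lead_coeff (univ i (?h (Suc k))) = Polynomial.lead_coeff (univ i (u i)) ^ Suc k"
      unfolding eq lead_coeff_add_le[OF lt] lead_coeff_mult
      by (simp only: Suc[THEN conjunct2] power_Suc)
  qed
qed simp

context var_mult_set
begin

text \<open>\<open>f l\<close> uses the first \<open>length vs - l + 1\<close> variables and is led
  by the last of these, \<open>vs ! (length vs - l)\<close>, which no later \<open>f\<close>
  contains. The powers of \<open>indet e\<close> follow in the triangular order, so \<open>E\<close>
  has to avoid the \<open>k\<close> leading variables.\<close>

lemma regular_mod_complete_sym:
  fixes u :: "nat \<Rightarrow> 'k mpoly"
  assumes vs: "distinct vs" "set vs \<inter> T = {}" and k: "k \<le> length vs"
    and u: "\<And>i. i \<in> set vs \<Longrightarrow> u i \<in> polys (insert i T)"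
      "\<And>i. i \<in> set vs \<Longrightarrow> Polynomial.degree (univ i (u i)) > 0"
      "\<And>i. i \<in> set vs \<Longrightarrow> Polynomial.lead_coeff (univ i (u i)) \<in> W"
    and E: "finite E" "E \<inter> T = {}" "E \<inter> set (drop (length vs - k) vs) = {}"
  defines "f \<equiv> \<lambda>l. complete_sym u (set (take (length vs - l + 1) vs)) l"
  shows "1 \<le> l \<Longrightarrow> l \<le> k \<Longrightarrow> regular_mod (f l) (f ` {1..<l})"
    and "e \<in> E \<Longrightarrow> E' \<subseteq> E - {e} \<Longrightarrow> regular_mod (indet e ^ t) ((\<lambda>e. indet e ^ t) ` E' \<union> f ` {1..k})"
proof -
  let ?m = "length vs"
  \<comment> \<open>One index set for both kinds of elements: \<open>l \<le> length vs\<close>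
    stands for \<open>f l\<close>, and the shifted index \<open>sh e\<close> for the power of
    \<open>indet e\<close>.\<close>
  define g where "g l = (if l \<le> ?m then f l else indet (l - Suc ?m) ^ t)" for l
  define v where "v l = (if l \<le> ?m then vs ! (?m - l) else l - Suc ?m)" for l
  define sh where "sh e = e + Suc ?m" for e
  define K where "K = {1..k} \<union> sh ` E"
  have gsh: "g (sh e) = indet e ^ t" and vsh: "v (sh e) = e" for e
    by (auto simp: g_def v_def sh_def)
  have gf: "g l = f l" and vf: "v l = vs ! (?m - l)" if "l \<le> ?m" for l
    using that by (auto simp: g_def v_def)
  have pow: "univ e (indet e ^ t) = ([:0, 1:] ^ t :: 'k mpoly poly)" for e
    by (simp add: univ_power univ_indet)
  have vin: "vs ! (?m - l) \<in> set vs" if "l \<in> {1..k}" for l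
    using that k by (intro nth_mem) auto
  have vdrop: "vs ! (?m - l) \<in> set (drop (?m - k) vs)" if "l \<in> {1..k}" for l
  proof -
    have "drop (?m - k) vs ! (k - l) = vs ! (?m - l)" using that k by (subst nth_drop) auto
    moreover have "k - l < length (drop (?m - k) vs)" using that k by auto
    ultimately show ?thesis by (metis nth_mem)
  qed
  have take_insert: "set (take (?m - l + 1) vs) = insert (vs ! (?m - l)) (set (take (?m - l) vs))"
    if "l \<in> {1..k}" for l
  proof -
    have "?m - l < ?m" using that k by auto
    then show ?thesis by (simp add: take_Suc_conv_app_nth)
  qed
  have notin_take: "vs ! (?m - l) \<notin> set (take r vs)" if "l \<in> {1..k}" "r \<le> ?m - l" for l r
  proof
    assume "vs ! (?m - l) \<in> set (take r vs)"
    then obtain q where "q < r" "q < ?m" "vs ! q = vs ! (?m - l)" by (auto simp: in_set_conv_nth)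
    moreover have "?m - l < ?m" using that k by auto
    ultimately have "q < r" "q = ?m - l" using nth_eq_iff_index_eq[OF vs(1)] by auto
    with that show False by simp
  qed
  have v: "v l \<notin> T" if "l \<in> K" for l
  proof (cases "l \<in> {1..k}")
    case True
    with vin[OF True] vs(2) k show ?thesis by (auto simp: vf)
  next
    case False
    with that E(2) vsh show ?thesis by (auto simp: K_def)
  qed
  have lead: "Polynomial.lead_coeff (univ (v l) (g l)) \<in> W" if "l \<in> K" for l
  proof (cases "l \<in> {1..k}")
    case True
    let ?i = "vs ! (?m - l)"
    have "Polynomial.lead_coeff (univ ?i (f l)) = Polynomial.lead_coeff (univ ?i (u ?i)) ^ l"
      unfolding f_def take_insert[OF True]
      using vin[OF True] vs(2) notin_take[OF True] u(1,2) set_take_subset[of "?m - l" vs]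
      by (intro lead_complete_sym[THEN conjunct2, of _ _ T]) auto
    moreover have "c ^ l \<in> W" if "c \<in> W" for c l using that by (induction l) (auto intro: one_W W_mult)
    ultimately show ?thesis using True k u(3)[OF vin[OF True]] by (simp add: gf vf)
  next
    case False
    with that obtain e where "l = sh e" by (auto simp: K_def)
    then show ?thesis using one_W by (simp add: gsh vsh pow lead_coeff_power)
  qed
  have free: "univ (v a) (g b) = [:g b:]" if ab: "a \<in> K" "b \<in> K" "a < b" for a b
  proof (cases "b \<in> {1..k}")
    case True
    then have a: "a \<in> {1..k}" using ab k by (auto simp: K_def sh_def)
    have "f b \<in> polys (set (take (?m - b + 1) vs) \<union> T)"
      unfolding f_def
    proof (rule complete_sym_in_polys)
      fix i assume i: "i \<in> set (take (?m - b + 1) vs)"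
      then have "i \<in> set vs" using set_take_subset by fastforce
      then have "u i \<in> polys (insert i T)" by (rule u(1))
      also have "\<dots> \<subseteq> polys (set (take (?m - b + 1) vs) \<union> T)" using i by (intro polys_mono) auto
      finally show "u i \<in> polys (set (take (?m - b + 1) vs) \<union> T)" .
    qed simp
    moreover have "vs ! (?m - a) \<notin> set (take (?m - b + 1) vs) \<union> T"
      using notin_take[OF a, of "?m - b + 1"] ab(3) True k vin[OF a] vs(2) by auto
    ultimately show ?thesis using True a k by (simp add: gf vf univ_polys)
  next
    case False
    with ab obtain e where e: "b = sh e" "e \<in> E" by (auto simp: K_def)
    have "v a \<noteq> e"
    proof (cases "a \<in> {1..k}")
      case True
      with vdrop[OF True] E(3) e(2) k show ?thesis by (auto simp: vf)
    next
      case False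
      with ab obtain e' where e': "a = sh e'" by (auto simp: K_def)
      then have "e' < e" using ab(3) e(1) by (simp add: sh_def)
      then show ?thesis unfolding e' vsh by simp
    qed
    then show ?thesis unfolding e(1) gsh
      by (intro univ_polys[of _ "{e}"] polys_power polys_indet) auto
  qed
  have gimg: "g ` {1..<l} = f ` {1..<l}" if "l \<le> Suc k" for l
    using that k by (intro image_cong) (auto simp: gf)
  show "regular_mod (f l) (f ` {1..<l})" if "1 \<le> l" "l \<le> k"
  proof -
    have "regular_mod (g l) (g ` {1..<l})"
    proof (rule regular_mod_triangular[OF v lead free])
      show "finite {1..<l}" by (rule finite_atLeastLessThan)
      show "{1..<l} \<subseteq> K" "l \<in> K - {1..<l}" using that unfolding K_def by auto
    qed
    then show ?thesis using gimg[of l] that k by (simp add: gf)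
  qed
  show "regular_mod (indet e ^ t) ((\<lambda>e. indet e ^ t) ` E' \<union> f ` {1..k})" if e: "e \<in> E" "E' \<subseteq> E - {e}"
  proof -
    have "regular_mod (g (sh e)) (g ` (sh ` E' \<union> {1..<Suc k}))"
    proof (rule regular_mod_triangular[OF v lead free])
      show "finite (sh ` E' \<union> {1..<Suc k})" using e E(1) finite_subset[of E' E] by auto
      show "sh ` E' \<union> {1..<Suc k} \<subseteq> K" using e by (auto simp: K_def)
      show "sh e \<in> K - (sh ` E' \<union> {1..<Suc k})" using e k by (auto simp: K_def sh_def)
    qed
    moreover have "g ` sh ` E' = (\<lambda>e. indet e ^ t) ` E'" by (simp add: image_image gsh)
    ultimately show ?thesis using gimg[of "Suc k"]
      by (simp add: gsh image_Un atLeastLessThanSuc_atLeastAtMost)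
  qed
qed

end

text \<open>\<open>u i\<close> has two roles. As a polynomial in \<open>indet i\<close> over the
  variables \<open>T\<close> it has leading coefficient in \<open>W\<close>, which makes the
  sequence triangular; as a multiple of \<open>indet i ^ t\<close> it vanishes modulo this
  power.\<close>

locale parameter_system = var_mult_set W T for W :: "'k::field mpoly set" and T +
  fixes S :: "nat set" and t :: nat and u q :: "nat \<Rightarrow> 'k mpoly"
  assumes S: "finite S" "S \<inter> T = {}"
    and u_polys: "\<And>i. i \<in> S \<Longrightarrow> u i \<in> polys (insert i T)"
    and u_deg: "\<And>i. i \<in> S \<Longrightarrow> Polynomial.degree (univ i (u i)) > 0"
    and u_lead: "\<And>i. i \<in> S \<Longrightarrow> Polynomial.lead_coeff (univ i (u i)) \<in> W"
    and u_eq: "\<And>i. i \<in> S \<Longrightarrow> u i = indet i ^ t * q i"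
begin

abbreviation "y \<equiv> complete_sym u S"

text \<open>For any ordering of \<open>S\<close>, \<open>y\<close> is traded for the triangular
  \<open>f\<close>, which gives the same saturated ideals.\<close>

lemma y_regular:
  assumes l: "1 \<le> l" "l \<le> card S"
  shows "regular_mod (y l) (y ` {1..<l})"
proof -
  obtain vs where vs: "set vs = S" "distinct vs" using finite_distinct_list[OF S(1)] by blast
  define f where "f = (\<lambda>l. complete_sym u (set (take (length vs - l + 1) vs)) l)"
  have len: "length vs = card S" using vs distinct_card by fastforce
  have f: "regular_mod (f l) (f ` {1..<l})"
    unfolding f_def
    by (rule regular_mod_complete_sym(1)[of vs "card S" u "{}"])
       (use vs S u_polys u_deg u_lead len l in auto)
  have yf: "y l - f l \<in> pideal.span (y ` {1..<l})" if "1 \<le> l" "l \<le> card S" for l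
    unfolding f_def vs(1)[symmetric] using that len vs(2) by (intro complete_sym_take) auto
  have "sat ({} \<union> y ` {1..l - 1}) = sat ({} \<union> f ` {1..l - 1})"
    using l yf by (intro sat_unitriangular) auto
  moreover have "{1..l - 1} = {1..<l}" using l by auto
  ultimately have eq: "sat (f ` {1..<l}) = sat (y ` {1..<l})" by simp
  have "f l - y l = - (y l - f l)" by simp
  also have "\<dots> \<in> sat (f ` {1..<l})" unfolding eq by (intro sat_minus span_subset_sat yf l)
  finally show ?thesis using regular_mod_cong[OF eq _ f] by blast
qed

lemma indet_power_regular:
  assumes i: "i \<in> S" and k: "k < card S"
  shows "regular_mod (indet i ^ t) (y ` {1..k})"
proof -
  obtain ws where ws: "set ws = S - {i}" "distinct ws" using finite_distinct_list[of "S - {i}"] S(1) by blast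
  \<comment> \<open>\<open>i\<close> comes first, hence outside the last \<open>k < card S\<close>
    positions, which hold the leading variables.\<close>
  define vs where "vs = i # ws"
  have vs: "set vs = S" "distinct vs" using ws i by (auto simp: vs_def)
  define f where "f = (\<lambda>l. complete_sym u (set (take (length vs - l + 1) vs)) l)"
  have len: "length vs = card S" using vs distinct_card by fastforce
  have "set (drop (length vs - k) vs) \<subseteq> set ws"
    using k len by (cases "length vs - k") (auto simp: vs_def dest: in_set_dropD)
  then have drop: "{i} \<inter> set (drop (length vs - k) vs) = {}" using ws by auto
  have "regular_mod (indet i ^ t) ((\<lambda>e. indet e ^ t) ` {} \<union> f ` {1..k})"
    unfolding f_def
    by (rule regular_mod_complete_sym(2)[where E = "{i}", OF vs(2) _ _ _ _ _ _ _ drop])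
       (use vs S u_polys u_deg u_lead len k i in auto)
  moreover have "sat ({} \<union> y ` {1..k}) = sat ({} \<union> f ` {1..k})"
    unfolding f_def vs(1)[symmetric] using k len vs(2)
    by (intro sat_unitriangular complete_sym_take) auto
  ultimately show ?thesis
    using regular_mod_cong[of "f ` {1..k}" "y ` {1..k}" "indet i ^ t" "indet i ^ t"] by (simp add: sat_0)
qed

text \<open>Modulo \<open>indet i ^ t\<close> the element \<open>u i\<close> vanishes, so
  \<open>y\<close> can be replaced by the symmetric polynomials over \<open>S - {i}\<close>. Among
  those \<open>card S - 1\<close> variables \<open>j\<close> must not be a leading one, whence
  \<open>k + 2 \<le> card S\<close>.\<close>

lemma indet_power_pair_regular:
  assumes ij: "i \<in> S" "j \<in> S" "i \<noteq> j" and k: "k + 2 \<le> card S"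
  shows "regular_mod (indet j ^ t) (insert (indet i ^ t) (y ` {1..k}))"
proof -
  let ?a = "indet i ^ t" and ?y' = "complete_sym u (S - {i})"
  obtain ws where ws: "set ws = S - {i, j}" "distinct ws" using finite_distinct_list[of "S - {i, j}"] S(1) by blast
  define vs where "vs = j # ws"
  have vs: "set vs = S - {i}" "distinct vs" using ws ij by (auto simp: vs_def)
  define f where "f = (\<lambda>l. complete_sym u (set (take (length vs - l + 1) vs)) l)"
  have "length vs = card (S - {i})" using vs distinct_card by fastforce
  then have len: "length vs = card S - 1" using S(1) ij(1) by simp
  have "set (drop (length vs - k) vs) \<subseteq> set ws"
    using k len by (cases "length vs - k") (auto simp: vs_def dest: in_set_dropD)
  then have drop: "{i, j} \<inter> set (drop (length vs - k) vs) = {}" using ws by auto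
  have "regular_mod (indet j ^ t) ((\<lambda>e. indet e ^ t) ` {i} \<union> f ` {1..k})"
    unfolding f_def
    by (rule regular_mod_complete_sym(2)[where E = "{i, j}", OF vs(2) _ _ _ _ _ _ _ drop])
       (use vs S u_polys u_deg u_lead len k ij in auto)
  moreover have "sat ({?a} \<union> ?y' ` {1..k}) = sat ({?a} \<union> f ` {1..k})"
    unfolding f_def vs(1)[symmetric] using k len vs(2)
    by (intro sat_unitriangular complete_sym_take) auto
  moreover have "sat ({?a} \<union> y ` {1..k}) = sat ({?a} \<union> ?y' ` {1..k})"
  proof -
    have diff: "y l - ?y' l \<in> sat ({?a} \<union> Z)" for l Z
    proof -
      have "u i \<in> pideal.span {?a}"
        unfolding u_eq[OF ij(1)] by (intro pideal_span_mult_right pideal.span_base) simp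
      then have "pideal.span {u i} \<subseteq> pideal.span {?a}" by (intro span_subset_of_span) simp
      moreover have "y l - ?y' l \<in> pideal.span {u i}"
        using complete_sym_remove[of "S - {i}" i u l] S(1) ij(1) by (simp add: insert_absorb)
      ultimately have "y l - ?y' l \<in> sat {?a}" using span_subset_sat by blast
      then show ?thesis using sat_mono[of "{?a}" "{?a} \<union> Z"] by auto
    qed
    show ?thesis
    proof (rule sat_eqI)
      have "(y l - ?y' l) + ?y' l \<in> sat ({?a} \<union> ?y' ` {1..k})" if "l \<in> {1..k}" for l
        using that by (intro sat_add diff sat_base) auto
      then show "{?a} \<union> y ` {1..k} \<subseteq> sat ({?a} \<union> ?y' ` {1..k})" by (auto intro: sat_base)
      have "y l - (y l - ?y' l) \<in> sat ({?a} \<union> y ` {1..k})" if "l \<in> {1..k}" for l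
        by (rule sat_diff[OF sat_base diff]) (use that in auto)
      then show "{?a} \<union> ?y' ` {1..k} \<subseteq> sat ({?a} \<union> y ` {1..k})" by (auto intro: sat_base)
    qed
  qed
  ultimately show ?thesis
    using regular_mod_cong[of "insert ?a (f ` {1..k})" "insert ?a (y ` {1..k})" "indet j ^ t" "indet j ^ t"]
    by (simp add: sat_0)
qed

text \<open>Applies \<open>regular_mod_products\<close> over all of \<open>{1..n}\<close>. Indices
  in \<open>T\<close> give units; for those in \<open>S\<close> the pairwise condition concerns
  \<open>k + 1\<close> symmetric polynomials, whence \<open>k + 3 \<le> card S\<close>.\<close>

lemma y_regular_mod_generators:
  assumes ST: "S \<union> T = {1..n}" and T: "\<And>i. i \<in> T \<Longrightarrow> indet i ^ t \<in> W" and k: "k + 3 \<le> card S"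
  shows "regular_mod (y (Suc k)) (generator n t ` {1..n} \<union> y ` {1..k})"
proof -
  have ins: "insert (y (Suc k)) (y ` {1..k}) = y ` {1..Suc k}"
    by (simp add: atLeastAtMostSuc_conv)
  have "S \<noteq> {}" using k by auto
  then have ne: "{1..n} \<noteq> {}" using ST by auto
  have "regular_mod (y (Suc k)) (y ` {1..<Suc k})" using k by (intro y_regular) auto
  then have reg: "regular_mod (y (Suc k)) (y ` {1..k})" by (simp add: atLeastLessThanSuc_atLeastAtMost)
  have "regular_mod (y (Suc k)) ((\<lambda>i. \<Prod>j\<in>{1..n} - {i}. indet j ^ t) ` {1..n} \<union> y ` {1..k})"
  proof (rule regular_mod_products[OF _ ne reg], simp)
    fix i assume i: "i \<in> {1..n}"
    show "regular_mod (indet i ^ t) (insert (y (Suc k)) (y ` {1..k}))"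
    proof (cases "i \<in> T")
      case True
      then show ?thesis by (intro regular_mod_unit T)
    next
      case False
      with i have "i \<in> S" unfolding ST[symmetric] by simp
      with k show ?thesis unfolding ins by (intro indet_power_regular) simp_all
    qed
    fix j assume j: "j \<in> {1..n}" "i \<noteq> j"
    show "regular_mod (indet j ^ t) (insert (indet i ^ t) (insert (y (Suc k)) (y ` {1..k})))"
    proof (cases "i \<in> T \<or> j \<in> T")
      case True
      then show ?thesis using T regular_mod_unit regular_mod_unit_insert by blast
    next
      case False
      with i j(1) have "i \<in> S" "j \<in> S" unfolding ST[symmetric] by simp_all
      with k j(2) show ?thesis unfolding ins by (intro indet_power_pair_regular) simp_all
    qed
  qed
  then show ?thesis by (simp add: generator_def[abs_def])
qed

end

subsection \<open>The Cohen-Macaulay property\<close>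

lemma complete_sym_in_prime:
  assumes P: "primeideal P (polynomial_ring n)" and A: "finite A"
    and u: "\<And>i. i \<in> A \<Longrightarrow> u i \<in> P"
  shows "k \<ge> 1 \<Longrightarrow> complete_sym u A k \<in> P"
  using A u
proof (induction A arbitrary: k rule: finite_induct)
  case empty
  then show ?case using primeideal_polysD(2)[OF P] by simp
next
  case (insert i A)
  obtain k' where k': "k = Suc k'" using insert.prems(1) by (cases k) auto
  have "complete_sym u (insert i A) k' \<in> polys {1..n}"
    using insert primeideal_polysD(1)[OF P] by (intro complete_sym_in_polys) auto
  then have "complete_sym u (insert i A) k' * u i \<in> P"
    using insert.prems(2) by (intro primeideal_polysD(5)[OF P]) auto
  moreover have "complete_sym u A k \<in> P" using insert by auto
  ultimately show ?case
    unfolding k' complete_sym_insert[OF insert.hyps] mult.commute[of "u i"]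
    by (intro primeideal_polysD(3)[OF P])
qed

text \<open>With \<open>D = n - 2 - card T\<close>, the dimension is at most \<open>D\<close> by
  \<open>chain_length_bound\<close>, the depth is at least \<open>D\<close> by the symmetric
  polynomials, and depth never exceeds dimension.\<close>

lemma (in poly_localization) depth_eq_dim:
  assumes G: "G = generator n t ` {1..n}" and n: "n \<ge> 1" and t: "t \<ge> 1"
  shows "local_depth L = krull_dim L"
proof -
  note Md = primeideal_polysD[OF prime_M] and W_closed = W_mult
  define \<T> where "\<T> = {T \<in> Pow {1..n}. M \<inter> polys T \<subseteq> {0}}"
  have "M \<inter> polys {} \<subseteq> {0}"
  proof
    fix p assume p: "p \<in> M \<inter> polys {}"
    then obtain c where c: "p = Const c" by (auto simp: polys_empty)
    show "p \<in> {0}"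
    proof (rule ccontr)
      assume "p \<notin> {0}"
      then have "c \<noteq> 0" using c by auto
      then have "Const (inverse c) * p = 1" by (simp add: c flip: Const_mult)
      moreover have "Const (inverse c) * p \<in> M" using p by (intro Md(5)) auto
      ultimately show False using Md(6) by simp
    qed
  qed
  then have "{} \<in> \<T>" by (simp add: \<T>_def)
  moreover have "finite \<T>" by (simp add: \<T>_def)
  ultimately obtain T where "T \<in> \<T>" and maxT: "\<And>T'. T' \<in> \<T> \<Longrightarrow> T \<subseteq> T' \<Longrightarrow> T' = T"
    using finite_has_maximal[of \<T>] by (metis empty_iff)
  then have T: "T \<subseteq> {1..n}" "M \<inter> polys T \<subseteq> {0}" by (auto simp: \<T>_def)
  define S where "S = {1..n} - T"
  \<comment> \<open>By maximality of \<open>T\<close>, each further variable produces a nonzero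
    element of \<open>M\<close>.\<close>
  have "\<exists>Q. Q \<in> M \<and> Q \<in> polys (insert i T) \<and> Q \<noteq> 0" if "i \<in> S" for i
  proof (rule ccontr)
    assume "\<not> ?thesis"
    then have "insert i T \<in> \<T>" using that T(1) by (auto simp: \<T>_def S_def)
    from maxT[OF this] that show False by (auto simp: S_def)
  qed
  then obtain Q where Q: "\<And>i. i \<in> S \<Longrightarrow> Q i \<in> M" "\<And>i. i \<in> S \<Longrightarrow> Q i \<in> polys (insert i T)"
    "\<And>i. i \<in> S \<Longrightarrow> Q i \<noteq> 0" by metis
  define u where "u i = indet i ^ t * Q i" for i
  \<comment> \<open>A smaller multiplicative set than \<open>W\<close>: its elements involve only
    \<open>T\<close>, as the triangular argument demands, and they avoid \<open>M\<close> by the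
    choice of \<open>T\<close>.\<close>
  define W' :: "'k mpoly set" where "W' = {s \<in> polys T. s \<noteq> 0}"
  have univ_u: "univ i (u i) = [:0, 1:] ^ t * univ i (Q i)" for i
    by (simp add: u_def univ_mult univ_power univ_indet)
  have Sp: "indet i \<in> polys {1..n}" if "i \<in> S" for i using that by (intro polys_indet) (auto simp: S_def)
  interpret parameter_system W' T S t u Q
  proof
    show "1 \<in> W'" "W' \<subseteq> polys T" "0 \<notin> W'" by (auto simp: W'_def)
    show "s * s' \<in> W'" if "s \<in> W'" "s' \<in> W'" for s s' using that by (auto simp: W'_def intro: polys_mult)
    show "finite S" "S \<inter> T = {}" by (auto simp: S_def)
    fix i assume i: "i \<in> S"
    show "u i \<in> polys (insert i T)"
      unfolding u_def using Q(2)[OF i] by (intro polys_mult polys_power polys_indet) auto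
    show "u i = indet i ^ t * Q i" by (rule u_def)
    have nz: "univ i (Q i) \<noteq> 0" using Q(3)[OF i] by simp
    show "Polynomial.degree (univ i (u i)) > 0"
      unfolding univ_u using nz t by (subst degree_mult_eq) (auto simp: degree_power_eq)
    have "Polynomial.lead_coeff (univ i (u i)) = Polynomial.lead_coeff (univ i (Q i))"
      unfolding univ_u by (simp only: lead_coeff_mult lead_coeff_power) simp
    moreover have "Polynomial.lead_coeff (univ i (Q i)) \<in> W'"
      using nz Q(2)[OF i] i unfolding W'_def by (auto simp: S_def intro!: coeff_univ_in_polys)
    ultimately show "Polynomial.lead_coeff (univ i (u i)) \<in> W'" by simp
  qed
  define D where "D = n - 2 - card T"
  have cS: "card S = n - card T" unfolding S_def using T(1) finite_subset[OF T(1)] by (simp add: card_Diff_subset)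
  have uM: "u i \<in> M" if "i \<in> S" for i
    unfolding u_def using Q(1)[OF that] Sp[OF that] by (intro Md(5) polys_power)
  have sub: "W' \<subseteq> W"
    using T polys_mono[OF T(1)] by (auto simp: W'_def)
  have "krull_dim L \<le> enat D"
  proof (rule krull_dim_le)
    fix P :: "nat \<Rightarrow> 'k mpoly set" and d
    assume P: "\<And>i. i \<le> d \<Longrightarrow> primeideal (P i) R" "\<And>i. i < d \<Longrightarrow> P i \<subset> P (Suc i)" "G \<subseteq> P 0" "P d \<subseteq> M"
    obtain i j where "i \<in> {1..n}" "j \<in> {1..n}" "i \<noteq> j" "indet i \<in> P 0" "indet j \<in> P 0"
      using two_indets_in_prime[OF P(1)[of 0] n] P(3) G by blast
    from chain_length_bound[OF P(1,2) this T(1)] P(4) T(2) have "d + card T \<le> n - 2" by blast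
    then show "d \<le> D" by (simp add: D_def)
  qed
  moreover have "enat D \<le> local_depth L"
  proof -
    \<comment> \<open>\<open>y 0\<close> is the constant one, so the sequence starts with
      \<open>y 1\<close> and position \<open>i\<close> holds \<open>y (Suc i)\<close>.\<close>
    define ys where "ys = map y [1..<Suc D]"
    have len: "length ys = D" by (simp add: ys_def)
    have nth: "ys ! i = y (Suc i)" if "i < D" for i using that by (simp add: ys_def del: upt_Suc)
    have take: "set (take i ys) = y ` {1..i}" if "i < D" for i
      using that by (simp add: ys_def take_map take_upt atLeastLessThanSuc_atLeastAtMost del: upt_Suc)
    have "enat (length ys) \<le> local_depth L"
    proof (rule length_le_local_depth)
      show "set ys \<subseteq> M"
        using complete_sym_in_prime[OF prime_M, of S u] uM by (auto simp: ys_def S_def)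
      fix i a w assume i: "i < length ys" and w: "w \<in> W"
        and "w * (ys ! i * a) \<in> pideal.span (G \<union> set (take i ys))"
      \<comment> \<open>\<open>w\<close> may lie outside \<open>W'\<close>, so it is kept with
        \<open>a\<close>; the multiplier \<open>s\<close> from \<open>W'\<close> found below is
        merged with it inside \<open>W\<close>.\<close>
      then have "y (Suc i) * (w * a) \<in> pideal.span (G \<union> y ` {1..i})"
        by (simp add: len nth take mult.left_commute)
      then have "y (Suc i) * (w * a) \<in> sat (G \<union> y ` {1..i})" by (rule span_subset_sat)
      moreover have "regular_mod (y (Suc i)) (G \<union> y ` {1..i})"
        unfolding G
      proof (rule y_regular_mod_generators)
        show "S \<union> T = {1..n}" using T(1) by (auto simp: S_def)
        show "i + 3 \<le> card S" using i by (simp add: len D_def cS)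
        fix j assume "j \<in> T"
        then show "indet j ^ t \<in> W'" by (simp add: W'_def polys_power polys_indet)
      qed
      ultimately have "w * a \<in> sat (G \<union> y ` {1..i})" by (simp add: regular_mod_def)
      then obtain s where s: "s \<in> W'" "s * (w * a) \<in> pideal.span (G \<union> y ` {1..i})" by (auto simp: sat_def)
      then have "(s * w) * a \<in> pideal.span (G \<union> set (take i ys))" using i by (simp add: len take mult.assoc)
      moreover have "s * w \<in> W" using s(1) sub w by (intro W_closed) auto
      ultimately show "\<exists>v\<in>W. v * a \<in> pideal.span (G \<union> set (take i ys))" by blast
    qed
    then show ?thesis by (simp add: len)
  qed
  moreover have "local_depth L \<le> krull_dim L" by (rule L.local_depth_le_krull_dim)
  ultimately show ?thesis by simp
qed

theorem mainTheorem1: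
  fixes n t :: nat
  assumes "n \<ge> 3" and "t \<ge> 1"
  shows "cohen_macaulay_ideal
           (monomial_ideal n t :: ((nat \<Rightarrow>\<^sub>0 nat) \<Rightarrow>\<^sub>0 'k::field) set) (polynomial_ring n)"
proof -
  let ?R = "polynomial_ring n :: 'k mpoly ring" and ?I = "monomial_ideal n t :: 'k mpoly set"
  interpret R: cring ?R by (rule cring_polynomial_ring)
  have G: "generator n t ` {1..n} \<subseteq> (polys {1..n} :: 'k mpoly set)" using generator_in_polys by blast
  have id: "ideal ?I ?R"
    unfolding monomial_ideal_def by (rule R.genideal_ideal) (use G in simp)
  interpret I: ideal ?I ?R by (rule id)
  interpret A: cring "?R Quot ?I" by (rule I.quotient_is_cring[OF R.is_cring])
  have "local_depth (localization_at (?R Quot ?I) N) = krull_dim (localization_at (?R Quot ?I) N)"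
    if "maximalideal N (?R Quot ?I)" for N
  proof -
    \<comment> \<open>A maximal ideal of the quotient is prime, so its localization has the form to
      which \<open>depth_eq_dim\<close> applies.\<close>
    from poly_localization_Quot[OF G monomial_ideal_def A.maximalideal_prime[OF that]]
    obtain M \<pi> where "poly_localization (localization_at (?R Quot ?I) N) n (generator n t ` {1..n} :: 'k mpoly set) M \<pi>"
      by blast
    from poly_localization.depth_eq_dim[OF this refl] assms show ?thesis by simp
  qed
  then show ?thesis
    unfolding cohen_macaulay_ideal_def cohen_macaulay_ring_def
    using id A.is_cring noetherian_ring_Quot[OF noetherian_polynomial_ring id] by blast
qed

end
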